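(* Let $p\ge 1$ be an integer, let $a_1,\ldots,a_{p+1},b_1,\ldots,b_p$ be complex numbers with no $a_j$ equal to a nonpositive integer, and put $s_p=b_1+\cdots+b_p-a_1-a_2-\cdots-a_{p+1}$. Suppose $\Re(a_j)>0$ for $j=3,\ldots,p+1$. If $s_p$ is equal to a negative integer $-t$, then the infinite series over $k$ below converges and $$\sum_{l=0}^{m-1}\frac{\Gamma(a_1+l)\Gamma(a_2+l)\cdots\Gamma(a_{p+1}+l)}{\Gamma(b_1+l)\cdots\Gamma(b_p+l)\Gamma(1+l)}$$ $$=\sum_{n=0}^{t-1}(-1)^n\frac{1}{t-n}\,\frac{(a_1-t)_n(a_2-t)_n}{\Gamma(1+n)}\,\frac{\Gamma(t-n+m)}{\Gamma(m)}\sum_{k=0}^{n}\frac{(-n)_k}{(a_1-t)_k(a_2-t)_k}A_k^{(p)}$$ $$+\sum_{k=1}^\infty\frac{\Gamma(k)}{(a_1)_k(a_2)_k}A_{t+k}^{(p)}$$ $$+(-1)^t\frac{(a_1-t)_t(a_2-t)_t}{\Gamma(1+t)}\sum_{k=0}^{t}\frac{(-t)_k}{(a_1-t)_k(a_2-t)_k}A_k^{(p)}\,\bigl[\psi(1+t-k)-\psi(a_1)-\psi(a_2)+\psi(m)\bigr]$$ $$+(-1)^t\frac{(a_1-t)_{t+1}(a_2-t)_{t+1}}{\Gamma(2+t)}\sum_{k=0}^{t+1}\frac{(-t-1)_k}{(a_1-t)_k(a_2-t)_k}A_k^{(p)}\,(m-1)^{-1}$$ $$-(-1)^t\frac{(a_1-t)_{t+2}(a_2-t)_{t+2}}{2\,\Gamma(3+t)}\sum_{k=0}^{t+2}\frac{(-t-2)_k}{(a_1-t)_k(a_2-t)_k}A_k^{(p)}\,[(m-1)(m-2)]^{-1}+O(m^{-3})$$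 as $m\to\infty$ through the positive integers.
   Context: $\psi=\Gamma'/\Gamma$ is the digamma function. $(x)_n=x(x+1)\cdots(x+n-1)=\Gamma(x+n)/\Gamma(x)$ is the Pochhammer symbol, $(x)_0=1$. The coefficients $A_k^{(p)}=A_k^{(p)}(a_3,\ldots,a_{p+1};b_1,\ldots,b_p)$, $k=0,1,2,\ldots$, are defined recursively in $p$: $A_0^{(1)}=1$ and $A_k^{(1)}=0$ for $k>0$; for $p\ge2$, $$A_k^{(p)}(a_3,\ldots,a_{p+1};b_1,\ldots,b_p)=\sum_{j=0}^{k}\frac{\bigl(\sum_{i=2}^{p}b_i-\sum_{i=3}^{p+1}a_i+j\bigr)_{k-j}\,(b_1-a_3)_{k-j}}{(k-j)!}\,A_j^{(p-1)}(a_4,\ldots,a_{p+1};b_2,\ldots,b_p).$$ For example $A_k^{(2)}=(b_2-a_3)_k(b_1-a_3)_k/k!$ and $A_k^{(3)}=\sum_{j=0}^k\frac{(b_3+b_2-a_4-a_3+j)_{k-j}(b_1-a_3)_{k-j}(b_3-a_4)_j(b_2-a_4)_j}{(k-j)!\,j!}$. The parameters are fixed and $m\to\infty$. $1/\Gamma$ is regarded as an entire function (zero at nonpositive integers), and for $k\le n$ each quotient $(x)_n/(x)_k$ is read as $(x+k)_{n-k}$. *)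

theory Defs
  imports "HOL-Analysis.Analysis" "HOL-Library.Landau_Symbols"
begin

text \<open>
  The coefficient \<open>A\<^sub>k\<^sup>(\<^sup>p\<^sup>)(a\<^sub>3, \<dots>, a\<^sub>p\<^sub>+\<^sub>1; b\<^sub>1, \<dots>, b\<^sub>p)\<close>. The parameter tuples are passed as functions
  on \<^typ>\<open>nat\<close> with 1-based indices, of which only \<open>a 3, \<dots>, a (p + 1)\<close> and \<open>b 1, \<dots>, b p\<close> are used.
  Since the tuple \<open>a\<close> always starts at index 3 and \<open>b\<close> at index 1, passing to
  \<open>(a\<^sub>4, \<dots>, a\<^sub>p\<^sub>+\<^sub>1; b\<^sub>2, \<dots>, b\<^sub>p)\<close> shifts both functions by one. The value at \<open>p = 0\<close> is junk.
\<close>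

fun coeffA :: "nat \<Rightarrow> (nat \<Rightarrow> complex) \<Rightarrow> (nat \<Rightarrow> complex) \<Rightarrow> nat \<Rightarrow> complex" where
  "coeffA 0 a b k = 0"
| "coeffA (Suc 0) a b k = (if k = 0 then 1 else 0)"
| "coeffA (Suc (Suc q)) a b k =
     (\<Sum>j\<le>k. pochhammer ((\<Sum>i=2..q + 2. b i) - (\<Sum>i=3..q + 3. a i) + of_nat j) (k - j)
              * pochhammer (b 1 - a 3) (k - j) / fact (k - j)
              * coeffA (Suc q) (\<lambda>i. a (Suc i)) (\<lambda>i. b (Suc i)) j)"

text \<open>
  The quotient \<open>(x)\<^sub>n / (x)\<^sub>k\<close> for \<open>k \<le> n\<close>, read as \<open>(x + k)\<^sub>n\<^sub>-\<^sub>k\<close> so that it is meaningful also when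
  \<open>(x)\<^sub>k = 0\<close>.
\<close>

definition poch_quot :: "complex \<Rightarrow> nat \<Rightarrow> nat \<Rightarrow> complex" where
  "poch_quot x n k = pochhammer (x + of_nat k) (n - k)"

end

theory Submission
  imports Defs
begin

text \<open>
  The proof reduces the general case to \<open>p = 1\<close> by an expansion in an inverse factorial series. Put
  \<open>\<sigma> = b\<^sub>1 + \<dots> + b\<^sub>p - a\<^sub>3 - \<dots> - a\<^sub>p\<^sub>+\<^sub>1\<close>, so that \<open>\<sigma> = a\<^sub>1 + a\<^sub>2 - t\<close>. The coefficients \<open>A\<^sub>k\<close> are made such that
  \<open>\<Gamma>(a\<^sub>3 + l) \<dots> \<Gamma>(a\<^sub>p\<^sub>+\<^sub>1 + l) / (\<Gamma>(b\<^sub>1 + l) \<dots> \<Gamma>(b\<^sub>p + l))\<close> is the sum of \<open>A\<^sub>k / \<Gamma>(\<sigma> + l + k)\<close> over \<open>k\<close>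
  (\<open>Gamma_quotient_expansion\<close>). The sum over \<open>l < m\<close> is therefore the series over \<open>k\<close> of \<open>A\<^sub>k\<close> times the partial sums of
  \<open>h\<^sub>k(l) = \<Gamma>(a\<^sub>1 + l) \<Gamma>(a\<^sub>2 + l) / (l! \<Gamma>(a\<^sub>1 + a\<^sub>2 - \<tau> + l))\<close> with \<open>\<tau> = t - k\<close>, a function of size \<open>l\<^bsup>\<tau> - 1\<^esup>\<close>.

  For fixed \<open>k\<close>, \<open>h\<^sub>k(l)\<close> has an asymptotic expansion in the functions \<open>\<Gamma>(\<tau> - n + l) / l!\<close> (\<open>hyp_expansion\<close>), which
  are explicit differences in \<open>l\<close>; the one with \<open>n = \<tau>\<close> is \<open>1 / l\<close> and produces \<open>\<psi>(m)\<close>. This gives the partial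
  sums up to a constant. For \<open>k > t\<close> the constant is the sum of a convergent series, known by Gauss's
  theorem (\<open>gauss_summation\<close>). For \<open>k = t\<close> it is the limit \<open>\<delta> \<rightarrow> 0\<close> of Gauss's theorem after removal of a pole
  (\<open>hyp_sum_log_constant\<close>), and for \<open>k < t\<close> it follows from the contiguous relation (\<open>hyp_sum_constant\<close>).

  Summation over infinitely many \<open>k\<close> rests on the bound \<open>A\<^sub>k = O(\<bar>\<Gamma>(\<sigma> + k)\<bar> k\<^bsup>-1 - \<epsilon>\<^esup>)\<close> for \<open>0 < \<epsilon> < min Re a\<^sub>j\<close>
  (\<open>coeffA_regular\<close>). Up to Gamma factors the recursion for \<open>A\<^sub>k\<close> is a convolution with \<open>(\<beta>)\<^sub>n / n!\<close>, where \<open>\<beta> = b\<^sub>1 - a\<^sub>3\<close>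
  may have negative real part. Estimating the convolution termwise is then too crude; the
  induction on \<open>p\<close> works in the class of sequences whose differences decay like those of a power
  (\<open>regular_conv\<close>). The same difficulty appears in the expansion itself: the double series behind
  it converges absolutely only for large \<open>Re b\<^sub>1\<close>, and other \<open>b\<^sub>1\<close> are reached through a contiguous
  relation for the coefficients (\<open>expansion_descent\<close>).
\<close>

section \<open>Polynomial growth of sequences\<close>

text \<open>The argument \<open>n + 1\<close> keeps the comparison function positive, so that changing finitely many terms is harmless.\<close>

definition growth :: "real \<Rightarrow> (nat \<Rightarrow> complex) \<Rightarrow> bool" where
  "growth s f \<longleftrightarrow> (\<exists>C. \<forall>n. norm (f n) \<le> C * real (Suc n) powr s)"

lemma growthI: "(\<And>n. norm (f n) \<le> C * real (Suc n) powr s) \<Longrightarrow> growth s f"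
  by (auto simp: growth_def)

lemma growthE:
  assumes "growth s f"
  obtains C where "C \<ge> 0" "\<And>n. norm (f n) \<le> C * real (Suc n) powr s"
proof -
  obtain C where C: "norm (f n) \<le> C * real (Suc n) powr s" for n
    using assms by (auto simp: growth_def)
  have "0 \<le> norm (f 0)" by simp
  also have "\<dots> \<le> C" using C[of 0] by simp
  finally show ?thesis using C that by blast
qed

text \<open>Finitely many values are absorbed by the constant, so Gamma identities are only needed away from the poles.\<close>

lemma growth_cong_eventually:
  assumes f: "growth s f" and eq: "eventually (\<lambda>n. f n = g n) sequentially"
  shows "growth s g"
proof -
  obtain C where C: "C \<ge> 0" "\<And>n. norm (f n) \<le> C * real (Suc n) powr s"
    using f growthE by blast
  from eq obtain N where N: "\<And>n. n \<ge> N \<Longrightarrow> f n = g n"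
    by (auto simp: eventually_sequentially)
  define D where "D = C + (\<Sum>n<N. norm (g n) / real (Suc n) powr s)"
  show ?thesis
  proof (rule growthI[where C = D])
    fix n
    show "norm (g n) \<le> D * real (Suc n) powr s"
    proof (cases "n \<ge> N")
      case True
      have "C \<le> D" unfolding D_def by (simp add: sum_nonneg)
      then have "C * real (Suc n) powr s \<le> D * real (Suc n) powr s"
        by (intro mult_right_mono) auto
      from order_trans[OF C(2)[of n] this] N[OF True] show ?thesis by metis
    next
      case False
      then have "norm (g n) / real (Suc n) powr s \<le> (\<Sum>n<N. norm (g n) / real (Suc n) powr s)"
        by (intro member_le_sum) auto
      also have "\<dots> \<le> D" using C by (simp add: D_def)
      finally show ?thesis by (simp add: divide_simps mult.commute split: if_splits)
    qed
  qed
qed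

lemma growth_mono:
  assumes "growth s f" "s \<le> r"
  shows "growth r f"
proof -
  obtain C where C: "C \<ge> 0" "\<And>n. norm (f n) \<le> C * real (Suc n) powr s"
    using assms(1) growthE by blast
  have "C * real (Suc n) powr s \<le> C * real (Suc n) powr r" for n
    using C(1) assms(2) by (intro mult_left_mono powr_mono) auto
  with C(2) show ?thesis by (intro growthI[where C = C]) (meson order_trans)
qed

lemma growth_mult:
  assumes "growth s f" "growth r g"
  shows "growth (s + r) (\<lambda>n. f n * g n)"
proof -
  obtain C where C: "C \<ge> 0" "\<And>n. norm (f n) \<le> C * real (Suc n) powr s"
    using assms(1) growthE by blast
  obtain D where D: "D \<ge> 0" "\<And>n. norm (g n) \<le> D * real (Suc n) powr r"
    using assms(2) growthE by blast
  show ?thesis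
  proof (rule growthI[where C = "C * D"])
    fix n
    have "norm (f n * g n) \<le> (C * real (Suc n) powr s) * (D * real (Suc n) powr r)"
      unfolding norm_mult using C D by (intro mult_mono) auto
    then show "norm (f n * g n) \<le> C * D * real (Suc n) powr (s + r)"
      by (simp add: powr_add mult_ac)
  qed
qed

lemma growth_add:
  assumes "growth s f" "growth s g"
  shows "growth s (\<lambda>n. f n + g n)"
proof -
  obtain C where C: "C \<ge> 0" "\<And>n. norm (f n) \<le> C * real (Suc n) powr s"
    using assms(1) growthE by blast
  obtain D where D: "D \<ge> 0" "\<And>n. norm (g n) \<le> D * real (Suc n) powr s"
    using assms(2) growthE by blast
  show ?thesis
  proof (rule growthI[where C = "C + D"])
    fix n
    show "norm (f n + g n) \<le> (C + D) * real (Suc n) powr s"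
      using norm_triangle_ineq[of "f n" "g n"] C(2)[of n] D(2)[of n]
      by (simp add: distrib_right)
  qed
qed

lemma growth_const: "growth 0 (\<lambda>_. c)"
  by (rule growthI[where C = "norm c"]) simp

lemma growth_cmult: "growth s f \<Longrightarrow> growth s (\<lambda>n. c * f n)"
  using growth_mult[OF growth_const[of c], of s f] by simp

lemma growth_zero: "growth s (\<lambda>_. 0)"
  by (rule growthI[where C = 0]) simp

lemma growth_sum: "(\<And>i. i \<in> I \<Longrightarrow> growth s (f i)) \<Longrightarrow> growth s (\<lambda>n. \<Sum>i\<in>I. f i n)"
  by (induction I rule: infinite_finite_induct) (auto intro: growth_zero growth_add)

text \<open>Used to replace an index between \<open>k / 2\<close> and \<open>k\<close> by \<open>k\<close> itself.\<close>

lemma powr_comparable: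
  fixes x y s :: real
  assumes "0 < x" "x \<le> 2 * y" "y \<le> 2 * x"
  shows "x powr s \<le> 2 powr \<bar>s\<bar> * y powr s"
proof -
  have "\<bar>ln x - ln y\<bar> \<le> ln 2"
  proof -
    have "ln x \<le> ln (2 * y)" "ln y \<le> ln (2 * x)" using assms by (simp_all add: ln_mono)
    then show ?thesis using assms by (auto simp: ln_mult)
  qed
  then have "s * (ln x - ln y) \<le> \<bar>s\<bar> * ln 2"
    using mult_left_mono[of "\<bar>ln x - ln y\<bar>" "ln 2" "\<bar>s\<bar>"] abs_ge_self[of "s * (ln x - ln y)"]
    by (simp add: abs_mult)
  then have "exp (s * ln x) \<le> exp (\<bar>s\<bar> * ln 2 + s * ln y)"
    by (simp add: algebra_simps)
  then show ?thesis using assms by (simp add: powr_def exp_add)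
qed

text \<open>In terms of generating functions, \<open>lag\<close> is multiplication by \<open>x\<close> and \<open>bdiff\<close> below is multiplication by \<open>1 - x\<close>.\<close>

definition lag :: "(nat \<Rightarrow> complex) \<Rightarrow> nat \<Rightarrow> complex" where
  "lag f n = (if n = 0 then 0 else f (n - 1))"

lemma lag_0 [simp]: "lag f 0 = 0" and lag_Suc [simp]: "lag f (Suc n) = f n"
  by (simp_all add: lag_def)

lemma growth_lag:
  assumes "growth s f"
  shows "growth s (lag f)"
proof -
  obtain C where C: "C \<ge> 0" "\<And>n. norm (f n) \<le> C * real (Suc n) powr s"
    using assms(1) growthE by blast
  show ?thesis
  proof (rule growthI[where C = "C * 2 powr \<bar>s\<bar>"])
    fix n
    show "norm (lag f n) \<le> C * 2 powr \<bar>s\<bar> * real (Suc n) powr s"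
    proof (cases n)
      case (Suc m)
      have "C * real (Suc m) powr s \<le> C * (2 powr \<bar>s\<bar> * real (Suc n) powr s)"
        using C Suc by (intro mult_left_mono powr_comparable) auto
      with C(2)[of m] show ?thesis by (simp add: Suc)
    qed (use C in auto)
  qed
qed

lemma growth_Suc:
  assumes "growth s f"
  shows "growth s (\<lambda>n. f (Suc n))"
proof -
  obtain C where C: "C \<ge> 0" "\<And>n. norm (f n) \<le> C * real (Suc n) powr s"
    using assms(1) growthE by blast
  show ?thesis
  proof (rule growthI[where C = "C * 2 powr \<bar>s\<bar>"])
    fix n
    have "C * real (Suc (Suc n)) powr s \<le> C * (2 powr \<bar>s\<bar> * real (Suc n) powr s)"
      using C by (intro mult_left_mono powr_comparable) auto
    with C(2)[of "Suc n"] show "norm (f (Suc n)) \<le> C * 2 powr \<bar>s\<bar> * real (Suc n) powr s"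
      by simp
  qed
qed

lemma growth_shift: "growth s f \<Longrightarrow> growth s (\<lambda>n. f (n + k))"
  by (induction k) (auto dest: growth_Suc)

lemma summable_Suc_powr: "s < -1 \<Longrightarrow> summable (\<lambda>n. real (Suc n) powr s)"
  using summable_real_powr_iff[of s] summable_Suc_iff[of "\<lambda>n. real n powr s"] by simp

lemma growth_summable:
  assumes "growth s f" "s < -1"
  shows "summable (\<lambda>n. norm (f n))" "summable f"
proof -
  obtain C where C: "C \<ge> 0" "\<And>n. norm (f n) \<le> C * real (Suc n) powr s"
    using assms(1) growthE by blast
  show "summable (\<lambda>n. norm (f n))"
    by (rule summable_comparison_test'[where N = 0, OF summable_mult[OF summable_Suc_powr[OF assms(2)], of C]])
       (use C in auto)
  then show "summable f" by (rule summable_norm_cancel)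
qed

lemma growth_tendsto_0:
  assumes "growth s f" "s < 0"
  shows "f \<longlonglongrightarrow> 0"
proof -
  obtain C where C: "C \<ge> 0" "\<And>n. norm (f n) \<le> C * real (Suc n) powr s"
    using assms(1) growthE by blast
  have "(\<lambda>n. real (Suc n) powr s) \<longlonglongrightarrow> 0"
    by (intro tendsto_neg_powr assms filterlim_compose[OF filterlim_real_sequentially filterlim_Suc])
  then have "(\<lambda>n. C * real (Suc n) powr s) \<longlonglongrightarrow> 0"
    using tendsto_mult_right_zero by blast
  then show ?thesis
    by (rule Lim_null_comparison[rotated]) (use C in \<open>auto intro!: always_eventually\<close>)
qed

text \<open>These turn sums of powers into telescoping sums.\<close>

lemma powr_diff_ge:
  fixes x p :: real
  assumes "x > 0"
  shows "p > 0 \<Longrightarrow> p \<le> 1 \<Longrightarrow> p * (x + 1) powr (p - 1) \<le> (x + 1) powr p - x powr p"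
    and "p < 0 \<Longrightarrow> - p * (x + 1) powr (p - 1) \<le> x powr p - (x + 1) powr p"
proof -
  obtain z where z: "x < z" "z < x + 1"
    and eq: "(x + 1) powr p - x powr p = (x + 1 - x) * (p * z powr (p - 1))"
  proof -
    have "\<exists>z>x. z < x + 1 \<and> (x + 1) powr p - x powr p = (x + 1 - x) * (p * z powr (p - 1))"
      using assms by (intro MVT2 has_real_derivative_powr) auto
    then show thesis using that by blast
  qed
  have le: "(x + 1) powr (p - 1) \<le> z powr (p - 1)" if "p \<le> 1"
    using z assms that by (intro powr_mono2') auto
  show "p > 0 \<Longrightarrow> p \<le> 1 \<Longrightarrow> p * (x + 1) powr (p - 1) \<le> (x + 1) powr p - x powr p"
    using le eq by simp
  show "p < 0 \<Longrightarrow> - p * (x + 1) powr (p - 1) \<le> x powr p - (x + 1) powr p"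
  proof -
    assume "p < 0"
    then have "p * z powr (p - 1) \<le> p * (x + 1) powr (p - 1)"
      using le by (intro mult_left_mono_neg) auto
    then show ?thesis using eq by simp
  qed
qed

lemma sum_Suc_powr_le:
  assumes "s > -1"
  obtains C where "C \<ge> 0" "\<And>k. (\<Sum>j<k. real (Suc j) powr s) \<le> C * real k powr (s + 1)"
proof (cases "s \<ge> 0")
  case True
  have "(\<Sum>j<k. real (Suc j) powr s) \<le> 1 * real k powr (s + 1)" for k
  proof (cases "k = 0")
    case False
    have "(\<Sum>j<k. real (Suc j) powr s) \<le> (\<Sum>j<k. real k powr s)"
      using True by (intro sum_mono powr_mono2) auto
    also have "\<dots> = real k powr (s + 1)" using False by (simp add: powr_add)
    finally show ?thesis by simp
  qed auto
  then show ?thesis using that[of 1] by simp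
next
  case False
  define C where "C = 1 / (s + 1)"
  have C: "C \<ge> 1" using assms False by (simp add: C_def field_simps)
  have "(\<Sum>j<k. real (Suc j) powr s) \<le> C * real k powr (s + 1)" for k
  proof (induction k)
    case (Suc k)
    show ?case
    proof (cases "k = 0")
      case False
      have "(s + 1) * (real k + 1) powr (s + 1 - 1) \<le> (real k + 1) powr (s + 1) - real k powr (s + 1)"
        using assms \<open>\<not> s \<ge> 0\<close> False by (intro powr_diff_ge) auto
      then have "(real k + 1) powr s \<le> C * ((real k + 1) powr (s + 1) - real k powr (s + 1))"
        using assms by (simp add: C_def field_simps)
      then show ?thesis using Suc by (simp add: algebra_simps)
    qed (use C in auto)
  qed auto
  then show ?thesis using that[of C] C by simp
qed

text \<open>The increments are bounded by differences of \<open>n\<^sup>s\<^sup>+\<^sup>1\<close>, which telescope.\<close>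

lemma growth_from_increments:
  assumes inc: "growth s (\<lambda>n. F (Suc n) - F n)" and s: "s < -1" and lim: "F \<longlonglongrightarrow> L"
  shows "growth (s + 1) (\<lambda>n. F n - L)"
proof -
  obtain C where C: "C \<ge> 0" "\<And>n. norm (F (Suc n) - F n) \<le> C * real (Suc n) powr s"
    using inc growthE by blast
  define D where "D = C / (- (s + 1))"
  have D: "D \<ge> 0" using C(1) s unfolding D_def by (intro divide_nonneg_nonneg) auto
  have step: "C * (real n + 1) powr s \<le> D * (real n powr (s + 1) - (real n + 1) powr (s + 1))"
    if "n > 0" for n
  proof -
    have "- (s + 1) * (real n + 1) powr (s + 1 - 1) \<le> real n powr (s + 1) - (real n + 1) powr (s + 1)"
      using s that by (intro powr_diff_ge) auto
    then have "D * (- (s + 1) * (real n + 1) powr s) \<le> D * (real n powr (s + 1) - (real n + 1) powr (s + 1))"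
      using D by (intro mult_left_mono) auto
    moreover have "D * (- (s + 1)) = C" using s by (simp add: D_def field_simps)
    ultimately show ?thesis by (metis mult.assoc)
  qed
  have bound: "norm (F (n + k) - F n) \<le> D * (real n powr (s + 1) - real (n + k) powr (s + 1))"
    if "n > 0" for n k
  proof (induction k)
    case (Suc k)
    have "norm (F (n + Suc k) - F n) \<le> norm (F (Suc (n + k)) - F (n + k)) + norm (F (n + k) - F n)"
      using norm_triangle_ineq[of "F (Suc (n + k)) - F (n + k)" "F (n + k) - F n"] by simp
    also have "norm (F (Suc (n + k)) - F (n + k)) \<le> D * (real (n + k) powr (s + 1) - (real (n + k) + 1) powr (s + 1))"
      using C(2)[of "n + k"] step[of "n + k"] that by (simp add: add_ac)
    finally show ?case using Suc by (simp add: algebra_simps)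
  qed auto
  have "growth (s + 1) (\<lambda>n. F (Suc n) - L)"
  proof (rule growthI[where C = D])
    fix n
    have "(\<lambda>k. norm (F (Suc n + k) - F (Suc n))) \<longlonglongrightarrow> norm (L - F (Suc n))"
      by (intro tendsto_intros LIMSEQ_ignore_initial_segment[OF lim, of "Suc n", unfolded add.commute[of _ "Suc n"]])
    moreover have "norm (F (Suc n + k) - F (Suc n)) \<le> D * real (Suc n) powr (s + 1)" for k
    proof -
      have "D * (real (Suc n) powr (s + 1) - real (Suc n + k) powr (s + 1)) \<le> D * real (Suc n) powr (s + 1)"
        using D by (intro mult_left_mono) auto
      with bound[of "Suc n" k] show ?thesis by simp
    qed
    ultimately have "norm (L - F (Suc n)) \<le> D * real (Suc n) powr (s + 1)"
      by (intro LIMSEQ_le_const2) auto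
    then show "norm (F (Suc n) - L) \<le> D * real (Suc n) powr (s + 1)"
      by (simp add: norm_minus_commute)
  qed
  from growth_lag[OF this] show ?thesis
    by (rule growth_cong_eventually)
       (use eventually_gt_at_top[of "0::nat"] in eventually_elim, simp add: lag_def)
qed

section \<open>Quotients of Gamma functions at large arguments\<close>

lemma Re_pos_not_nonpos_Int: "Re z > 0 \<Longrightarrow> z \<notin> \<int>\<^sub>\<le>\<^sub>0"
  by (auto elim!: nonpos_Ints_cases)

lemma eventually_not_nonpos_Int:
  "eventually (\<lambda>n. (z :: complex) + of_nat n \<notin> \<int>\<^sub>\<le>\<^sub>0) sequentially"
proof -
  have "eventually (\<lambda>n. real n > - Re z) sequentially"
    using filterlim_real_sequentially by (auto simp: filterlim_at_top_dense)
  then show ?thesis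
    by eventually_elim (auto elim!: nonpos_Ints_cases simp: complex_eq_iff)
qed

lemma Gamma_Suc_arg:
  "z + of_nat n \<notin> \<int>\<^sub>\<le>\<^sub>0 \<Longrightarrow> Gamma (z + of_nat (Suc n)) = (z + of_nat n) * Gamma (z + of_nat n :: complex)"
  using Gamma_plus1[of "z + of_nat n"] by (simp add: add_ac)

lemma rGamma_Suc_arg: "(z + of_nat n) * rGamma (z + of_nat (Suc n)) = rGamma (z + of_nat n :: complex)"
  using rGamma_plus1[of "z + of_nat n"] by (simp add: add_ac)

lemma Gamma_mult_rGamma: "z \<notin> \<int>\<^sub>\<le>\<^sub>0 \<Longrightarrow> Gamma z * rGamma z = (1 :: complex)"
  by (simp add: rGamma_inverse_Gamma Gamma_eq_zero_iff)

text \<open>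
  Gauss's limit formula for \<open>\<Gamma>\<close> in the form \<open>\<Gamma>(z + n) / (\<Gamma>(n) n\<^sup>z) \<longlonglongrightarrow> 1\<close>. Poles of \<open>\<Gamma>(z)\<close> are no
  obstacle, since finitely many unit shifts of \<open>z\<close> lead away from them.
\<close>

definition Gamma_norm :: "complex \<Rightarrow> nat \<Rightarrow> complex" where
  "Gamma_norm z n = Gamma (z + of_nat n) / (Gamma (of_nat n) * of_nat n powr z)"

lemma of_nat_div_shift_tendsto_1: "(\<lambda>n. of_nat n / (z + of_nat n :: complex)) \<longlonglongrightarrow> 1"
proof -
  have "(\<lambda>n. inverse (z * inverse (of_nat n) + 1 :: complex)) \<longlonglongrightarrow> inverse (z * 0 + 1)"
    by (intro tendsto_intros tendsto_inverse_0_at_top) (auto intro: lim_inverse_n)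
  then have "(\<lambda>n. inverse (z * inverse (of_nat n) + 1 :: complex)) \<longlonglongrightarrow> 1" by simp
  moreover have "eventually (\<lambda>n. inverse (z * inverse (of_nat n) + 1 :: complex) = of_nat n / (z + of_nat n)) sequentially"
    using eventually_gt_at_top[of "0::nat"]
    by eventually_elim (simp add: field_simps)
  ultimately show ?thesis by (simp add: tendsto_cong)
qed

lemma Gamma_norm_tendsto_1: "Gamma_norm z \<longlonglongrightarrow> 1"
proof -
  have nonpole: "Gamma_norm z \<longlonglongrightarrow> 1" if z: "z \<notin> \<int>\<^sub>\<le>\<^sub>0" for z
  proof -
    have "(\<lambda>n. Gamma z * rGamma_series z n * (of_nat n / (z + of_nat n))) \<longlonglongrightarrow> Gamma z * rGamma z * 1"
      by (intro tendsto_intros of_nat_div_shift_tendsto_1)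
    then have "(\<lambda>n. Gamma z * rGamma_series z n * (of_nat n / (z + of_nat n))) \<longlonglongrightarrow> 1"
      using z by (simp add: Gamma_mult_rGamma)
    moreover have "eventually (\<lambda>n. Gamma z * rGamma_series z n * (of_nat n / (z + of_nat n)) = Gamma_norm z n) sequentially"
      using eventually_gt_at_top[of "0::nat"] eventually_not_nonpos_Int[of z]
    proof eventually_elim
      case (elim n)
      have nz: "z + of_nat n \<noteq> 0" using elim by auto
      obtain m where m: "n = Suc m" using elim by (cases n) auto
      have "Gamma (z + of_nat n) = Gamma z * pochhammer z n"
        using z by (simp add: pochhammer_Gamma Gamma_eq_zero_iff)
      moreover have "Gamma (of_nat n :: complex) = fact m"
        using Gamma_fact[of m, where ?'a = complex] by (simp add: m add_ac)
      moreover have "rGamma_series z n = (z + of_nat n) * pochhammer z n / (of_nat n * fact m * of_nat n powr z)"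
        using elim m by (simp add: rGamma_series_def pochhammer_rec' powr_def Ln_of_nat mult_ac del: of_nat_Suc)
      ultimately show ?case
        using nz elim by (simp add: Gamma_norm_def field_simps)
    qed
    ultimately show ?thesis by (simp add: tendsto_cong)
  qed
  have step: "Gamma_norm z \<longlonglongrightarrow> 1" if "Gamma_norm (z + 1) \<longlonglongrightarrow> 1" for z
  proof -
    have "(\<lambda>n. Gamma_norm (z + 1) n * (of_nat n / (z + of_nat n))) \<longlonglongrightarrow> 1 * 1"
      by (intro tendsto_intros that of_nat_div_shift_tendsto_1)
    moreover have "eventually (\<lambda>n. Gamma_norm (z + 1) n * (of_nat n / (z + of_nat n)) = Gamma_norm z n) sequentially"
      using eventually_gt_at_top[of "0::nat"] eventually_not_nonpos_Int[of z]
    proof eventually_elim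
      case (elim n)
      have nz: "z + of_nat n \<noteq> 0" using elim by auto
      have "Gamma (z + 1 + of_nat n) = (z + of_nat n) * Gamma (z + of_nat n)"
        using Gamma_Suc_arg[OF elim(2)] by (simp add: add_ac)
      then have "Gamma_norm (z + 1) n * (of_nat n / (z + of_nat n))
          = ((z + of_nat n) / (z + of_nat n)) * (of_nat n / of_nat n) *
            (Gamma (z + of_nat n) / (Gamma (of_nat n) * of_nat n powr z))"
        by (simp add: Gamma_norm_def powr_add mult_ac)
      then show ?case using nz elim by (simp add: Gamma_norm_def)
    qed
    ultimately show ?thesis by (simp add: tendsto_cong)
  qed
  have "Gamma_norm (z + of_nat N) \<longlonglongrightarrow> 1 \<Longrightarrow> Gamma_norm z \<longlonglongrightarrow> 1" for N
  proof (induction N)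
    case (Suc N)
    then show ?case using step[of "z + of_nat N"] by (simp add: add_ac)
  qed auto
  moreover obtain N where "z + of_nat N \<notin> \<int>\<^sub>\<le>\<^sub>0"
    using eventually_happens[OF eventually_not_nonpos_Int[of z]] by auto
  ultimately show ?thesis using nonpole by blast
qed

lemma Gamma_quot_eq_norm:
  assumes "n > 0"
  shows "Gamma (c + of_nat n) * rGamma (d + of_nat n) = Gamma_norm c n / Gamma_norm d n * of_nat n powr (c - d)"
proof -
  have "Gamma (of_nat n :: complex) \<noteq> 0" using assms by (auto simp: Gamma_eq_zero_iff elim!: nonpos_Ints_cases)
     (metis of_int_of_nat_eq of_int_eq_iff of_nat_0_less_iff not_le)
  then show ?thesis using assms
    by (simp add: Gamma_norm_def rGamma_inverse_Gamma powr_diff field_simps)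
qed

lemma Gamma_quot_growth: "growth (Re (c - d)) (\<lambda>n. Gamma (c + of_nat n) * rGamma (d + of_nat n))"
proof -
  have "(\<lambda>n. Gamma_norm c n / Gamma_norm d n) \<longlonglongrightarrow> 1 / 1"
    by (intro tendsto_intros Gamma_norm_tendsto_1) auto
  then have "Bseq (\<lambda>n. Gamma_norm c n / Gamma_norm d n)"
    using convergent_imp_Bseq convergent_def by blast
  then obtain K where K: "K > 0" "\<And>n. norm (Gamma_norm c n / Gamma_norm d n) \<le> K"
    by (auto simp: Bseq_def)
  have "growth (Re (c - d)) (\<lambda>n. if n = 0 then 0 else Gamma (c + of_nat n) * rGamma (d + of_nat n))"
  proof (rule growthI[where C = "K * 2 powr \<bar>Re (c - d)\<bar>"])
    fix n
    show "norm (if n = 0 then 0 else Gamma (c + of_nat n) * rGamma (d + of_nat n))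
       \<le> K * 2 powr \<bar>Re (c - d)\<bar> * real (Suc n) powr Re (c - d)"
    proof (cases "n = 0")
      case False
      have "norm (Gamma_norm c n / Gamma_norm d n * of_nat n powr (c - d)) \<le> K * real n powr Re (c - d)"
        unfolding norm_mult using K False
        by (intro mult_mono) (auto simp: norm_powr_real_powr)
      also have "\<dots> \<le> K * (2 powr \<bar>Re (c - d)\<bar> * real (Suc n) powr Re (c - d))"
        using K(1) False by (intro mult_left_mono powr_comparable) auto
      finally show ?thesis using False by (simp add: Gamma_quot_eq_norm)
    qed (use K in auto)
  qed
  then show ?thesis
    by (rule growth_cong_eventually)
       (use eventually_gt_at_top[of "0::nat"] in eventually_elim, simp)
qed

lemma Gamma_quot_balanced_tendsto_1:
  fixes c c' d d' :: complex
  assumes "c + c' = d + d'"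
  shows "(\<lambda>n. Gamma (c + of_nat n) * Gamma (c' + of_nat n) * rGamma (d + of_nat n) * rGamma (d' + of_nat n)) \<longlonglongrightarrow> 1"
proof -
  have "(\<lambda>n. Gamma_norm c n / Gamma_norm d n * (Gamma_norm c' n / Gamma_norm d' n)) \<longlonglongrightarrow> 1 / 1 * (1 / 1)"
    by (intro tendsto_intros Gamma_norm_tendsto_1) auto
  then have "(\<lambda>n. Gamma_norm c n / Gamma_norm d n * (Gamma_norm c' n / Gamma_norm d' n)) \<longlonglongrightarrow> 1" by simp
  moreover have "eventually (\<lambda>n. Gamma_norm c n / Gamma_norm d n * (Gamma_norm c' n / Gamma_norm d' n) =
     Gamma (c + of_nat n) * Gamma (c' + of_nat n) * rGamma (d + of_nat n) * rGamma (d' + of_nat n)) sequentially"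
    using eventually_gt_at_top[of "0::nat"]
  proof eventually_elim
    case (elim n)
    have "c' - d' = - (c - d)" using assms by (simp add: algebra_simps)
    then have "of_nat n powr (c - d) * of_nat n powr (c' - d') = (1 :: complex)"
      using elim by (simp add: powr_add[symmetric])
    then have "Gamma_norm c n / Gamma_norm d n * (Gamma_norm c' n / Gamma_norm d' n) =
        (Gamma_norm c n / Gamma_norm d n * of_nat n powr (c - d)) *
        (Gamma_norm c' n / Gamma_norm d' n * of_nat n powr (c' - d'))" by (simp add: mult_ac)
    also have "\<dots> = (Gamma (c + of_nat n) * rGamma (d + of_nat n)) * (Gamma (c' + of_nat n) * rGamma (d' + of_nat n))"
      using elim by (simp only: Gamma_quot_eq_norm)
    finally show ?case by (simp add: mult_ac)
  qed
  ultimately show ?thesis by (simp add: tendsto_cong)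
qed

section \<open>Sequences with the regularity of a power\<close>

definition bdiff :: "(nat \<Rightarrow> complex) \<Rightarrow> nat \<Rightarrow> complex" where
  "bdiff f n = f n - lag f n"

text \<open>
  The exponent drops by one with every difference, as for symbols of pseudodifferential operators.
  A bound on the size alone does not give the order of a convolution with the coefficients
  \<open>(\<beta>)\<^sub>n / n!\<close> when \<open>Re \<beta> \<le> 0\<close>: that convolution is then a fractional difference, which is small only
  because of cancellation.
\<close>

definition regular :: "real \<Rightarrow> (nat \<Rightarrow> complex) \<Rightarrow> bool" where
  "regular s f \<longleftrightarrow> (\<forall>i. growth (s - real i) ((bdiff ^^ i) f))"

lemma regular_growth: "regular s f \<Longrightarrow> growth s f"
  unfolding regular_def by (elim allE[of _ 0]) simp

lemma bdiff_eventually: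
  assumes "eventually (\<lambda>n. f n = g n) sequentially"
  shows "eventually (\<lambda>n. bdiff f n = bdiff g n) sequentially"
proof -
  from assms obtain N where "\<And>n. n \<ge> N \<Longrightarrow> f n = g n" by (auto simp: eventually_sequentially)
  then have "bdiff f n = bdiff g n" if "n \<ge> Suc N" for n
    using that by (cases n) (auto simp: bdiff_def)
  then show ?thesis by (auto simp: eventually_sequentially)
qed

lemma regular_cong_eventually:
  assumes "regular s f" "eventually (\<lambda>n. f n = g n) sequentially"
  shows "regular s g"
  unfolding regular_def
proof
  fix i
  have "eventually (\<lambda>n. (bdiff ^^ i) f n = (bdiff ^^ i) g n) sequentially"
    using assms(2) by (induction i) (auto intro: bdiff_eventually)
  with assms(1) show "growth (s - real i) ((bdiff ^^ i) g)"
    unfolding regular_def using growth_cong_eventually by blast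
qed

lemma bdiff_add: "bdiff (\<lambda>n. f n + g n) = (\<lambda>n. bdiff f n + bdiff g n)"
  by (auto simp: fun_eq_iff bdiff_def lag_def)

lemma bdiff_iter_add: "(bdiff ^^ i) (\<lambda>n. f n + g n) = (\<lambda>n. (bdiff ^^ i) f n + (bdiff ^^ i) g n)"
  by (induction i) (simp_all add: bdiff_add)

lemma bdiff_lag: "bdiff (lag f) = lag (bdiff f)"
  by (auto simp: fun_eq_iff bdiff_def lag_def)

lemma bdiff_iter_lag: "(bdiff ^^ i) (lag f) = lag ((bdiff ^^ i) f)"
  by (induction i) (simp_all add: bdiff_lag)

lemma regular_lag: "regular s f \<Longrightarrow> regular s (lag f)"
  by (auto simp: regular_def bdiff_iter_lag intro: growth_lag)

lemma regular_bdiff: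
  assumes "regular s f"
  shows "regular (s - 1) (bdiff f)"
  unfolding regular_def
proof
  fix i
  have "growth (s - real (Suc i)) ((bdiff ^^ Suc i) f)" using assms unfolding regular_def by blast
  then show "growth (s - 1 - real i) ((bdiff ^^ i) (bdiff f))"
    by (simp add: funpow_Suc_right algebra_simps del: funpow.simps)
qed

lemma bdiff_mult: "bdiff (\<lambda>n. f n * g n) = (\<lambda>n. bdiff f n * g n + lag f n * bdiff g n)"
  by (auto simp: fun_eq_iff bdiff_def lag_def algebra_simps)

text \<open>By the Leibniz rule \<open>bdiff_mult\<close>, the exponents of all its terms being equal.\<close>

lemma regular_mult:
  assumes "regular s f" "regular r g"
  shows "regular (s + r) (\<lambda>n. f n * g n)"
proof -
  have "growth (s + r - real i) ((bdiff ^^ i) (\<lambda>n. f n * g n))"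
    if "regular s f" "regular r g" for i s r f g
    using that
  proof (induction i arbitrary: s r f g)
    case 0
    then show ?case using growth_mult[OF regular_growth regular_growth] by simp
  next
    case (Suc i)
    have "growth (s - 1 + r - real i) ((bdiff ^^ i) (\<lambda>n. bdiff f n * g n))"
      using Suc by (intro Suc.IH regular_bdiff)
    moreover have "growth (s + (r - 1) - real i) ((bdiff ^^ i) (\<lambda>n. lag f n * bdiff g n))"
      using Suc by (intro Suc.IH regular_bdiff regular_lag)
    ultimately have "growth (s + r - real (Suc i)) (\<lambda>n. (bdiff ^^ i) (\<lambda>n. bdiff f n * g n) n
        + (bdiff ^^ i) (\<lambda>n. lag f n * bdiff g n) n)"
      by (intro growth_add) (simp_all add: algebra_simps)
    then show ?case
      by (simp add: funpow_Suc_right bdiff_mult bdiff_iter_add del: funpow.simps)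
  qed
  with assms show ?thesis by (auto simp: regular_def)
qed

lemma regular_finite_support:
  assumes "eventually (\<lambda>n. f n = 0) sequentially"
  shows "regular s f"
proof -
  have "(bdiff ^^ i) (\<lambda>_. 0) = (\<lambda>_. 0)" for i
    by (induction i) (auto simp: fun_eq_iff bdiff_def lag_def)
  then have "regular s (\<lambda>_. 0)" by (simp add: regular_def growth_zero)
  then show ?thesis
    by (rule regular_cong_eventually) (use assms in \<open>auto elim: eventually_mono\<close>)
qed

text \<open>The backward difference of a Gamma quotient is a multiple of the quotient with \<open>c\<close> lowered by one.\<close>

lemma Gamma_quot_regular: "regular (Re (c - d)) (\<lambda>n. Gamma (c + of_nat n) * rGamma (d + of_nat n))"
  unfolding regular_def
proof
  fix i
  have "\<exists>K. eventually (\<lambda>n. (bdiff ^^ i) (\<lambda>n. Gamma (c + of_nat n) * rGamma (d + of_nat n)) n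
              = K * (Gamma (c - of_nat i + of_nat n) * rGamma (d + of_nat n))) sequentially"
  proof (induction i)
    case 0
    show ?case by (intro exI[of _ 1]) simp
  next
    case (Suc i)
    then obtain K where K: "eventually (\<lambda>n. (bdiff ^^ i) (\<lambda>n. Gamma (c + of_nat n) * rGamma (d + of_nat n)) n
              = K * (Gamma (c - of_nat i + of_nat n) * rGamma (d + of_nat n))) sequentially" by blast
    define c' where "c' = c - of_nat (Suc i)"
    have "eventually (\<lambda>n. bdiff (\<lambda>n. K * (Gamma (c - of_nat i + of_nat n) * rGamma (d + of_nat n))) n
        = K * (c' + 1 - d) * (Gamma (c' + of_nat n) * rGamma (d + of_nat n))) sequentially"
      using eventually_gt_at_top[of 0] eventually_not_nonpos_Int[of "c' - 1"]
        eventually_not_nonpos_Int[of "c'"]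
    proof eventually_elim
      case (elim n)
      obtain m where m: "n = Suc m" using elim by (cases n) auto
      have ci: "c - of_nat i = c' + 1" by (simp add: c'_def)
      have 1: "Gamma (c' + 1 + of_nat n) = (c' + of_nat n) * Gamma (c' + of_nat n)"
        using Gamma_Suc_arg[OF elim(3)] by (simp add: add_ac)
      have 2: "rGamma (d + of_nat m) = (d + of_nat m) * rGamma (d + of_nat n)"
        by (simp only: m rGamma_Suc_arg)
      have 3: "Gamma (c' + 1 + of_nat m) = Gamma (c' + of_nat n)" by (simp add: m add_ac)
      have "bdiff (\<lambda>n. K * (Gamma (c' + 1 + of_nat n) * rGamma (d + of_nat n))) n
          = K * (Gamma (c' + 1 + of_nat n) * rGamma (d + of_nat n))
            - K * (Gamma (c' + 1 + of_nat m) * rGamma (d + of_nat m))"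
        by (simp add: bdiff_def m)
      also have "\<dots> = K * (c' + 1 - d) * (Gamma (c' + of_nat n) * rGamma (d + of_nat n))"
        unfolding 1 2 3 by (simp add: m algebra_simps)
      finally show ?case unfolding ci .
    qed
    with bdiff_eventually[OF K]
    have "eventually (\<lambda>n. bdiff ((bdiff ^^ i) (\<lambda>n. Gamma (c + of_nat n) * rGamma (d + of_nat n))) n
        = K * (c' + 1 - d) * (Gamma (c' + of_nat n) * rGamma (d + of_nat n))) sequentially"
      by eventually_elim (rule trans)
    then show ?case unfolding c'_def by auto
  qed
  then obtain K where K: "eventually (\<lambda>n. (bdiff ^^ i) (\<lambda>n. Gamma (c + of_nat n) * rGamma (d + of_nat n)) n
              = K * (Gamma (c - of_nat i + of_nat n) * rGamma (d + of_nat n))) sequentially" by blast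
  have "growth (Re (c - d) - real i) (\<lambda>n. K * (Gamma (c - of_nat i + of_nat n) * rGamma (d + of_nat n)))"
    using growth_cmult[OF Gamma_quot_growth[of "c - of_nat i" d]] by (simp add: algebra_simps)
  then show "growth (Re (c - d) - real i) ((bdiff ^^ i) (\<lambda>n. Gamma (c + of_nat n) * rGamma (d + of_nat n)))"
    by (rule growth_cong_eventually) (use K in \<open>auto elim: eventually_mono\<close>)
qed

section \<open>Convolution with binomial coefficients\<close>

text \<open>The Taylor coefficients of \<open>(1 - x)\<^bsup>-\<beta>\<^esup>\<close>.\<close>

definition pcoef :: "complex \<Rightarrow> nat \<Rightarrow> complex" where
  "pcoef \<beta> n = pochhammer \<beta> n / fact n"

lemma pcoef_0 [simp]: "pcoef \<beta> 0 = 1"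
  by (simp add: pcoef_def)

lemma pcoef_pascal: "pcoef \<beta> (Suc n) = pcoef (\<beta> + 1) (Suc n) - pcoef (\<beta> + 1) n"
proof -
  have "pcoef (\<beta> + 1) (Suc n) - pcoef (\<beta> + 1) n
      = pochhammer (\<beta> + 1) n * ((\<beta> + 1 + of_nat n) / (of_nat (Suc n) * fact n) - 1 / fact n)"
    by (simp add: pcoef_def pochhammer_rec' algebra_simps)
  also have "\<dots> = pochhammer (\<beta> + 1) n * (\<beta> / (of_nat (Suc n) * fact n))"
    by (simp add: divide_simps del: of_nat_Suc) (simp add: algebra_simps)
  finally show ?thesis by (simp add: pcoef_def pochhammer_rec)
qed

lemma pcoef_growth: "growth (Re \<beta> - 1) (pcoef \<beta>)"
proof (cases "\<beta> \<in> \<int>\<^sub>\<le>\<^sub>0")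
  case True
  then obtain k where k: "\<beta> = - of_nat k" by (auto elim!: nonpos_Ints_cases')
  have "eventually (\<lambda>n. 0 = pcoef \<beta> n) sequentially"
    using eventually_gt_at_top[of k] by eventually_elim (simp add: pcoef_def k pochhammer_of_nat_eq_0_lemma)
  then show ?thesis by (rule growth_cong_eventually[OF growth_zero])
next
  case False
  have "pcoef \<beta> = (\<lambda>n. rGamma \<beta> * (Gamma (\<beta> + of_nat n) * rGamma (1 + of_nat n)))"
    using False by (simp add: fun_eq_iff pcoef_def pochhammer_Gamma rGamma_inverse_Gamma Gamma_fact field_simps)
  then show ?thesis using growth_cmult[OF Gamma_quot_growth[of \<beta> 1]] by simp
qed

lemma growth_compose:
  assumes "growth s f" and le: "\<And>k. Suc (g k) \<le> 2 * Suc k" "\<And>k. Suc k \<le> 2 * Suc (g k)"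
  shows "growth s (\<lambda>k. f (g k))"
proof -
  obtain C where C: "C \<ge> 0" "\<And>n. norm (f n) \<le> C * real (Suc n) powr s"
    using assms(1) growthE by blast
  show ?thesis
  proof (rule growthI[where C = "C * 2 powr \<bar>s\<bar>"])
    fix k
    have "C * real (Suc (g k)) powr s \<le> C * (2 powr \<bar>s\<bar> * real (Suc k) powr s)"
      using C le[of k] by (intro mult_left_mono powr_comparable) linarith+
    with C(2)[of "g k"] show "norm (f (g k)) \<le> C * 2 powr \<bar>s\<bar> * real (Suc k) powr s"
      by simp
  qed
qed

text \<open>Summation by parts: the binomial coefficients are differences of those for \<open>\<beta> + 1\<close>.\<close>

lemma sum_pcoef_by_parts:
  assumes "h \<le> k"
  shows "(\<Sum>j=h..k. pcoef \<beta> (k - j) * u j) =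
    (\<Sum>j=h..k. pcoef (\<beta> + 1) (k - j) * bdiff u j) + pcoef (\<beta> + 1) (k - h) * lag u h"
  using assms
proof (induction rule: inc_induct)
  case base
  show ?case by (simp add: bdiff_def)
next
  case (step n)
  have "k - n = Suc (k - Suc n)" using step by simp
  then have eq: "pcoef \<beta> (k - n) = pcoef (\<beta> + 1) (k - n) - pcoef (\<beta> + 1) (k - Suc n)"
    using pcoef_pascal[of \<beta> "k - Suc n"] by simp
  have "n \<le> k" using step by simp
  then show ?case
    unfolding sum.atLeast_Suc_atMost[OF \<open>n \<le> k\<close>] eq step.IH by (simp add: bdiff_def algebra_simps)
qed

text \<open>
  Every summation by parts raises \<open>Re \<beta>\<close> by one and lowers the exponent of \<open>u\<close> by one, until the
  coefficients \<open>(\<beta>)\<^sub>n / n!\<close> have partial sums of the expected order \<open>k\<^bsup>Re \<beta>\<^esup>\<close>. All indices in this half of the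
  range are comparable to \<open>k\<close>.
\<close>

lemma growth_conv_upper_half:
  assumes "Re \<beta> > - real N" "\<And>i. i \<le> N \<Longrightarrow> growth (s - real i) ((bdiff ^^ i) u)"
  shows "growth (s + Re \<beta>) (\<lambda>k. \<Sum>j=k div 2..k. pcoef \<beta> (k - j) * u j)"
  using assms
proof (induction N arbitrary: \<beta> s u)
  case 0
  obtain A where A: "A \<ge> 0" "\<And>n. norm (pcoef \<beta> n) \<le> A * real (Suc n) powr (Re \<beta> - 1)"
    using pcoef_growth growthE by blast
  have "growth s u" using "0.prems"(2)[of 0] by simp
  then obtain B where B: "B \<ge> 0" "\<And>n. norm (u n) \<le> B * real (Suc n) powr s"
    using growthE by blast
  obtain D where D: "D \<ge> 0" "\<And>k. (\<Sum>j<k. real (Suc j) powr (Re \<beta> - 1)) \<le> D * real k powr (Re \<beta> - 1 + 1)"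
    using sum_Suc_powr_le[of "Re \<beta> - 1"] "0.prems"(1) by auto
  define E where "E = A * (B * 2 powr \<bar>s\<bar>)"
  have E: "E \<ge> 0" using A B by (simp add: E_def)
  show ?case
  proof (rule growthI[where C = "E * D"])
    fix k
    have "norm (\<Sum>j=k div 2..k. pcoef \<beta> (k - j) * u j) \<le> (\<Sum>j=k div 2..k. norm (pcoef \<beta> (k - j) * u j))"
      by (rule norm_sum)
    also have "\<dots> \<le> (\<Sum>j=k div 2..k. E * real (Suc k) powr s * real (Suc (k - j)) powr (Re \<beta> - 1))"
    proof (rule sum_mono)
      fix j assume j: "j \<in> {k div 2..k}"
      have "norm (pcoef \<beta> (k - j) * u j) \<le> (A * real (Suc (k - j)) powr (Re \<beta> - 1)) * (B * real (Suc j) powr s)"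
        unfolding norm_mult using A B by (intro mult_mono) auto
      also have "\<dots> \<le> (A * real (Suc (k - j)) powr (Re \<beta> - 1)) * (B * (2 powr \<bar>s\<bar> * real (Suc k) powr s))"
      proof (intro mult_left_mono powr_comparable)
        show "real (Suc k) \<le> 2 * real (Suc j)" using j by auto
      qed (use A B j in auto)
      finally show "norm (pcoef \<beta> (k - j) * u j) \<le> E * real (Suc k) powr s * real (Suc (k - j)) powr (Re \<beta> - 1)"
        by (simp add: E_def mult_ac)
    qed
    also have "\<dots> = E * real (Suc k) powr s * (\<Sum>j=k div 2..k. real (Suc (k - j)) powr (Re \<beta> - 1))"
      by (simp add: sum_distrib_left)
    also have "\<dots> \<le> E * real (Suc k) powr s * (\<Sum>j=0..k. real (Suc (k - j)) powr (Re \<beta> - 1))"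
      using E by (intro mult_left_mono sum_mono2) auto
    also have "(\<Sum>j=0..k. real (Suc (k - j)) powr (Re \<beta> - 1)) = (\<Sum>j<Suc k. real (Suc j) powr (Re \<beta> - 1))"
      by (rule sum.reindex_bij_witness[of _ "\<lambda>j. k - j" "\<lambda>j. k - j"]) auto
    also have "E * real (Suc k) powr s * \<dots> \<le> E * real (Suc k) powr s * (D * real (Suc k) powr (Re \<beta>))"
      using E D(2)[of "Suc k"] by (intro mult_left_mono) auto
    finally show "norm (\<Sum>j=k div 2..k. pcoef \<beta> (k - j) * u j) \<le> E * D * real (Suc k) powr (s + Re \<beta>)"
      by (simp add: powr_add mult_ac)
  qed
next
  case (Suc N)
  have "growth (s - 1 + Re (\<beta> + 1)) (\<lambda>k. \<Sum>j=k div 2..k. pcoef (\<beta> + 1) (k - j) * bdiff u j)"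
  proof (rule Suc.IH)
    show "- real N < Re (\<beta> + 1)" using Suc.prems(1) by simp
    show "growth (s - 1 - real i) ((bdiff ^^ i) (bdiff u))" if "i \<le> N" for i
      using Suc.prems(2)[of "Suc i"] that by (simp add: funpow_Suc_right algebra_simps del: funpow.simps)
  qed
  moreover have "growth (Re (\<beta> + 1) - 1 + s) (\<lambda>k. pcoef (\<beta> + 1) (k - k div 2) * lag u (k div 2))"
  proof (rule growth_mult)
    show "growth (Re (\<beta> + 1) - 1) (\<lambda>k. pcoef (\<beta> + 1) (k - k div 2))"
      by (rule growth_compose[OF pcoef_growth]) auto
    have "growth s u" using Suc.prems(2)[of 0] by simp
    then show "growth s (\<lambda>k. lag u (k div 2))"
      by (rule growth_compose[OF growth_lag]) auto
  qed
  ultimately have "growth (s + Re \<beta>) (\<lambda>k. (\<Sum>j=k div 2..k. pcoef (\<beta> + 1) (k - j) * bdiff u j)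
      + pcoef (\<beta> + 1) (k - k div 2) * lag u (k div 2))"
    by (intro growth_add) (simp_all add: algebra_simps)
  also have "(\<lambda>k. (\<Sum>j=k div 2..k. pcoef (\<beta> + 1) (k - j) * bdiff u j)
      + pcoef (\<beta> + 1) (k - k div 2) * lag u (k div 2)) = (\<lambda>k. \<Sum>j=k div 2..k. pcoef \<beta> (k - j) * u j)"
    by (intro ext sum_pcoef_by_parts[symmetric]) simp
  finally show ?case .
qed

lemma growth_conv_lower_half:
  assumes "growth s u" "s > -1"
  shows "growth (s + Re \<beta>) (\<lambda>k. \<Sum>j<k div 2. pcoef \<beta> (k - j) * u j)"
proof -
  define r where "r = Re \<beta> - 1"
  obtain A where A: "A \<ge> 0" "\<And>n. norm (pcoef \<beta> n) \<le> A * real (Suc n) powr r"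
    using pcoef_growth growthE unfolding r_def by blast
  obtain B where B: "B \<ge> 0" "\<And>n. norm (u n) \<le> B * real (Suc n) powr s"
    using assms(1) growthE by blast
  obtain D where D: "D \<ge> 0" "\<And>k. (\<Sum>j<k. real (Suc j) powr s) \<le> D * real k powr (s + 1)"
    using sum_Suc_powr_le[OF assms(2)] by auto
  define E where "E = A * 2 powr \<bar>r\<bar> * B"
  have E: "E \<ge> 0" using A B by (simp add: E_def)
  show ?thesis
  proof (rule growthI[where C = "E * D"])
    fix k
    have "norm (\<Sum>j<k div 2. pcoef \<beta> (k - j) * u j) \<le> (\<Sum>j<k div 2. norm (pcoef \<beta> (k - j) * u j))"
      by (rule norm_sum)
    also have "\<dots> \<le> (\<Sum>j<k div 2. E * real (Suc k) powr r * real (Suc j) powr s)"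
    proof (rule sum_mono)
      fix j assume j: "j \<in> {..<k div 2}"
      have "norm (pcoef \<beta> (k - j) * u j) \<le> (A * real (Suc (k - j)) powr r) * (B * real (Suc j) powr s)"
        unfolding norm_mult using A B by (intro mult_mono) auto
      also have "\<dots> \<le> (A * (2 powr \<bar>r\<bar> * real (Suc k) powr r)) * (B * real (Suc j) powr s)"
      proof (intro mult_left_mono mult_right_mono powr_comparable)
        have "Suc k \<le> 2 * Suc (k - j)" using j by auto
        then show "real (Suc k) \<le> 2 * real (Suc (k - j))" by linarith
      qed (use A B j in auto)
      finally show "norm (pcoef \<beta> (k - j) * u j) \<le> E * real (Suc k) powr r * real (Suc j) powr s"
        by (simp add: E_def mult_ac)
    qed
    also have "\<dots> \<le> (\<Sum>j<Suc k. E * real (Suc k) powr r * real (Suc j) powr s)"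
      using E by (intro sum_mono2) auto
    also have "\<dots> = E * real (Suc k) powr r * (\<Sum>j<Suc k. real (Suc j) powr s)"
      by (rule sum_distrib_left[symmetric])
    also have "\<dots> \<le> E * real (Suc k) powr r * (D * real (Suc k) powr (s + 1))"
      using E D(2)[of "Suc k"] by (intro mult_left_mono) auto
    also have "real (Suc k) powr r * real (Suc k) powr (s + 1) = real (Suc k) powr (s + Re \<beta>)"
      by (simp add: powr_add[symmetric] r_def algebra_simps)
    then have "E * real (Suc k) powr r * (D * real (Suc k) powr (s + 1)) = E * D * real (Suc k) powr (s + Re \<beta>)"
      by (simp add: mult_ac)
    finally show "norm (\<Sum>j<k div 2. pcoef \<beta> (k - j) * u j) \<le> E * D * real (Suc k) powr (s + Re \<beta>)" .
  qed
qed

definition conv :: "complex \<Rightarrow> (nat \<Rightarrow> complex) \<Rightarrow> nat \<Rightarrow> complex" where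
  "conv \<beta> u k = (\<Sum>j\<le>k. pcoef \<beta> (k - j) * u j)"

lemma bdiff_conv: "bdiff (conv (\<beta> + 1) u) = conv \<beta> u"
proof
  fix k
  show "bdiff (conv (\<beta> + 1) u) k = conv \<beta> u k"
  proof (cases k)
    case (Suc m)
    have "(\<Sum>j\<le>m. pcoef \<beta> (Suc m - j) * u j)
        = (\<Sum>j\<le>m. pcoef (\<beta> + 1) (Suc m - j) * u j) - (\<Sum>j\<le>m. pcoef (\<beta> + 1) (m - j) * u j)"
      unfolding sum_subtractf[symmetric]
      by (intro sum.cong) (auto simp: Suc_diff_le pcoef_pascal[of \<beta>] algebra_simps)
    then show ?thesis by (simp add: bdiff_def conv_def Suc)
  qed (simp add: bdiff_def conv_def)
qed

lemma bdiff_iter_conv: "(bdiff ^^ i) (conv \<beta> u) = conv (\<beta> - of_nat i) u"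
proof (induction i)
  case (Suc i)
  then show ?case using bdiff_conv[of "\<beta> - of_nat (Suc i)" u] by simp
qed simp

text \<open>
  In the upper half of the summation range the regularity of \<open>u\<close> is spent on making \<open>Re \<beta>\<close>
  positive; in the lower half the binomial coefficients have size \<open>k\<^bsup>Re \<beta> - 1\<^esup>\<close>, and \<open>s > -1\<close>
  bounds the sum of the \<open>u\<^sub>j\<close>. Differences merely lower \<open>\<beta>\<close>.
\<close>

lemma regular_conv:
  assumes "regular s u" "s > -1"
  shows "regular (s + Re \<beta>) (conv \<beta> u)"
proof -
  have "growth (s + Re \<beta>) (conv \<beta> u)" for \<beta>
  proof -
    obtain N where N: "- real N < Re \<beta>"
      using reals_Archimedean2[of "- Re \<beta>"] by (metis minus_less_iff)
    have "growth (s + Re \<beta>) (\<lambda>k. (\<Sum>j<k div 2. pcoef \<beta> (k - j) * u j) + (\<Sum>j=k div 2..k. pcoef \<beta> (k - j) * u j))"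
      using assms N regular_growth[OF assms(1)]
      by (intro growth_add growth_conv_lower_half growth_conv_upper_half[where N = N])
         (auto simp: regular_def)
    also have "(\<lambda>k. (\<Sum>j<k div 2. pcoef \<beta> (k - j) * u j) + (\<Sum>j=k div 2..k. pcoef \<beta> (k - j) * u j)) = conv \<beta> u"
    proof
      fix k :: nat
      have "{..k} = {..<k div 2} \<union> {k div 2..k}" by auto
      then show "(\<Sum>j<k div 2. pcoef \<beta> (k - j) * u j) + (\<Sum>j=k div 2..k. pcoef \<beta> (k - j) * u j) = conv \<beta> u k"
        by (simp add: conv_def sum.union_disjoint ivl_disj_int)
    qed
    finally show ?thesis .
  qed
  from this[of "\<beta> - of_nat _"] show ?thesis
    unfolding regular_def bdiff_iter_conv by (simp add: algebra_simps)
qed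

section \<open>Size of the coefficients\<close>

text \<open>
  The number \<open>\<sigma> = b\<^sub>1 + \<dots> + b\<^sub>p - a\<^sub>3 - \<dots> - a\<^sub>p\<^sub>+\<^sub>1\<close> is the natural base point of the inverse factorial series with
  coefficients \<open>A\<^sub>k\<close>; the variant without \<open>b\<^sub>1\<close> is the base of the Pochhammer symbols in the recursion
  from \<open>p = q + 1\<close> to \<open>p = q + 2\<close>.
\<close>

definition sig :: "nat \<Rightarrow> (nat \<Rightarrow> complex) \<Rightarrow> (nat \<Rightarrow> complex) \<Rightarrow> complex" where
  "sig p a b = (\<Sum>i=1..p. b i) - (\<Sum>i=3..p + 1. a i)"

definition sig' :: "nat \<Rightarrow> (nat \<Rightarrow> complex) \<Rightarrow> (nat \<Rightarrow> complex) \<Rightarrow> complex" where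
  "sig' q a b = (\<Sum>i=2..q + 2. b i) - (\<Sum>i=3..q + 3. a i)"

lemma sig_eq_sig': "sig (Suc (Suc q)) a b = sig' q a b + b 1"
proof -
  have "(\<Sum>i=1..q + 2. b i) = b 1 + (\<Sum>i=2..q + 2. b i)"
  proof -
    have "{1..q + 2} = insert 1 {2..q + 2}" by auto
    then show ?thesis by (simp del: sum.cl_ivl_Suc)
  qed
  moreover have "q + 2 + 1 = q + 3" by simp
  moreover have "x + y - z = y - z + x" for x y z :: complex by simp
  ultimately have "sig (q + 2) a b = sig' q a b + b 1" unfolding sig_def sig'_def by (simp only:)
  then show ?thesis by simp
qed

lemma sig_shift: "sig (Suc q) (\<lambda>i. a (Suc i)) (\<lambda>i. b (Suc i)) = sig' q a b + a 3"
proof -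
  have "(\<Sum>i=1..Suc q. b (Suc i)) = (\<Sum>i=2..q + 2. b i)"
    by (rule sum.reindex_bij_witness[of _ "\<lambda>i. i - 1" Suc]) auto
  moreover have "(\<Sum>i=3..Suc q + 1. a (Suc i)) = (\<Sum>i=4..q + 3. a i)"
    by (rule sum.reindex_bij_witness[of _ "\<lambda>i. i - 1" Suc]) auto
  moreover have "(\<Sum>i=3..q + 3. a i) = a 3 + (\<Sum>i=4..q + 3. a i)"
  proof -
    have "{3..q + 3} = insert 3 {4..q + 3}" by auto
    then show ?thesis by simp
  qed
  ultimately show ?thesis by (simp add: sig_def sig'_def)
qed

text \<open>
  Division by a Gamma function turns \<open>(\<sigma>' + j)\<^sub>k\<^sub>-\<^sub>j\<close> into a quotient of a factor in \<open>j\<close> and a factor in \<open>k\<close>, so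
  the defining recursion becomes a convolution.
\<close>

lemma coeffA_rGamma:
  "coeffA (Suc (Suc q)) a b k * rGamma (sig' q a b + of_nat k) =
     conv (b 1 - a 3) (\<lambda>j. coeffA (Suc q) (\<lambda>i. a (Suc i)) (\<lambda>i. b (Suc i)) j * rGamma (sig' q a b + of_nat j)) k"
  unfolding conv_def coeffA.simps sum_distrib_right
proof (rule sum.cong)
  fix j assume "j \<in> {..k}"
  then have "rGamma (sig' q a b + of_nat j) = pochhammer (sig' q a b + of_nat j) (k - j) * rGamma (sig' q a b + of_nat k)"
    using pochhammer_rGamma[of "sig' q a b + of_nat j" "k - j"] by (simp add: of_nat_diff)
  then show "pochhammer ((\<Sum>i = 2..q + 2. b i) - (\<Sum>i = 3..q + 3. a i) + of_nat j) (k - j) *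
         pochhammer (b 1 - a 3) (k - j) / fact (k - j) *
         coeffA (Suc q) (\<lambda>i. a (Suc i)) (\<lambda>i. b (Suc i)) j * rGamma (sig' q a b + of_nat k) =
         pcoef (b 1 - a 3) (k - j) *
         (coeffA (Suc q) (\<lambda>i. a (Suc i)) (\<lambda>i. b (Suc i)) j * rGamma (sig' q a b + of_nat j))"
    by (simp add: pcoef_def sig'_def mult_ac)
qed simp

lemma regular_rGamma_change:
  assumes "regular s (\<lambda>k. A k * rGamma (c + of_nat k))"
  shows "regular (s + Re (c - d)) (\<lambda>k. A k * rGamma (d + of_nat k))"
proof -
  have "regular (s + Re (c - d)) (\<lambda>k. (A k * rGamma (c + of_nat k)) * (Gamma (c + of_nat k) * rGamma (d + of_nat k)))"
    by (intro regular_mult assms Gamma_quot_regular)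
  then show ?thesis
  proof (rule regular_cong_eventually)
    show "eventually (\<lambda>k. (A k * rGamma (c + of_nat k)) * (Gamma (c + of_nat k) * rGamma (d + of_nat k))
       = A k * rGamma (d + of_nat k)) sequentially"
      using eventually_not_nonpos_Int[of c]
    proof eventually_elim
      case (elim k)
      have "(A k * rGamma (c + of_nat k)) * (Gamma (c + of_nat k) * rGamma (d + of_nat k))
          = (Gamma (c + of_nat k) * rGamma (c + of_nat k)) * (A k * rGamma (d + of_nat k))" by (simp only: mult_ac)
      then show ?case using Gamma_mult_rGamma[OF elim] by simp
    qed
  qed
qed

text \<open>
  By induction on \<open>p\<close>: change the Gamma factor, convolve, change it back. The hypothesis \<open>Re a\<^sub>j > \<epsilon>\<close>
  keeps the exponent \<open>-1 - \<epsilon> + Re a\<^sub>3\<close> of the convolved sequence above \<open>-1\<close>.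
\<close>

theorem coeffA_regular:
  assumes "p \<ge> 1" "\<And>j. j \<in> {3..p + 1} \<Longrightarrow> Re (a j) > \<epsilon>"
  shows "regular (- 1 - \<epsilon>) (\<lambda>k. coeffA p a b k * rGamma (sig p a b + of_nat k))"
  using assms
proof (induction p arbitrary: a b)
  case (Suc p)
  show ?case
  proof (cases p)
    case 0
    show ?thesis unfolding 0
      by (rule regular_finite_support) (use eventually_gt_at_top[of "0::nat"] in eventually_elim, simp)
  next
    case (Suc q)
    let ?A = "coeffA (Suc q) (\<lambda>i. a (Suc i)) (\<lambda>i. b (Suc i))"
    have a3: "Re (a 3) > \<epsilon>" using Suc.prems(2)[of 3] Suc by simp
    have "regular (- 1 - \<epsilon>) (\<lambda>k. ?A k * rGamma (sig' q a b + a 3 + of_nat k))"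
      using Suc.IH[of "\<lambda>i. a (Suc i)" "\<lambda>i. b (Suc i)"] Suc.prems(2) by (simp add: Suc sig_shift)
    from regular_rGamma_change[OF this, of "sig' q a b"]
    have "regular (- 1 - \<epsilon> + Re (a 3)) (\<lambda>k. ?A k * rGamma (sig' q a b + of_nat k))"
      by simp
    then have "regular (- 1 - \<epsilon> + Re (a 3) + Re (b 1 - a 3))
         (\<lambda>k. coeffA (Suc (Suc q)) a b k * rGamma (sig' q a b + of_nat k))"
      unfolding coeffA_rGamma using a3 by (intro regular_conv) auto
    from regular_rGamma_change[OF this, of "sig (Suc (Suc q)) a b"]
    have "regular (- 1 - \<epsilon> + Re (a 3) + Re (b 1 - a 3) + Re (sig' q a b - sig (Suc (Suc q)) a b))
      (\<lambda>k. coeffA (Suc p) a b k * rGamma (sig (Suc p) a b + of_nat k))" by (simp only: Suc)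
    moreover have "- 1 - \<epsilon> + Re (a 3) + Re (b 1 - a 3) + Re (sig' q a b - sig (Suc (Suc q)) a b) = - 1 - \<epsilon>"
      by (simp add: sig_eq_sig')
    ultimately show ?thesis by (simp only:)
  qed
qed simp

section \<open>Gauss's summation theorem\<close>

lemma norm_pochhammer_mono:
  fixes x :: complex
  assumes "Re x \<ge> 0" "r \<ge> 0"
  shows "norm (pochhammer x n) \<le> norm (pochhammer (x + of_real r) n)"
  unfolding pochhammer_prod prod_norm[symmetric]
proof (rule prod_mono)
  fix i
  have "norm (x + of_nat i) \<le> norm (x + of_real r + of_nat i)"
  proof -
    have "(Re x + real i)\<^sup>2 \<le> (Re x + r + real i)\<^sup>2" using assms by (intro power_mono) auto
    then show ?thesis by (simp add: cmod_def)
  qed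
  then show "0 \<le> norm (x + of_nat i) \<and> norm (x + of_nat i) \<le> norm (x + of_real r + of_nat i)"
    by simp
qed

text \<open>
  The terms of \<open>\<^sub>2F\<^sub>1(a, b; c; 1) / \<Gamma>(c)\<close>; this normalisation makes them entire functions of \<open>c\<close>.
\<close>

definition gauss_term :: "complex \<Rightarrow> complex \<Rightarrow> complex \<Rightarrow> nat \<Rightarrow> complex" where
  "gauss_term a b c n = pochhammer a n * pochhammer b n / fact n * rGamma (c + of_nat n)"

lemma fact_rGamma_growth: "growth (1 - Re c) (\<lambda>n. fact n * rGamma (c + of_nat n))"
  using Gamma_quot_growth[of 1 c] by (simp add: Gamma_fact)

lemma gauss_term_growth: "growth (Re (a + b - c) - 1) (gauss_term a b c)"
proof -
  have "growth ((Re a - 1) + (Re b - 1) + (1 - Re c)) (\<lambda>n. pcoef a n * pcoef b n * (fact n * rGamma (c + of_nat n)))"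
    by (intro growth_mult pcoef_growth fact_rGamma_growth)
  moreover have "(\<lambda>n. pcoef a n * pcoef b n * (fact n * rGamma (c + of_nat n))) = gauss_term a b c"
    by (simp add: fun_eq_iff pcoef_def gauss_term_def)
  ultimately show ?thesis by (simp add: algebra_simps)
qed

text \<open>The contiguous relation in \<open>c\<close>, termwise up to a telescoping difference.\<close>

lemma gauss_term_contiguous:
  "(c - a - b) * gauss_term a b c n - (c - a) * (c - b) * gauss_term a b (c + 1) n
     = of_nat n * gauss_term a b c n - of_nat (Suc n) * gauss_term a b c (Suc n)"
proof -
  define P where "P = pochhammer a n * pochhammer b n / fact n * rGamma (c + of_nat (Suc n))"
  have "gauss_term a b c n = (c + of_nat n) * P"
    by (simp add: gauss_term_def P_def rGamma_Suc_arg[symmetric, of c n])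
  moreover have "gauss_term a b (c + 1) n = P"
    by (simp add: gauss_term_def P_def add_ac)
  moreover have "of_nat (Suc n) * gauss_term a b c (Suc n) = (a + of_nat n) * (b + of_nat n) * P"
    by (simp add: gauss_term_def P_def pochhammer_rec' divide_simps del: of_nat_Suc)
  ultimately show ?thesis by (simp only:) (simp add: algebra_simps)
qed

lemma gauss_sum_contiguous:
  assumes "Re (c - a - b) > 0"
  shows "(c - a - b) * (\<Sum>n. gauss_term a b c n) = (c - a) * (c - b) * (\<Sum>n. gauss_term a b (c + 1) n)"
proof -
  define q where "q n = of_nat n * gauss_term a b c n" for n
  have "growth (1 + (Re (a + b - c) - 1)) q"
    unfolding q_def by (intro growth_mult gauss_term_growth growthI[where C = 1]) auto
  then have "q \<longlonglongrightarrow> 0" by (rule growth_tendsto_0) (use assms in simp)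
  from telescope_sums'[OF this] have "(\<lambda>n. q n - q (Suc n)) sums 0" by (simp add: q_def)
  then have "(\<lambda>n. (c - a - b) * gauss_term a b c n - (c - a) * (c - b) * gauss_term a b (c + 1) n) sums 0"
    unfolding gauss_term_contiguous q_def .
  moreover have "summable (gauss_term a b c)" "summable (gauss_term a b (c + 1))"
    using assms by (auto intro!: growth_summable(2)[OF gauss_term_growth])
  then have "(\<lambda>n. (c - a - b) * gauss_term a b c n - (c - a) * (c - b) * gauss_term a b (c + 1) n) sums
      ((c - a - b) * (\<Sum>n. gauss_term a b c n) - (c - a) * (c - b) * (\<Sum>n. gauss_term a b (c + 1) n))"
    by (intro sums_diff sums_mult summable_sums)
  ultimately show ?thesis using sums_unique2 by fastforce
qed

text \<open>\<open>\<Gamma>(c)\<close> times the sum is \<open>\<^sub>2F\<^sub>1(a, b; c; 1)\<close>, where by dominated convergence only the term \<open>n = 0\<close> survives as \<open>c\<close> grows.\<close>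

lemma gauss_sum_asymp:
  "(\<lambda>N. Gamma (c + of_nat N) * (\<Sum>n. gauss_term a b (c + of_nat N) n)) \<longlonglongrightarrow> 1"
proof -
  obtain M where M: "real M > max 1 (max (1 - Re c) (Re (a + b - c) + 1))"
    using reals_Archimedean2 by blast
  define d where "d = c + of_nat M"
  have d: "Re d > 0" "Re (a + b - d) < -1" using M by (auto simp: d_def)
  note nonpole = Re_pos_not_nonpos_Int
  define T where "T n N = Gamma (d + of_nat N) * gauss_term a b (d + of_nat N) n" for n N
  define B where "B n = norm (Gamma d * gauss_term a b d n)" for n
  have T0: "T n N = pochhammer a n * pochhammer b n / fact n / pochhammer (d + of_nat N) n" for n N
  proof -
    have "d + of_nat N \<notin> \<int>\<^sub>\<le>\<^sub>0" by (rule nonpole) (use d in simp)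
    then have "pochhammer (d + of_nat N) n = inverse (Gamma (d + of_nat N) * rGamma (d + of_nat N + of_nat n))"
      by (simp add: pochhammer_Gamma rGamma_inverse_Gamma field_simps)
    then show ?thesis by (simp add: T_def gauss_term_def field_simps)
  qed
  have "eventually (\<lambda>N. summable (\<lambda>n. norm (T n N))) sequentially \<and>
           summable (\<lambda>n. norm (if n = 0 then 1 else 0 :: complex)) \<and>
           ((\<lambda>N. suminf (\<lambda>n. T n N)) \<longlonglongrightarrow> suminf (\<lambda>n. if n = 0 then 1 else 0))"
  proof (rule tannerys_theorem)
    fix n
    show "T n \<longlonglongrightarrow> (if n = 0 then 1 else 0)"
    proof (cases "n = 0")
      case False
      have "growth (Re (d - (d + of_nat n))) (\<lambda>N. Gamma (d + of_nat N) * rGamma (d + of_nat n + of_nat N))"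
        by (rule Gamma_quot_growth)
      from growth_cmult[OF this, of "pochhammer a n * pochhammer b n / fact n"]
      have "growth (- real n) (T n)"
        unfolding T_def gauss_term_def by (simp add: add_ac mult_ac)
      from growth_tendsto_0[OF this] False show ?thesis by simp
    next
      case True
      then have "T n = (\<lambda>_. 1)" by (simp add: fun_eq_iff T0)
      then show ?thesis using True by simp
    qed
  next
    show "eventually (\<lambda>(n, N). norm (T n N) \<le> B n) (sequentially \<times>\<^sub>F sequentially)"
    proof (intro always_eventually allI, safe)
      fix n N
      have "pochhammer d n \<noteq> 0" using nonpole[of d] d(1) by (auto dest!: pochhammer_eq_0_imp_nonpos_Int)
      then have "norm (pochhammer a n * pochhammer b n / fact n) / norm (pochhammer (d + of_nat N) n)
          \<le> norm (pochhammer a n * pochhammer b n / fact n) / norm (pochhammer d n)"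
        using norm_pochhammer_mono[of d "real N" n] d
        by (intro divide_left_mono mult_pos_pos) (auto simp del: norm_mult norm_divide)
      moreover have "B n = norm (pochhammer a n * pochhammer b n / fact n) / norm (pochhammer d n)"
        using T0[of n 0] by (simp add: B_def T_def norm_divide norm_mult)
      ultimately show "norm (T n N) \<le> B n" by (simp add: T0 norm_divide norm_mult)
    qed
  next
    have "growth (Re (a + b - d) - 1) (\<lambda>n. Gamma d * gauss_term a b d n)"
      by (intro growth_cmult gauss_term_growth)
    then show "summable B" unfolding B_def by (rule growth_summable) (use d in simp)
  qed simp
  then have "(\<lambda>N. \<Sum>n. T n N) \<longlonglongrightarrow> (\<Sum>n. if n = 0 then 1 else 0)" by blast
  moreover have "(\<Sum>n. if n = 0 then 1 else 0 :: complex) = 1"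
    using sums_single[of 0 "\<lambda>_. 1 :: complex"] by (simp add: sums_iff)
  moreover have "(\<Sum>n. T n N) = Gamma (c + of_nat (N + M)) * (\<Sum>n. gauss_term a b (c + of_nat (N + M)) n)" for N
  proof -
    have "d + of_nat N = c + of_nat (N + M)" by (simp add: d_def)
    moreover have "summable (gauss_term a b (d + of_nat N))"
      by (rule growth_summable(2)[OF gauss_term_growth]) (use d in auto)
    ultimately show ?thesis unfolding T_def by (simp only: suminf_mult)
  qed
  ultimately have "(\<lambda>N. Gamma (c + of_nat (N + M)) * (\<Sum>n. gauss_term a b (c + of_nat (N + M)) n)) \<longlonglongrightarrow> 1"
    by simp
  then show ?thesis by (rule LIMSEQ_offset)
qed

text \<open>
  Both sides satisfy the same recurrence in \<open>c\<close> and have the same behaviour as \<open>c \<rightarrow> \<infinity>\<close>, so their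
  difference vanishes.
\<close>

theorem gauss_summation:
  assumes re: "Re (c - a - b) > 0"
  shows "gauss_term a b c sums (Gamma (c - a - b) * rGamma (c - a) * rGamma (c - b))"
proof -
  define H where "H c = Gamma (c - a - b) * rGamma (c - a) * rGamma (c - b)" for c
  define D where "D c = (\<Sum>n. gauss_term a b c n) - H c" for c
  define e where "e = c - a - b"
  note nonpole = Re_pos_not_nonpos_Int
  have H_rec: "(z - a - b) * H z = (z - a) * (z - b) * H (z + 1)" if "Re (z - a - b) > 0" for z
  proof -
    have "z - a - b \<notin> \<int>\<^sub>\<le>\<^sub>0" using that by (rule nonpole)
    then have "Gamma (z + 1 - a - b) = (z - a - b) * Gamma (z - a - b)"
      using Gamma_plus1[of "z - a - b"] by (simp add: algebra_simps)
    moreover have "rGamma (z - a) = (z - a) * rGamma (z + 1 - a)" "rGamma (z - b) = (z - b) * rGamma (z + 1 - b)"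
      using rGamma_plus1[of "z - a"] rGamma_plus1[of "z - b"] by (simp_all add: algebra_simps)
    ultimately show ?thesis by (simp add: H_def)
  qed
  have D_rec: "(z - a - b) * D z = (z - a) * (z - b) * D (z + 1)" if "Re (z - a - b) > 0" for z
    using H_rec[OF that] gauss_sum_contiguous[OF that] by (simp add: D_def right_diff_distrib)
  have D_iter: "pochhammer e N * D c = pochhammer (c - a) N * pochhammer (c - b) N * D (c + of_nat N)" for N
  proof (induction N)
    case (Suc N)
    have "pochhammer e (Suc N) * D c = (e + of_nat N) * (pochhammer (c - a) N * pochhammer (c - b) N * D (c + of_nat N))"
      using Suc by (simp add: pochhammer_rec')
    also have "\<dots> = pochhammer (c - a) N * pochhammer (c - b) N * ((c + of_nat N - a - b) * D (c + of_nat N))"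
      by (simp add: e_def algebra_simps)
    also have "(c + of_nat N - a - b) * D (c + of_nat N)
        = (c + of_nat N - a) * (c + of_nat N - b) * D (c + of_nat N + 1)"
      by (rule D_rec) (use re in simp)
    finally show ?case by (simp add: pochhammer_rec' algebra_simps)
  qed simp
  have lim: "(\<lambda>N. Gamma (c + of_nat N) * D (c + of_nat N)) \<longlonglongrightarrow> 0"
  proof -
    have "(\<lambda>N. Gamma (c - a - b + of_nat N) * Gamma (c + of_nat N) * rGamma (c - a + of_nat N) * rGamma (c - b + of_nat N)) \<longlonglongrightarrow> 1"
      by (rule Gamma_quot_balanced_tendsto_1) simp
    then have "(\<lambda>N. Gamma (c + of_nat N) * H (c + of_nat N)) \<longlonglongrightarrow> 1"
      by (simp add: H_def algebra_simps)
    from tendsto_diff[OF gauss_sum_asymp this] show ?thesis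
      by (simp add: D_def right_diff_distrib)
  qed
  have "growth ((Re (c - a) - 1) + (Re (c - b) - 1) + Re (1 - e) + (1 - Re c))
     (\<lambda>N. pcoef (c - a) N * pcoef (c - b) N * (Gamma (1 + of_nat N) * rGamma (e + of_nat N)) * (fact N * rGamma (c + of_nat N)))"
    by (intro growth_mult pcoef_growth Gamma_quot_growth fact_rGamma_growth)
  then have "growth 0 (\<lambda>N. pochhammer (c - a) N * pochhammer (c - b) N * rGamma (e + of_nat N) * rGamma (c + of_nat N))"
    by (simp add: pcoef_def Gamma_fact e_def mult_ac)
  then obtain K where K: "\<And>N. norm (pochhammer (c - a) N * pochhammer (c - b) N * rGamma (e + of_nat N) * rGamma (c + of_nat N)) \<le> K"
    by (auto simp: growth_def)
  have "(\<lambda>N. pochhammer (c - a) N * pochhammer (c - b) N * rGamma (e + of_nat N) * rGamma (c + of_nat N)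
       * (Gamma (c + of_nat N) * D (c + of_nat N))) \<longlonglongrightarrow> 0"
  proof (rule Lim_null_comparison)
    show "eventually (\<lambda>N. norm (pochhammer (c - a) N * pochhammer (c - b) N * rGamma (e + of_nat N) * rGamma (c + of_nat N)
       * (Gamma (c + of_nat N) * D (c + of_nat N))) \<le> K * norm (Gamma (c + of_nat N) * D (c + of_nat N))) sequentially"
      unfolding norm_mult[of _ "Gamma _ * D _"] using K by (intro always_eventually allI mult_right_mono) auto
    show "(\<lambda>N. K * norm (Gamma (c + of_nat N) * D (c + of_nat N))) \<longlonglongrightarrow> 0"
      using tendsto_mult_right_zero[OF tendsto_norm_zero[OF lim]] .
  qed
  moreover have "eventually (\<lambda>N. pochhammer (c - a) N * pochhammer (c - b) N * rGamma (e + of_nat N) * rGamma (c + of_nat N)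
       * (Gamma (c + of_nat N) * D (c + of_nat N)) = rGamma e * D c) sequentially"
    using eventually_not_nonpos_Int[of c]
  proof eventually_elim
    case (elim N)
    have "pochhammer (c - a) N * pochhammer (c - b) N * rGamma (e + of_nat N) * rGamma (c + of_nat N)
       * (Gamma (c + of_nat N) * D (c + of_nat N))
       = (Gamma (c + of_nat N) * rGamma (c + of_nat N)) * rGamma (e + of_nat N) *
         (pochhammer (c - a) N * pochhammer (c - b) N * D (c + of_nat N))"
      by (simp only: mult_ac)
    also have "\<dots> = (pochhammer e N * rGamma (e + of_nat N)) * D c"
      unfolding D_iter[symmetric] by (simp add: Gamma_mult_rGamma[OF elim])
    also have "pochhammer e N * rGamma (e + of_nat N) = rGamma e"
      by (rule pochhammer_rGamma[symmetric])
    finally show ?case .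
  qed
  ultimately have "(\<lambda>N :: nat. rGamma e * D c) \<longlonglongrightarrow> 0"
    by (rule Lim_transform_eventually)
  then have "rGamma e * D c = 0" by (simp add: LIMSEQ_const_iff)
  moreover have "rGamma e \<noteq> 0"
    using nonpole[of e] re by (auto simp: e_def rGamma_eq_zero_iff)
  ultimately have "D c = 0" by simp
  moreover have "summable (gauss_term a b c)"
    using re by (auto intro!: growth_summable(2)[OF gauss_term_growth])
  ultimately show ?thesis by (simp add: D_def H_def sums_iff)
qed

section \<open>Inverse factorial series of a quotient of Gamma functions\<close>

lemma double_series_diagonal:
  fixes f :: "nat \<Rightarrow> nat \<Rightarrow> complex" and x y :: "nat \<Rightarrow> real"
  assumes bound: "\<And>j n. norm (f j n) \<le> x j * y n"
    and nonneg: "\<And>j. x j \<ge> 0" "\<And>n. y n \<ge> 0"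
    and summable: "summable x" "summable y"
    and inner: "\<And>j. f j sums g j" and outer: "g sums S"
  shows "(\<lambda>k. \<Sum>j\<le>k. f j (k - j)) sums S"
proof -
  have "(\<lambda>(j, n). x j * y n) summable_on (UNIV \<times> UNIV)"
  proof (rule summable_on_SigmaI)
    fix j
    show "((\<lambda>n. case (j, n) of (j, n) \<Rightarrow> x j * y n) has_sum (x j * suminf y)) UNIV"
      using nonneg summable by (intro sums_nonneg_imp_has_sum) (auto intro: sums_mult summable_sums)
  next
    have "(\<lambda>j. x j * suminf y) sums (suminf x * suminf y)"
      using summable by (intro sums_mult2 summable_sums)
    then show "(\<lambda>j. x j * suminf y) summable_on UNIV"
      using nonneg summable by (auto simp: summable_on_def intro!: exI sums_nonneg_imp_has_sum mult_nonneg_nonneg suminf_nonneg)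
  qed (use nonneg in auto)
  then have "(\<lambda>p. norm (case p of (j, n) \<Rightarrow> f j n)) summable_on (UNIV \<times> UNIV)"
    by (rule Infinite_Sum.abs_summable_on_comparison_test') (use bound in auto)
  then have "(\<lambda>(j, n). f j n) summable_on (UNIV \<times> UNIV)" by (rule abs_summable_summable)
  then obtain T where T: "((\<lambda>(j, n). f j n) has_sum T) (UNIV \<times> UNIV)"
    by (auto simp: summable_on_def)
  have "(g has_sum T) UNIV"
  proof (rule has_sum_SigmaD[OF T])
    fix j
    have "summable (\<lambda>n. norm (f j n))"
      by (rule summable_comparison_test'[where N = 0, OF summable_mult[OF summable(2), of "x j"]]) (use bound in auto)
    then show "((\<lambda>n. case (j, n) of (j, n) \<Rightarrow> f j n) has_sum g j) UNIV"
      using inner by (simp add: norm_summable_imp_has_sum)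
  qed
  with outer have TS: "T = S" using has_sum_imp_sums sums_unique2 by blast
  have "((\<lambda>(k, j). f j (k - j)) has_sum T) (SIGMA k:UNIV. {..k})"
    using T by (subst has_sum_reindex_bij_witness[of _ "\<lambda>(j, n). (j + n, j)" "\<lambda>(k, j). (j, k - j)" "UNIV \<times> UNIV"
       "\<lambda>(j, n). f j n" _ T T]) auto
  then have "((\<lambda>k. \<Sum>j\<le>k. f j (k - j)) has_sum T) UNIV"
    by (rule has_sum_SigmaD) (simp add: has_sum_finite)
  then show ?thesis unfolding TS by (rule has_sum_imp_sums)
qed

lemma coeffA_cong:
  assumes "\<And>i. i \<ge> 3 \<Longrightarrow> a i = a' i" "\<And>i. i \<ge> 1 \<Longrightarrow> b i = b' i"
  shows "coeffA p a b k = coeffA p a' b' k"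
  using assms
proof (induction p arbitrary: a b a' b' k)
  case (Suc p)
  show ?case
  proof (cases p)
    case (Suc q)
    have "coeffA (Suc q) (\<lambda>i. a (Suc i)) (\<lambda>i. b (Suc i)) j = coeffA (Suc q) (\<lambda>i. a' (Suc i)) (\<lambda>i. b' (Suc i)) j" for j
      using Suc.IH[of "\<lambda>i. a (Suc i)" "\<lambda>i. a' (Suc i)" "\<lambda>i. b (Suc i)" "\<lambda>i. b' (Suc i)"] Suc.prems Suc
      by simp
    moreover have "(\<Sum>i=2..q + 2. b i) = (\<Sum>i=2..q + 2. b' i)" "(\<Sum>i=3..q + 3. a i) = (\<Sum>i=3..q + 3. a' i)"
      using Suc.prems by (auto intro!: sum.cong)
    ultimately show ?thesis using Suc.prems(1)[of 3] Suc.prems(2)[of 1] by (simp only: Suc coeffA.simps)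
  qed simp
qed simp

text \<open>Only differences between the two groups of parameters enter, so the summation index \<open>l\<close> can be absorbed into the parameters.\<close>

lemma coeffA_translate: "coeffA p (\<lambda>i. a i + z) (\<lambda>i. b i + z) k = coeffA p a b k"
proof (induction p arbitrary: a b k)
  case (Suc p)
  show ?case
  proof (cases p)
    case (Suc q)
    have "(\<Sum>i=2..q + 2. b i + z) - (\<Sum>i=3..q + 3. a i + z) = (\<Sum>i=2..q + 2. b i) - (\<Sum>i=3..q + 3. a i)"
      by (simp add: sum.distrib del: sum.cl_ivl_Suc)
    then show ?thesis
      using Suc.IH[of "\<lambda>i. a (Suc i)" "\<lambda>i. b (Suc i)"] by (simp only: Suc coeffA.simps) simp
  qed simp
qed simp

lemma sig_translate: "p \<ge> 1 \<Longrightarrow> sig p (\<lambda>i. a i + z) (\<lambda>i. b i + z) = sig p a b + z"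
  by (simp add: sig_def sum.distrib of_nat_diff algebra_simps del: sum.cl_ivl_Suc)

text \<open>Summation of Gauss's theorem over \<open>j\<close>; for \<open>Re b\<^sub>1 > Re a\<^sub>3\<close> the double series converges absolutely.\<close>

lemma expansion_step:
  fixes a b :: "nat \<Rightarrow> complex"
  assumes Re_a: "\<And>j. j \<in> {3..q + 3} \<Longrightarrow> Re (a j) > \<epsilon>" and eps: "\<epsilon> > 0"
    and b1: "Re (b 1) > Re (a 3)"
    and IH: "(\<lambda>j. coeffA (Suc q) (\<lambda>i. a (Suc i)) (\<lambda>i. b (Suc i)) j * rGamma (sig' q a b + a 3 + of_nat j)) sums S"
  shows "(\<lambda>k. coeffA (Suc (Suc q)) a b k * rGamma (sig (Suc (Suc q)) a b + of_nat k)) sums (S * (Gamma (a 3) * rGamma (b 1)))"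
proof -
  define s where "s = sig' q a b"
  define \<beta> where "\<beta> = b 1 - a 3"
  define A where "A = coeffA (Suc q) (\<lambda>i. a (Suc i)) (\<lambda>i. b (Suc i))"
  define f where "f j n = A j * gauss_term (s + of_nat j) \<beta> (s + b 1 + of_nat j) n" for j n
  define g where "g j = A j * rGamma (s + a 3 + of_nat j) * (Gamma (a 3) * rGamma (b 1))" for j
  define x where "x j = real (Suc j) powr (- 1 - \<epsilon> / 2)" for j
  have a3: "Re (a 3) > \<epsilon>" using Re_a[of 3] by simp
  have inner: "f j sums g j" for j
  proof -
    have "gauss_term (s + of_nat j) \<beta> (s + b 1 + of_nat j) sums
        (Gamma (s + b 1 + of_nat j - (s + of_nat j) - \<beta>) * rGamma (s + b 1 + of_nat j - (s + of_nat j)) *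
         rGamma (s + b 1 + of_nat j - \<beta>))"
      by (rule gauss_summation) (use a3 eps in \<open>simp add: \<beta>_def\<close>)
    from sums_mult[OF this, of "A j"] show ?thesis
      by (simp add: f_def[abs_def] g_def \<beta>_def algebra_simps)
  qed
  have "regular (- 1 - \<epsilon>) (\<lambda>k. A k * rGamma (sig (Suc q) (\<lambda>i. a (Suc i)) (\<lambda>i. b (Suc i)) + of_nat k))"
    unfolding A_def using Re_a by (intro coeffA_regular) auto
  from regular_growth[OF regular_rGamma_change[OF this, of s]]
  have "growth (- 1 - \<epsilon> + Re (a 3)) (\<lambda>j. A j * rGamma (s + of_nat j))"
    by (simp add: sig_shift s_def)
  then obtain V where V: "V \<ge> 0" "\<And>j. norm (A j * rGamma (s + of_nat j)) \<le> V * real (Suc j) powr (- 1 - \<epsilon> + Re (a 3))"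
    using growthE by blast
  obtain P where P: "P \<ge> 0" "\<And>n. norm (pcoef \<beta> n) \<le> P * real (Suc n) powr (Re \<beta> - 1)"
    using pcoef_growth growthE by blast
  have "growth (- Re (b 1)) (\<lambda>k. Gamma (s + of_nat k) * rGamma (s + b 1 + of_nat k))"
    using Gamma_quot_growth[of s "s + b 1"] by simp
  then obtain W where W: "W \<ge> 0" "\<And>k. norm (Gamma (s + of_nat k) * rGamma (s + b 1 + of_nat k)) \<le> W * real (Suc k) powr (- Re (b 1))"
    using growthE by blast
  obtain J where J: "\<And>k. k \<ge> J \<Longrightarrow> s + of_nat k \<notin> \<int>\<^sub>\<le>\<^sub>0"
    using eventually_not_nonpos_Int[of s] by (auto simp: eventually_sequentially)
  define C where "C = V * P * W"
  have C: "C \<ge> 0" using V P W by (simp add: C_def)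
  have bound: "norm (f j n) \<le> C * (x j * x n)" if "j + n \<ge> J" for j n
  proof -
    have "pochhammer (s + of_nat j) n = Gamma (s + of_nat (j + n)) * rGamma (s + of_nat j)"
      using pochhammer_rGamma[of "s + of_nat j" n] Gamma_mult_rGamma[OF J[OF that]]
      by (simp add: add_ac mult_ac)
    then have f_eq: "f j n = (A j * rGamma (s + of_nat j)) * pcoef \<beta> n * (Gamma (s + of_nat (j + n)) * rGamma (s + b 1 + of_nat (j + n)))"
      by (simp add: f_def gauss_term_def pcoef_def add_ac)
    have "norm (f j n) \<le> (V * real (Suc j) powr (- 1 - \<epsilon> + Re (a 3))) * (P * real (Suc n) powr (Re \<beta> - 1))
        * (W * real (Suc (j + n)) powr (- Re (b 1)))"
      unfolding norm_mult[of "_ * pcoef \<beta> n"] norm_mult[of _ "pcoef \<beta> n"] f_eq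
      by (intro mult_mono V P W mult_nonneg_nonneg) auto
    (* both exponents are negative, so that one factor can be bounded in terms of j and the other in terms of n *)
    also have "real (Suc (j + n)) powr (- Re (b 1))
        = real (Suc (j + n)) powr (- (Re (a 3) - \<epsilon> / 2)) * real (Suc (j + n)) powr (- (Re \<beta> + \<epsilon> / 2))"
      by (simp add: powr_add[symmetric] \<beta>_def del: of_nat_Suc)
    also have "(V * real (Suc j) powr (- 1 - \<epsilon> + Re (a 3))) * (P * real (Suc n) powr (Re \<beta> - 1)) * (W * \<dots>)
       \<le> (V * real (Suc j) powr (- 1 - \<epsilon> + Re (a 3))) * (P * real (Suc n) powr (Re \<beta> - 1))
        * (W * (real (Suc j) powr (- (Re (a 3) - \<epsilon> / 2)) * real (Suc n) powr (- (Re \<beta> + \<epsilon> / 2))))"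
      using V P W a3 eps b1
      by (intro mult_left_mono mult_mono powr_mono2') (auto simp: \<beta>_def)
    also have "\<dots> = C * ((real (Suc j) powr (- 1 - \<epsilon> + Re (a 3)) * real (Suc j) powr (- (Re (a 3) - \<epsilon> / 2)))
        * (real (Suc n) powr (Re \<beta> - 1) * real (Suc n) powr (- (Re \<beta> + \<epsilon> / 2))))"
      by (simp add: C_def mult_ac del: of_nat_Suc)
    also have "\<dots> = C * (x j * x n)"
      by (simp add: x_def powr_add[symmetric] algebra_simps del: of_nat_Suc)
    finally show ?thesis .
  qed
  (* for j + n < J the quotient of Gamma functions may hit a pole; these pairs are finitely many and
     only enlarge the constant *)
  define F where "F = {..J} \<times> {..J}"
  define E where "E = C + (\<Sum>(j, n)\<in>F. norm (f j n) / (x j * x n))"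
  have x_pos: "x j > 0" for j by (simp add: x_def)
  have x_nonneg: "x j \<ge> 0" for j by (simp add: x_def)
  have F_nonneg: "(\<Sum>(j, n)\<in>F. norm (f j n) / (x j * x n)) \<ge> 0"
    by (intro sum_nonneg) (auto simp: x_nonneg)
  have bound': "norm (f j n) \<le> E * x j * x n" for j n
  proof (cases "j + n \<ge> J")
    case True
    have "C * (x j * x n) \<le> E * (x j * x n)"
      using F_nonneg x_pos[of j] x_pos[of n] by (intro mult_right_mono) (auto simp: E_def)
    with bound[OF True] show ?thesis by (simp add: mult_ac)
  next
    case False
    have "(case (j, n) of (j, n) \<Rightarrow> norm (f j n) / (x j * x n)) \<le> (\<Sum>(j, n)\<in>F. norm (f j n) / (x j * x n))"
      using False by (intro member_le_sum) (auto simp: F_def x_nonneg)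
    then have "norm (f j n) / (x j * x n) \<le> E" using C by (simp add: E_def)
    then show ?thesis using x_pos[of j] x_pos[of n] by (simp add: divide_simps mult_ac split: if_splits)
  qed
  have "(\<lambda>k. \<Sum>j\<le>k. f j (k - j)) sums (S * (Gamma (a 3) * rGamma (b 1)))"
  proof (rule double_series_diagonal[where x = "\<lambda>j. E * x j" and y = x and g = g])
    show "summable x" unfolding x_def by (rule summable_Suc_powr) (use eps in simp)
    then show "summable (\<lambda>j. E * x j)" by (rule summable_mult)
    show "g sums (S * (Gamma (a 3) * rGamma (b 1)))"
      using sums_mult2[OF IH, of "Gamma (a 3) * rGamma (b 1)"] by (simp add: g_def[abs_def] A_def s_def)
    show "0 \<le> E * x j" for j using x_pos[of j] C F_nonneg by (simp add: E_def)
  qed (use bound' inner x_pos in \<open>auto intro: less_imp_le\<close>)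
  moreover have "(\<Sum>j\<le>k. f j (k - j)) = coeffA (Suc (Suc q)) a b k * rGamma (sig (Suc (Suc q)) a b + of_nat k)" for k
    unfolding coeffA.simps sum_distrib_right
  proof (rule sum.cong)
    fix j assume "j \<in> {..k}"
    then have "s + b 1 + of_nat j + of_nat (k - j) = sig (Suc (Suc q)) a b + of_nat k"
      by (simp add: sig_eq_sig' s_def of_nat_diff)
    then show "f j (k - j) = pochhammer ((\<Sum>i = 2..q + 2. b i) - (\<Sum>i = 3..q + 3. a i) + of_nat j) (k - j) *
         pochhammer (b 1 - a 3) (k - j) / fact (k - j) *
         coeffA (Suc q) (\<lambda>i. a (Suc i)) (\<lambda>i. b (Suc i)) j * rGamma (sig (Suc (Suc q)) a b + of_nat k)"
      by (simp only: f_def gauss_term_def A_def \<beta>_def s_def sig'_def) (simp only: mult_ac times_divide_eq_right times_divide_eq_left)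
  qed simp
  ultimately show ?thesis by simp
qed

text \<open>The contiguous relation in \<open>b\<^sub>1\<close> mirrors \<open>1 / \<Gamma>(b\<^sub>1) = b\<^sub>1 / \<Gamma>(b\<^sub>1 + 1)\<close>.\<close>

lemma coeffA_contiguous:
  assumes b': "b' 1 = b 1 + 1" "\<And>i. i \<ge> 2 \<Longrightarrow> b' i = b i"
  shows "coeffA (Suc (Suc q)) a b (Suc k) = coeffA (Suc (Suc q)) a b' (Suc k)
            - (sig' q a b + of_nat k) * coeffA (Suc (Suc q)) a b' k"
    and "coeffA (Suc (Suc q)) a b 0 = coeffA (Suc (Suc q)) a b' 0"
proof -
  define A where "A = coeffA (Suc q) (\<lambda>i. a (Suc i)) (\<lambda>i. b (Suc i))"
  have A': "coeffA (Suc q) (\<lambda>i. a (Suc i)) (\<lambda>i. b' (Suc i)) = A"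
    unfolding A_def by (intro ext coeffA_cong) (use b' in auto)
  have s: "(\<Sum>i=2..q + 2. b' i) = (\<Sum>i=2..q + 2. b i)" using b' by (intro sum.cong) auto
  define \<beta> where "\<beta> = b 1 - a 3"
  have \<beta>': "b' 1 - a 3 = \<beta> + 1" using b' by (simp add: \<beta>_def)
  have eq: "coeffA (Suc (Suc q)) a b k = (\<Sum>j\<le>k. pochhammer (sig' q a b + of_nat j) (k - j) * pcoef \<beta> (k - j) * A j)"
     "coeffA (Suc (Suc q)) a b' k = (\<Sum>j\<le>k. pochhammer (sig' q a b + of_nat j) (k - j) * pcoef (\<beta> + 1) (k - j) * A j)" for k
    by (simp_all only: coeffA.simps s A' A_def[symmetric] \<beta>' \<beta>_def[symmetric] sig'_def[symmetric] pcoef_def times_divide_eq_right)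
  show "coeffA (Suc (Suc q)) a b 0 = coeffA (Suc (Suc q)) a b' 0" unfolding eq by simp
  have "(\<Sum>j\<le>k. pochhammer (sig' q a b + of_nat j) (Suc k - j) * pcoef \<beta> (Suc k - j) * A j)
      = (\<Sum>j\<le>k. pochhammer (sig' q a b + of_nat j) (Suc k - j) * pcoef (\<beta> + 1) (Suc k - j) * A j)
        - (sig' q a b + of_nat k) * (\<Sum>j\<le>k. pochhammer (sig' q a b + of_nat j) (k - j) * pcoef (\<beta> + 1) (k - j) * A j)"
    unfolding sum_distrib_left sum_subtractf[symmetric]
  proof (intro sum.cong refl)
    fix j assume j: "j \<in> {..k}"
    then have Suc: "Suc k - j = Suc (k - j)" by (simp add: Suc_diff_le)
    have "pochhammer (sig' q a b + of_nat j) (Suc (k - j)) = (sig' q a b + of_nat k) * pochhammer (sig' q a b + of_nat j) (k - j)"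
      using j by (simp add: pochhammer_rec' of_nat_diff)
    then show "pochhammer (sig' q a b + of_nat j) (Suc k - j) * pcoef \<beta> (Suc k - j) * A j
      = pochhammer (sig' q a b + of_nat j) (Suc k - j) * pcoef (\<beta> + 1) (Suc k - j) * A j
        - (sig' q a b + of_nat k) * (pochhammer (sig' q a b + of_nat j) (k - j) * pcoef (\<beta> + 1) (k - j) * A j)"
      unfolding Suc pcoef_pascal[of \<beta>] by (simp add: algebra_simps)
  qed
  then show "coeffA (Suc (Suc q)) a b (Suc k) = coeffA (Suc (Suc q)) a b' (Suc k)
            - (sig' q a b + of_nat k) * coeffA (Suc (Suc q)) a b' k"
    unfolding eq by simp
qed

text \<open>
  The contiguous relation extends the expansion to all \<open>b\<^sub>1\<close>, where the double series need not converge
  absolutely. The boundary term vanishes because of the bound on the coefficients.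
\<close>

lemma expansion_descent:
  fixes a b :: "nat \<Rightarrow> complex"
  assumes b': "b' 1 = b 1 + 1" "\<And>i. i \<ge> 2 \<Longrightarrow> b' i = b i"
    and Re_a: "\<And>j. j \<in> {3..q + 3} \<Longrightarrow> Re (a j) > \<epsilon>" and eps: "\<epsilon> > 0"
    and sums: "(\<lambda>k. coeffA (Suc (Suc q)) a b' k * rGamma (sig (Suc (Suc q)) a b' + of_nat k)) sums S"
  shows "(\<lambda>k. coeffA (Suc (Suc q)) a b k * rGamma (sig (Suc (Suc q)) a b + of_nat k)) sums (b 1 * S)"
proof -
  define A where "A = coeffA (Suc (Suc q)) a b"
  define B where "B = coeffA (Suc (Suc q)) a b'"
  define s where "s = sig (Suc (Suc q)) a b"
  have "(\<Sum>i=2..q + 2. b' i) = (\<Sum>i=2..q + 2. b i)" using b' by (intro sum.cong) auto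
  then have sig'_eq: "sig' q a b' = sig' q a b" by (simp only: sig'_def)
  have s1: "sig (Suc (Suc q)) a b' = s + 1" using b'(1) by (simp add: s_def sig_eq_sig' sig'_eq)
  have partial: "(\<Sum>k<Suc K. A k * rGamma (s + of_nat k)) = b 1 * (\<Sum>k<K. B k * rGamma (s + 1 + of_nat k)) + B K * rGamma (s + of_nat K)" for K
  proof (induction K)
    case 0
    show ?case using coeffA_contiguous(2)[where b = b and b' = b', OF b'] by (simp add: A_def B_def del: coeffA.simps)
  next
    case (Suc K)
    have "A (Suc K) = B (Suc K) - (s - b 1 + of_nat K) * B K"
      using coeffA_contiguous(1)[where b = b and b' = b', OF b'] by (simp add: A_def B_def s_def sig_eq_sig' del: coeffA.simps)
    moreover have "rGamma (s + of_nat K) = (s + of_nat K) * rGamma (s + of_nat (Suc K))"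
      by (simp only: rGamma_Suc_arg)
    moreover have "rGamma (s + 1 + of_nat K) = rGamma (s + of_nat (Suc K))" by (simp add: add_ac)
    ultimately show ?case
      unfolding sum.lessThan_Suc[of _ "Suc K"] Suc.IH sum.lessThan_Suc[of _ K]
      by (simp only:) (simp add: algebra_simps)
  qed
  have "regular (- 1 - \<epsilon>) (\<lambda>k. B k * rGamma (sig (Suc (Suc q)) a b' + of_nat k))"
    unfolding B_def using Re_a by (intro coeffA_regular) auto
  from regular_growth[OF regular_rGamma_change[OF this, of s]]
  have "growth (- \<epsilon>) (\<lambda>K. B K * rGamma (s + of_nat K))" by (simp add: s1)
  then have "(\<lambda>K. B K * rGamma (s + of_nat K)) \<longlonglongrightarrow> 0"
    by (rule growth_tendsto_0) (use eps in simp)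
  moreover have "(\<lambda>K. \<Sum>k<K. B k * rGamma (s + 1 + of_nat k)) \<longlonglongrightarrow> S"
    using sums by (simp add: sums_def B_def s1)
  ultimately have "(\<lambda>K. \<Sum>k<Suc K. A k * rGamma (s + of_nat k)) \<longlonglongrightarrow> b 1 * S + 0"
    unfolding partial by (intro tendsto_intros)
  then have "(\<lambda>K. \<Sum>k<K. A k * rGamma (s + of_nat k)) \<longlonglongrightarrow> b 1 * S"
    by (subst (asm) filterlim_sequentially_Suc) simp
  then show ?thesis unfolding sums_def A_def s_def .
qed

lemma ex_positive_lower_bound:
  fixes a :: "nat \<Rightarrow> complex"
  assumes "finite I" "\<And>j. j \<in> I \<Longrightarrow> Re (a j) > 0"
  obtains \<epsilon> where "\<epsilon> > 0" "\<And>j. j \<in> I \<Longrightarrow> Re (a j) > \<epsilon>"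
proof -
  define m where "m = Min (insert 1 ((\<lambda>j. Re (a j)) ` I))"
  have "m > 0" using assms by (auto simp: m_def)
  moreover have "Re (a j) \<ge> m" if "j \<in> I" for j using assms that by (auto simp: m_def)
  ultimately show ?thesis using that[of "m / 2"] by force
qed

lemma expansion_at_0:
  fixes a b :: "nat \<Rightarrow> complex"
  assumes "p \<ge> 1" "\<And>j. j \<in> {3..p + 1} \<Longrightarrow> Re (a j) > 0"
  shows "(\<lambda>k. coeffA p a b k * rGamma (sig p a b + of_nat k)) sums
           ((\<Prod>j=3..p + 1. Gamma (a j)) * (\<Prod>i=1..p. rGamma (b i)))"
  using assms
proof (induction p arbitrary: a b)
  case (Suc p)
  show ?case
  proof (cases p)
    case 0
    have "(\<lambda>k. coeffA (Suc 0) a b k * rGamma (sig (Suc 0) a b + of_nat k)) = (\<lambda>k. if k = 0 then rGamma (b 1) else 0)"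
      by (auto simp: fun_eq_iff sig_def)
    then show ?thesis using sums_single[of 0 "\<lambda>_. rGamma (b 1)"] by (simp add: 0)
  next
    case (Suc q)
    obtain \<epsilon> where eps: "\<epsilon> > 0" "\<And>j. j \<in> {3..q + 3} \<Longrightarrow> Re (a j) > \<epsilon>"
      by (rule ex_positive_lower_bound[of "{3..q + 3}" a]) (use Suc.prems Suc in auto)
    define Q where "Q b \<longleftrightarrow> (\<lambda>k. coeffA (Suc (Suc q)) a b k * rGamma (sig (Suc (Suc q)) a b + of_nat k)) sums
           ((\<Prod>j=3..q + 3. Gamma (a j)) * (\<Prod>i=1..q + 2. rGamma (b i)))" for b
    have prod_a: "(\<Prod>j=3..q + 3. Gamma (a j)) = Gamma (a 3) * (\<Prod>j=4..q + 3. Gamma (a j))"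
    proof -
      have "{3..q + 3} = insert 3 {4..q + 3}" by auto
      then show ?thesis by simp
    qed
    have prod_b: "(\<Prod>i=1..q + 2. rGamma (b i)) = rGamma (b 1) * (\<Prod>i=2..q + 2. rGamma (b i))" for b :: "nat \<Rightarrow> complex"
    proof -
      have "{1..q + 2} = insert 1 {2..q + 2}" by auto
      then show ?thesis by (simp del: prod.cl_ivl_Suc)
    qed
    have large: "Q b" if "Re (b 1) > Re (a 3)" for b
    proof -
      have "(\<lambda>k. coeffA (Suc q) (\<lambda>i. a (Suc i)) (\<lambda>i. b (Suc i)) k * rGamma (sig (Suc q) (\<lambda>i. a (Suc i)) (\<lambda>i. b (Suc i)) + of_nat k)) sums
           ((\<Prod>j=3..Suc q + 1. Gamma (a (Suc j))) * (\<Prod>i=1..Suc q. rGamma (b (Suc i))))"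
        using Suc.IH[of "\<lambda>i. a (Suc i)" "\<lambda>i. b (Suc i)"] Suc.prems Suc by simp
      from expansion_step[OF eps(2) eps(1) that this[unfolded sig_shift]]
      have "(\<lambda>k. coeffA (Suc (Suc q)) a b k * rGamma (sig (Suc (Suc q)) a b + of_nat k)) sums
        ((\<Prod>j=3..Suc q + 1. Gamma (a (Suc j))) * (\<Prod>i=1..Suc q. rGamma (b (Suc i))) * (Gamma (a 3) * rGamma (b 1)))" .
      moreover have "(\<Prod>j=3..Suc q + 1. Gamma (a (Suc j))) = (\<Prod>j=4..q + 3. Gamma (a j))"
        by (rule prod.reindex_bij_witness[of _ "\<lambda>i. i - 1" Suc]) auto
      moreover have "(\<Prod>i=1..Suc q. rGamma (b (Suc i))) = (\<Prod>i=2..q + 2. rGamma (b i))"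
        by (rule prod.reindex_bij_witness[of _ "\<lambda>i. i - 1" Suc]) auto
      ultimately show ?thesis unfolding Q_def prod_a prod_b by (simp only: mult_ac)
    qed
    have descent: "Q b" if "Q (b(1 := b 1 + 1))" for b
    proof -
      have "(\<lambda>k. coeffA (Suc (Suc q)) a b k * rGamma (sig (Suc (Suc q)) a b + of_nat k)) sums
        (b 1 * ((\<Prod>j=3..q + 3. Gamma (a j)) * (\<Prod>i=1..q + 2. rGamma ((b(1 := b 1 + 1)) i))))"
        by (rule expansion_descent[OF _ _ eps(2) eps(1) that[unfolded Q_def]]) auto
      moreover have "(\<Prod>i=2..q + 2. rGamma ((b(1 := b 1 + 1)) i)) = (\<Prod>i=2..q + 2. rGamma (b i))"
        by (rule prod.cong) auto
      moreover have "rGamma (b 1) = b 1 * rGamma ((b(1 := b 1 + 1)) 1)"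
        using rGamma_plus1[of "b 1"] by simp
      ultimately show ?thesis unfolding Q_def prod_b by (simp only: mult_ac)
    qed
    have iter: "Q (b(1 := b 1 + of_nat N)) \<Longrightarrow> Q b" for N
    proof (induction N)
      case (Suc N)
      have "b(1 := b 1 + of_nat (Suc N)) = (b(1 := b 1 + of_nat N))(1 := (b(1 := b 1 + of_nat N)) 1 + 1)"
        by (simp add: fun_eq_iff add_ac)
      with Suc.prems have "Q ((b(1 := b 1 + of_nat N))(1 := (b(1 := b 1 + of_nat N)) 1 + 1))" by (simp only:)
      then have "Q (b(1 := b 1 + of_nat N))" by (rule descent)
      then show ?case by (rule Suc.IH)
    qed simp
    obtain N where "Re (a 3) - Re (b 1) < real N" using reals_Archimedean2 by blast
    then have "Q (b(1 := b 1 + of_nat N))" by (intro large) simp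
    then have "Q b" by (rule iter)
    moreover have "q + 3 = Suc p + 1" "q + 2 = Suc p" "Suc (Suc q) = Suc p" using Suc by auto
    ultimately show ?thesis unfolding Q_def by (simp only:)
  qed
qed simp

text \<open>Translating all parameters by \<open>l\<close> moves \<open>\<sigma>\<close> by \<open>l\<close> and leaves the coefficients unchanged.\<close>

theorem Gamma_quotient_expansion:
  fixes a b :: "nat \<Rightarrow> complex"
  assumes "p \<ge> 1" "\<And>j. j \<in> {3..p + 1} \<Longrightarrow> Re (a j) > 0"
  shows "(\<lambda>k. coeffA p a b k * rGamma (sig p a b + of_nat l + of_nat k)) sums
           ((\<Prod>j=3..p + 1. Gamma (a j + of_nat l)) * (\<Prod>i=1..p. rGamma (b i + of_nat l)))"
proof -
  have "Re (a j + of_nat l) > 0" if "j \<in> {3..p + 1}" for j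
    using assms(2)[OF that] by simp
  from expansion_at_0[of p "\<lambda>i. a i + of_nat l" "\<lambda>i. b i + of_nat l", OF assms(1) this]
  show ?thesis by (simp only: coeffA_translate sig_translate[OF assms(1)])
qed

section \<open>Asymptotic expansion of the two-parameter term\<close>

text \<open>
  The terms have size \<open>l\<^bsup>\<tau> - 1\<^esup>\<close>, so that the partial sums grow like \<open>m\<^sup>\<tau>\<close> for \<open>\<tau> = 1, 2, \<dots>\<close>, logarithmically for
  \<open>\<tau> = 0\<close>, and converge for \<open>Re \<tau> < 0\<close>.
\<close>

definition hyp :: "complex \<Rightarrow> complex \<Rightarrow> complex \<Rightarrow> nat \<Rightarrow> complex" where
  "hyp a b \<tau> l = Gamma (a + of_nat l) * Gamma (b + of_nat l) * rGamma (a + b - \<tau> + of_nat l) / fact l"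

text \<open>
  The coefficients of the asymptotic expansion of \<open>\<Gamma>(a + l) \<Gamma>(b + l) / \<Gamma>(a + b - \<tau> + l)\<close> in the functions
  \<open>\<Gamma>(\<tau> - n + l)\<close>.
\<close>

definition ecf :: "complex \<Rightarrow> complex \<Rightarrow> complex \<Rightarrow> nat \<Rightarrow> complex" where
  "ecf a b \<tau> n = (-1) ^ n * pochhammer (a - \<tau>) n * pochhammer (b - \<tau>) n / fact n"

lemma ecf_0 [simp]: "ecf a b \<tau> 0 = 1"
  by (simp add: ecf_def)

lemma ecf_Suc: "of_nat (Suc n) * ecf a b \<tau> (Suc n) = - (a - \<tau> + of_nat n) * (b - \<tau> + of_nat n) * ecf a b \<tau> n"
  by (simp add: ecf_def pochhammer_rec' divide_simps del: of_nat_Suc) (simp add: algebra_simps)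

lemma ecf_Suc_lower: "of_nat (Suc n) * ecf a b \<tau> (Suc n) = - (a - \<tau>) * (b - \<tau>) * ecf a b (\<tau> - 1) n"
  by (simp add: ecf_def pochhammer_rec divide_simps del: of_nat_Suc) (simp add: algebra_simps)

lemma hyp_growth: "growth (Re \<tau> - 1) (hyp a b \<tau>)"
proof -
  have "growth (Re (a - 1) + Re (b - (a + b - \<tau>))) (\<lambda>l. (Gamma (a + of_nat l) * rGamma (1 + of_nat l))
      * (Gamma (b + of_nat l) * rGamma (a + b - \<tau> + of_nat l)))"
    by (intro growth_mult Gamma_quot_growth)
  moreover have "(\<lambda>l. (Gamma (a + of_nat l) * rGamma (1 + of_nat l))
      * (Gamma (b + of_nat l) * rGamma (a + b - \<tau> + of_nat l))) = hyp a b \<tau>"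
    by (simp add: fun_eq_iff hyp_def rGamma_inverse_Gamma Gamma_fact field_simps)
  ultimately show ?thesis by simp
qed

lemma hyp_eq_gauss_term:
  assumes "a \<notin> \<int>\<^sub>\<le>\<^sub>0" "b \<notin> \<int>\<^sub>\<le>\<^sub>0"
  shows "hyp a b \<tau> l = Gamma a * Gamma b * gauss_term a b (a + b - \<tau>) l"
  using assms by (simp add: hyp_def gauss_term_def pochhammer_Gamma Gamma_eq_zero_iff)

text \<open>The recurrence of the coefficients makes all terms but the last cancel; \<open>g n\<close> stands for \<open>\<Gamma>(\<tau> - n + z)\<close>.\<close>

lemma hyp_expansion_aux:
  "(\<Sum>n<Suc N. ecf a b \<tau> n * (((a + b - \<tau> + z) * (\<tau> - of_nat n + z) - (a + z) * (b + z)) * g n)) =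
     - (a - \<tau> + of_nat N) * (b - \<tau> + of_nat N) * ecf a b \<tau> N * g N"
  if g: "\<And>n. n < N \<Longrightarrow> (\<tau> - of_nat (Suc n) + z) * g (Suc n) = g n"
  using g
proof (induction N)
  case 0
  show ?case by (simp add: algebra_simps)
next
  case (Suc N)
  define u where "u = \<tau> - of_nat (Suc N) + z"
  have "(a + b - \<tau> + z) * u - (a + z) * (b + z)
      = - of_nat (Suc N) * u - (a - \<tau> + of_nat (Suc N)) * (b - \<tau> + of_nat (Suc N))"
    by (simp add: u_def algebra_simps)
  then have "ecf a b \<tau> (Suc N) * (((a + b - \<tau> + z) * u - (a + z) * (b + z)) * g (Suc N))
     = - (of_nat (Suc N) * ecf a b \<tau> (Suc N)) * (u * g (Suc N))
       - (a - \<tau> + of_nat (Suc N)) * (b - \<tau> + of_nat (Suc N)) * ecf a b \<tau> (Suc N) * g (Suc N)"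
    by (simp only:) (simp add: algebra_simps)
  also have "u * g (Suc N) = g N" unfolding u_def by (rule Suc.prems) simp
  finally have new: "ecf a b \<tau> (Suc N) * (((a + b - \<tau> + z) * u - (a + z) * (b + z)) * g (Suc N))
     = - (of_nat (Suc N) * ecf a b \<tau> (Suc N)) * g N
       - (a - \<tau> + of_nat (Suc N)) * (b - \<tau> + of_nat (Suc N)) * ecf a b \<tau> (Suc N) * g (Suc N)" .
  have IH: "(\<Sum>n<Suc N. ecf a b \<tau> n * (((a + b - \<tau> + z) * (\<tau> - of_nat n + z) - (a + z) * (b + z)) * g n)) =
     - (a - \<tau> + of_nat N) * (b - \<tau> + of_nat N) * ecf a b \<tau> N * g N"
    by (rule Suc.IH) (use Suc.prems in simp)
  show ?case
    unfolding sum.lessThan_Suc[of _ "Suc N"] IH u_def[symmetric] new ecf_Suc by (simp del: of_nat_Suc add: algebra_simps)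
qed

text \<open>
  Divide the sum \<open>P\<close> of the first \<open>N\<close> terms by the function \<open>\<Gamma>(a + l) \<Gamma>(b + l) / \<Gamma>(a + b - \<tau> + l)\<close> to be
  approximated. The quotient \<open>X\<close> tends to 1, and its increments telescope to a single small term, so
  \<open>X - 1\<close> is small as well.
\<close>

lemma hyp_expansion:
  "growth (Re \<tau> - real N - 1)
     (\<lambda>l. hyp a b \<tau> l - (\<Sum>n<N. ecf a b \<tau> n * (Gamma (\<tau> - of_nat n + of_nat l) / fact l)))"
proof (cases N)
  case 0
  then show ?thesis using hyp_growth by simp
next
  case (Suc M)
  define P where "P l = (\<Sum>n<N. ecf a b \<tau> n * Gamma (\<tau> - of_nat n + of_nat l))" for l
  define X where "X l = P l * (Gamma (a + b - \<tau> + of_nat l) * rGamma (a + of_nat l) * rGamma (b + of_nat l))" for l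
  have "growth (- real M - 2) (\<lambda>l. X (Suc l) - X l)"
  proof -
    have "growth (Re (\<tau> - of_nat M - (a + 1)) + Re (a + b - \<tau> - (b + 1)))
       (\<lambda>l. (Gamma (\<tau> - of_nat M + of_nat l) * rGamma (a + 1 + of_nat l)) *
         (Gamma (a + b - \<tau> + of_nat l) * rGamma (b + 1 + of_nat l)))"
      by (intro growth_mult Gamma_quot_growth)
    from growth_cmult[OF this, of "- (a - \<tau> + of_nat M) * (b - \<tau> + of_nat M) * ecf a b \<tau> M"]
    have "growth (- real M - 2) (\<lambda>l. - (a - \<tau> + of_nat M) * (b - \<tau> + of_nat M) * ecf a b \<tau> M *
       ((Gamma (\<tau> - of_nat M + of_nat l) * rGamma (a + 1 + of_nat l)) *
         (Gamma (a + b - \<tau> + of_nat l) * rGamma (b + 1 + of_nat l))))"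
      by (simp add: algebra_simps)
    then show ?thesis
    proof (rule growth_cong_eventually)
      have "eventually (\<lambda>l. \<forall>n\<in>{..N}. \<tau> - of_nat n + of_nat l \<notin> \<int>\<^sub>\<le>\<^sub>0) sequentially"
        by (intro eventually_ball_finite ballI eventually_not_nonpos_Int) auto
      then show "eventually (\<lambda>l. - (a - \<tau> + of_nat M) * (b - \<tau> + of_nat M) * ecf a b \<tau> M *
       ((Gamma (\<tau> - of_nat M + of_nat l) * rGamma (a + 1 + of_nat l)) *
         (Gamma (a + b - \<tau> + of_nat l) * rGamma (b + 1 + of_nat l))) = X (Suc l) - X l) sequentially"
        using eventually_not_nonpos_Int[of "a + b - \<tau>"]
      proof eventually_elim
        case (elim l)
        define z where "z = (of_nat l :: complex)"
        define g where "g n = Gamma (\<tau> - of_nat n + z)" for n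
        define K where "K = Gamma (a + b - \<tau> + z) * rGamma (a + 1 + z) * rGamma (b + 1 + z)"
        have g: "Gamma (\<tau> - of_nat n + of_nat (Suc l)) = (\<tau> - of_nat n + z) * g n" if "n < N" for n
          using Gamma_Suc_arg[of "\<tau> - of_nat n" l] elim that by (simp add: g_def z_def)
        have g': "(\<tau> - of_nat (Suc n) + z) * g (Suc n) = g n" if "n < M" for n
        proof -
          have "g n = Gamma (\<tau> - of_nat (Suc n) + of_nat (Suc l))" by (simp add: g_def z_def algebra_simps)
          also have "\<dots> = (\<tau> - of_nat (Suc n) + of_nat l) * Gamma (\<tau> - of_nat (Suc n) + of_nat l)"
            using bspec[OF elim(1), of "Suc n"] that Suc by (intro Gamma_Suc_arg) auto
          finally show ?thesis by (simp only: g_def z_def)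
        qed
        have 1: "Gamma (a + b - \<tau> + of_nat (Suc l)) = (a + b - \<tau> + z) * Gamma (a + b - \<tau> + z)"
          using Gamma_Suc_arg[OF elim(2)] by (simp add: z_def)
        have 2: "rGamma (a + of_nat l) = (a + z) * rGamma (a + 1 + z)" "rGamma (b + of_nat l) = (b + z) * rGamma (b + 1 + z)"
          using rGamma_Suc_arg[of a l] rGamma_Suc_arg[of b l] by (simp_all add: z_def add_ac)
        have "X (Suc l) = (\<Sum>n<N. ecf a b \<tau> n * ((\<tau> - of_nat n + z) * g n)) * ((a + b - \<tau> + z) * K)"
          unfolding X_def P_def 1 using g by (simp add: K_def z_def add_ac mult_ac)
        moreover have "X l = (\<Sum>n<N. ecf a b \<tau> n * g n) * ((a + z) * (b + z) * K)"
          unfolding X_def P_def 2 by (simp add: K_def z_def g_def mult_ac)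
        ultimately have "X (Suc l) - X l =
           K * (\<Sum>n<N. ecf a b \<tau> n * (((a + b - \<tau> + z) * (\<tau> - of_nat n + z) - (a + z) * (b + z)) * g n))"
          by (simp only: sum_distrib_left sum_distrib_right sum_subtractf[symmetric])
             (intro sum.cong refl, simp add: algebra_simps)
        also have "\<dots> = K * (- (a - \<tau> + of_nat M) * (b - \<tau> + of_nat M) * ecf a b \<tau> M * g M)"
          unfolding Suc by (subst hyp_expansion_aux[OF g']) auto
        finally show ?case by (simp add: K_def g_def z_def mult_ac)
      qed
    qed
  qed
  moreover have "X \<longlonglongrightarrow> 1"
  proof -
    have "(\<lambda>l. ecf a b \<tau> n * (Gamma (\<tau> - of_nat n + of_nat l) *
         (Gamma (a + b - \<tau> + of_nat l) * rGamma (a + of_nat l) * rGamma (b + of_nat l)))) \<longlonglongrightarrow> (if n = 0 then 1 else 0)" for n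
    proof (cases "n = 0")
      case True
      have "(\<lambda>l. Gamma (\<tau> + of_nat l) * Gamma (a + b - \<tau> + of_nat l) * rGamma (a + of_nat l) * rGamma (b + of_nat l)) \<longlonglongrightarrow> 1"
        by (rule Gamma_quot_balanced_tendsto_1) simp
      then show ?thesis using True by (simp add: mult_ac)
    next
      case False
      have "growth (Re (\<tau> - of_nat n - a) + Re (a + b - \<tau> - b))
         (\<lambda>l. (Gamma (\<tau> - of_nat n + of_nat l) * rGamma (a + of_nat l)) *
           (Gamma (a + b - \<tau> + of_nat l) * rGamma (b + of_nat l)))"
        by (intro growth_mult Gamma_quot_growth)
      from growth_tendsto_0[OF growth_cmult[OF this, of "ecf a b \<tau> n"]] False show ?thesis
        by (simp add: mult_ac)
    qed
    then have "(\<lambda>l. \<Sum>n<N. ecf a b \<tau> n * (Gamma (\<tau> - of_nat n + of_nat l) *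
         (Gamma (a + b - \<tau> + of_nat l) * rGamma (a + of_nat l) * rGamma (b + of_nat l)))) \<longlonglongrightarrow> (\<Sum>n<N. if n = 0 then 1 else 0)"
      by (intro tendsto_sum)
    moreover have "(\<Sum>n<N. if n = 0 then 1 else 0 :: complex) = 1" using Suc by simp
    moreover have "X = (\<lambda>l. \<Sum>n<N. ecf a b \<tau> n * (Gamma (\<tau> - of_nat n + of_nat l) *
         (Gamma (a + b - \<tau> + of_nat l) * rGamma (a + of_nat l) * rGamma (b + of_nat l))))"
      by (simp add: fun_eq_iff X_def P_def sum_distrib_right mult.assoc)
    ultimately show ?thesis by (simp only:)
  qed
  ultimately have "growth (- real M - 2 + 1) (\<lambda>l. X l - 1)"
    by (intro growth_from_increments) auto
  from growth_mult[OF growth_cmult[OF this, of "-1"] hyp_growth[of \<tau> a b]]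
  have "growth (Re \<tau> - real N - 1) (\<lambda>l. (- 1 * (X l - 1)) * hyp a b \<tau> l)"
    by (simp add: Suc algebra_simps)
  then show ?thesis
  proof (rule growth_cong_eventually)
    show "eventually (\<lambda>l. (- 1 * (X l - 1)) * hyp a b \<tau> l
      = hyp a b \<tau> l - (\<Sum>n<N. ecf a b \<tau> n * (Gamma (\<tau> - of_nat n + of_nat l) / fact l))) sequentially"
      using eventually_not_nonpos_Int[of a] eventually_not_nonpos_Int[of b] eventually_not_nonpos_Int[of "a + b - \<tau>"]
    proof eventually_elim
      case (elim l)
      have "X l * hyp a b \<tau> l = P l / fact l * ((Gamma (a + b - \<tau> + of_nat l) * rGamma (a + b - \<tau> + of_nat l))
          * (Gamma (a + of_nat l) * rGamma (a + of_nat l)) * (Gamma (b + of_nat l) * rGamma (b + of_nat l)))"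
        by (simp add: X_def hyp_def)
      also have "\<dots> = P l / fact l" using elim by (simp add: Gamma_mult_rGamma)
      finally show ?case
        by (simp add: P_def sum_divide_distrib algebra_simps)
    qed
  qed
qed

section \<open>Partial sums of the two-parameter series\<close>

text \<open>A discrete antiderivative of \<open>\<Gamma>(x + m) / m!\<close>; for \<open>x = 0\<close> that function is \<open>1 / m\<close>.\<close>

definition antidiff :: "complex \<Rightarrow> nat \<Rightarrow> complex" where
  "antidiff x m = (if x = 0 then Digamma (of_nat m) else Gamma (x + of_nat m) / (Gamma (of_nat m) * x))"

lemma Gamma_of_nat_Suc: "Gamma (of_nat (Suc m) :: complex) = fact m"
  using Gamma_fact[of m, where ?'a = complex] by simp

lemma antidiff_increment:
  "eventually (\<lambda>m. antidiff x (Suc m) - antidiff x m = Gamma (x + of_nat m) / fact m) sequentially"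
  using eventually_gt_at_top[of 0] eventually_not_nonpos_Int[of x]
proof eventually_elim
  case (elim m)
  obtain k where k: "m = Suc k" using elim by (cases m) auto
  show ?case
  proof (cases "x = 0")
    case True
    have "Digamma (of_nat m + 1) = Digamma (of_nat m) + 1 / (of_nat m :: complex)"
      using elim by (intro Digamma_plus1) auto
    moreover have "Gamma (of_nat m :: complex) / fact m = 1 / of_nat m"
      by (simp add: k Gamma_of_nat_Suc del: of_nat_Suc)
    ultimately show ?thesis using True by (simp add: antidiff_def add_ac)
  next
    case False
    have "antidiff x (Suc m) = (x + of_nat m) * Gamma (x + of_nat m) / (fact m * x)"
      using Gamma_Suc_arg[OF elim(2)] False by (simp add: antidiff_def Gamma_of_nat_Suc del: of_nat_Suc)
    moreover have "antidiff x m = of_nat m * Gamma (x + of_nat m) / (fact m * x)"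
      using False by (simp add: antidiff_def k Gamma_of_nat_Suc divide_simps del: of_nat_Suc) 
    ultimately have "antidiff x (Suc m) - antidiff x m = x * Gamma (x + of_nat m) / (fact m * x)"
      by (simp add: diff_divide_distrib[symmetric] algebra_simps)
    then show ?thesis using False by simp
  qed
qed

lemma antidiff_tendsto_0:
  assumes "Re x < 0"
  shows "antidiff x \<longlonglongrightarrow> 0"
proof -
  have "x \<noteq> 0" using assms by auto
  have "growth (Re (x - 0)) (\<lambda>m. Gamma (x + of_nat m) * rGamma (0 + of_nat m))" by (rule Gamma_quot_growth)
  from growth_tendsto_0[OF growth_cmult[OF this, of "1 / x"]] assms \<open>x \<noteq> 0\<close> show ?thesis
    by (simp add: antidiff_def[abs_def] rGamma_inverse_Gamma divide_inverse mult_ac)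
qed

definition hyp_sum :: "complex \<Rightarrow> complex \<Rightarrow> complex \<Rightarrow> nat \<Rightarrow> complex" where
  "hyp_sum a b \<tau> m = (\<Sum>l<m. hyp a b \<tau> l)"

definition hyp_approx :: "complex \<Rightarrow> complex \<Rightarrow> complex \<Rightarrow> nat \<Rightarrow> nat \<Rightarrow> complex" where
  "hyp_approx a b \<tau> N m = (\<Sum>n<N. ecf a b \<tau> n * antidiff (\<tau> - of_nat n) m)"

lemma hyp_sum_increment:
  "growth (Re \<tau> - real N - 1)
     (\<lambda>m. (hyp_sum a b \<tau> (Suc m) - hyp_approx a b \<tau> N (Suc m)) - (hyp_sum a b \<tau> m - hyp_approx a b \<tau> N m))"
proof (rule growth_cong_eventually[OF hyp_expansion[of \<tau> N a b]])
  have "eventually (\<lambda>m. \<forall>n\<in>{..<N}. antidiff (\<tau> - of_nat n) (Suc m) - antidiff (\<tau> - of_nat n) m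
       = Gamma (\<tau> - of_nat n + of_nat m) / fact m) sequentially"
    by (intro eventually_ball_finite ballI antidiff_increment) auto
  then show "eventually (\<lambda>m. hyp a b \<tau> m - (\<Sum>n<N. ecf a b \<tau> n * (Gamma (\<tau> - of_nat n + of_nat m) / fact m))
     = (hyp_sum a b \<tau> (Suc m) - hyp_approx a b \<tau> N (Suc m)) - (hyp_sum a b \<tau> m - hyp_approx a b \<tau> N m)) sequentially"
  proof eventually_elim
    case (elim m)
    have "(\<Sum>n<N. ecf a b \<tau> n * (Gamma (\<tau> - of_nat n + of_nat m) / fact m))
       = (\<Sum>n<N. ecf a b \<tau> n * (antidiff (\<tau> - of_nat n) (Suc m) - antidiff (\<tau> - of_nat n) m))"
      using elim by (intro sum.cong) auto
    also have "\<dots> = hyp_approx a b \<tau> N (Suc m) - hyp_approx a b \<tau> N m"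
      by (simp add: hyp_approx_def right_diff_distrib sum_subtractf)
    finally show ?case by (simp add: hyp_sum_def)
  qed
qed

lemma hyp_sum_rate:
  assumes lim: "(\<lambda>m. hyp_sum a b \<tau> m - hyp_approx a b \<tau> N m) \<longlonglongrightarrow> L" and N: "Re \<tau> < real N"
  shows "growth (Re \<tau> - real N) (\<lambda>m. hyp_sum a b \<tau> m - hyp_approx a b \<tau> N m - L)"
  using growth_from_increments[OF hyp_sum_increment[of \<tau> N a b] _ lim] N by simp

text \<open>Terms beyond the order of growth do not influence the limit.\<close>

lemma hyp_approx_more:
  assumes lim: "(\<lambda>m. hyp_sum a b \<tau> m - hyp_approx a b \<tau> N m) \<longlonglongrightarrow> L" and N: "Re \<tau> < real N"
  shows "(\<lambda>m. hyp_sum a b \<tau> m - hyp_approx a b \<tau> (N + k) m) \<longlonglongrightarrow> L"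
proof (induction k)
  case (Suc k)
  have "antidiff (\<tau> - of_nat (N + k)) \<longlonglongrightarrow> 0" by (rule antidiff_tendsto_0) (use N in simp)
  from tendsto_diff[OF Suc tendsto_mult_right_zero[OF this, of "ecf a b \<tau> (N + k)"]]
  show ?case by (simp add: hyp_approx_def algebra_simps)
qed (use lim in simp)

section \<open>The constants in the divergent case\<close>

lemma Digamma_shift_diff_tendsto_0:
  fixes x :: complex
  assumes "x \<notin> \<int>\<^sub>\<le>\<^sub>0"
  shows "(\<lambda>n. Digamma (x + of_nat n) - of_real (ln (real n))) \<longlonglongrightarrow> 0"
proof -
  have nz: "\<forall>k<n. x \<noteq> - of_nat k" for n
    using assms by (metis minus_of_nat_in_nonpos_Ints)
  have eq: "Digamma (x + of_nat n) = Digamma x + (\<Sum>k<n. inverse (x + of_nat k))" for n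
    using Polygamma_plus_of_nat[OF nz[of n], of 0] by (simp add: inverse_eq_divide)
  have "x \<noteq> 0" using assms by auto
  from tendsto_diff[OF tendsto_const[of "Digamma x"] Digamma_LIMSEQ[OF this]]
  show ?thesis by (simp add: eq algebra_simps)
qed

text \<open>
  The constant in the logarithmic case \<open>\<tau> = 0\<close> arises from Gauss's theorem with \<open>c = a + b + \<delta>\<close> as
  \<open>\<delta> \<rightarrow> 0\<close>. Subtracting the series with parameters \<open>x, 1\<close>, where \<open>x = a + b - 1 + M\<close>, removes the pole at
  \<open>\<delta> = 0\<close>, and both series depend on \<open>\<delta>\<close> through the same factor, which is bounded uniformly.
\<close>

lemma hyp_sum_log_constant:
  assumes a: "a \<notin> \<int>\<^sub>\<le>\<^sub>0" and b: "b \<notin> \<int>\<^sub>\<le>\<^sub>0"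
  shows "(\<lambda>m. hyp_sum a b 0 m - Digamma (of_nat m)) \<longlonglongrightarrow> Digamma 1 - Digamma a - Digamma b"
proof -
  note nonpole = Re_pos_not_nonpos_Int
  obtain M where M: "max 0 (1 - Re (a + b)) < real M"
    using reals_Archimedean2 by blast
  define x where "x = a + b - 1 + of_nat M"
  have x: "Re x > 0" using M by (simp add: x_def)
  have M0: "M > 0" using M by simp
  note xn = nonpole[OF x]
  define H where "H \<delta> i = hyp a b (- of_real \<delta>) (i + M)" for \<delta> :: real and i
  define g where "g \<delta> i = Gamma (x + of_nat i) * rGamma (x + 1 + of_real \<delta> + of_nat i)" for \<delta> :: real and i
  define D where "D i = H 0 i - g 0 i" for i
  define w where "w \<delta> i = Gamma (x + 1 + of_nat i) * rGamma (x + 1 + of_real \<delta> + of_nat i)" for \<delta> :: real and i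
  have x1n: "x + 1 + of_nat i \<notin> \<int>\<^sub>\<le>\<^sub>0" for i by (rule nonpole) (use x in simp)
  have diff: "H \<delta> i - g \<delta> i = D i * w \<delta> i" for \<delta> i
  proof -
    have H: "H \<delta> i = Gamma (a + of_nat (i + M)) * Gamma (b + of_nat (i + M)) / fact (i + M) * rGamma (x + 1 + of_real \<delta> + of_nat i)" for \<delta>
    proof -
      have e: "a + b - (- of_real \<delta>) + of_nat (i + M) = x + 1 + of_real \<delta> + of_nat i" by (simp add: x_def)
      show ?thesis unfolding H_def hyp_def e by simp
    qed
    have 1: "rGamma (x + 1 + of_nat i) * w \<delta> i = rGamma (x + 1 + of_real \<delta> + of_nat i)"
      using Gamma_mult_rGamma[OF x1n[of i]] by (simp add: w_def mult_ac)
    have "H 0 i * w \<delta> i = Gamma (a + of_nat (i + M)) * Gamma (b + of_nat (i + M)) / fact (i + M) * (rGamma (x + 1 + of_nat i) * w \<delta> i)"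
      unfolding H by simp
    also have "\<dots> = H \<delta> i" unfolding 1 H ..
    finally have "H 0 i * w \<delta> i = H \<delta> i" .
    moreover have "g 0 i * w \<delta> i = g \<delta> i"
      using 1 by (simp add: g_def mult_ac)
    ultimately show ?thesis by (simp add: D_def left_diff_distrib)
  qed
  have g0: "g 0 i = 1 / (x + of_nat i)" for i
  proof -
    have "x + of_nat i \<notin> \<int>\<^sub>\<le>\<^sub>0" by (rule nonpole) (use x in simp)
    moreover from this have "x + of_nat i \<noteq> 0" by auto
    moreover have "rGamma (x + of_nat i) = (x + of_nat i) * rGamma (x + 1 + of_nat i)"
      using rGamma_Suc_arg[of x i] by (simp add: add_ac)
    ultimately show ?thesis using Gamma_mult_rGamma[of "x + of_nat i"] by (simp add: g_def field_simps)
  qed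
  have D_growth: "growth (- 2) D"
  proof -
    have "growth (Re 0 - real 1 - 1) (\<lambda>l. hyp a b 0 l - (\<Sum>n<1. ecf a b 0 n * (Gamma (0 - of_nat n + of_nat l) / fact l)))"
      by (rule hyp_expansion)
    then have 1: "growth (- 2) (\<lambda>l. hyp a b 0 l - Gamma (of_nat l) / fact l)" by simp
    have "growth (Re (0 - 1) + Re (a + b - 1 - (a + b)))
      (\<lambda>l. (Gamma (0 + of_nat l) * rGamma (1 + of_nat l)) * (Gamma (a + b - 1 + of_nat l) * rGamma (a + b + of_nat l)))"
      by (intro growth_mult Gamma_quot_growth)
    from growth_cmult[OF this, of "a + b - 1"]
    have "growth (- 2) (\<lambda>l. (a + b - 1) * ((Gamma (0 + of_nat l) * rGamma (1 + of_nat l)) * (Gamma (a + b - 1 + of_nat l) * rGamma (a + b + of_nat l))))"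
      by simp
    from growth_add[OF 1 this] have "growth (- 2) (\<lambda>l. hyp a b 0 l - 1 / (a + b - 1 + of_nat l))"
    proof (rule growth_cong_eventually)
      show "eventually (\<lambda>l. hyp a b 0 l - Gamma (of_nat l) / fact l +
          (a + b - 1) * ((Gamma (0 + of_nat l) * rGamma (1 + of_nat l)) * (Gamma (a + b - 1 + of_nat l) * rGamma (a + b + of_nat l)))
          = hyp a b 0 l - 1 / (a + b - 1 + of_nat l)) sequentially"
        using eventually_gt_at_top[of 0] eventually_not_nonpos_Int[of "a + b - 1"]
      proof eventually_elim
        case (elim l)
        obtain k where k: "l = Suc k" using elim by (cases l) auto
        define z where "z = a + b - 1 + of_nat l"
        have z: "z \<notin> \<int>\<^sub>\<le>\<^sub>0" "z \<noteq> 0" using elim by (auto simp: z_def)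
        have 1: "Gamma (of_nat l :: complex) / fact l = 1 / of_nat l"
          by (simp add: k Gamma_of_nat_Suc del: of_nat_Suc)
        have 2: "Gamma (0 + of_nat l) * rGamma (1 + of_nat l) = (1 / of_nat l :: complex)"
          using 1 by (simp add: rGamma_inverse_Gamma Gamma_fact divide_inverse)
        have "rGamma z = z * rGamma (a + b + of_nat l)"
          using rGamma_plus1[of z] by (simp add: z_def add_ac)
        then have 3: "Gamma z * rGamma (a + b + of_nat l) = 1 / z"
          using Gamma_mult_rGamma[OF z(1)] z(2) by (simp add: field_simps)
        have 4: "1 / of_nat l - (a + b - 1) * (1 / of_nat l * (1 / z)) = 1 / z"
          using elim z(2) by (simp add: divide_simps) (simp add: z_def)
        have 5: "h - p + q = h - (p - q)" for h p q :: complex by simp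
        show ?case unfolding 1 2 z_def[symmetric] 3 unfolding 5 4 ..
      qed
    qed
    from growth_shift[OF this, of M] show ?thesis
      unfolding D_def[abs_def] g0 H_def by (simp add: x_def add_ac)
  qed
  have w_lim: "((\<lambda>\<delta>. w \<delta> i) \<longlongrightarrow> 1) (at_right 0)" for i
  proof -
    have "((\<lambda>\<delta>. w \<delta> i) \<longlongrightarrow> Gamma (x + 1 + of_nat i) * rGamma (x + 1 + of_real 0 + of_nat i)) (at_right 0)"
      unfolding w_def by (intro tendsto_intros isCont_tendsto_compose[OF isCont_rGamma[OF continuous_ident]])
    then show ?thesis using Gamma_mult_rGamma[OF x1n[of i]] by simp
  qed
  have w_bound: "norm (w \<delta> i) \<le> norm (w \<delta> 0)" if "\<delta> > 0" for \<delta> i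
  proof -
    have xd: "x + 1 + of_real \<delta> \<notin> \<int>\<^sub>\<le>\<^sub>0" by (rule nonpole) (use x that in simp)
    then have pz: "pochhammer (x + 1 + of_real \<delta>) i \<noteq> 0" by (auto dest!: pochhammer_eq_0_imp_nonpos_Int)
    have "rGamma (x + 1 + of_real \<delta>) = pochhammer (x + 1 + of_real \<delta>) i * rGamma (x + 1 + of_real \<delta> + of_nat i)"
      by (rule pochhammer_rGamma)
    moreover have "Gamma (x + 1 + of_nat i) = pochhammer (x + 1) i * Gamma (x + 1)"
      using x1n[of 0] by (simp add: pochhammer_Gamma Gamma_eq_zero_iff)
    ultimately have "w \<delta> i = w \<delta> 0 * (pochhammer (x + 1) i / pochhammer (x + 1 + of_real \<delta>) i)"
      using pz by (simp add: w_def)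
    moreover have "norm (pochhammer (x + 1) i / pochhammer (x + 1 + of_real \<delta>) i) \<le> 1"
      using norm_pochhammer_mono[of "x + 1" \<delta> i] x that pz by (simp add: norm_divide divide_simps)
    ultimately show ?thesis
      using mult_left_le[of "norm (pochhammer (x + 1) i / pochhammer (x + 1 + of_real \<delta>) i)" "norm (w \<delta> 0)"]
      by (simp only: norm_mult norm_ge_zero)
  qed
  have w_ev: "eventually (\<lambda>\<delta>. \<forall>i. norm (w \<delta> i) \<le> 2) (at_right 0)"
  proof -
    have "eventually (\<lambda>\<delta>. norm (w \<delta> 0) < 2) (at_right 0)"
      using order_tendstoD(2)[OF tendsto_norm[OF w_lim[of 0]], of 2] by simp
    moreover have "eventually (\<lambda>\<delta> :: real. \<delta> > 0) (at_right 0)" by (simp add: eventually_at_right_less)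
    ultimately show ?thesis
    proof eventually_elim
      case (elim \<delta>)
      then show ?case using w_bound[of \<delta>] by (meson le_less_trans less_imp_le)
    qed
  qed
  have "eventually (\<lambda>\<delta>. summable (\<lambda>i. norm (D i * w \<delta> i))) (at_right 0) \<and>
        summable (\<lambda>i. norm (D i * 1)) \<and>
        ((\<lambda>\<delta>. suminf (\<lambda>i. D i * w \<delta> i)) \<longlongrightarrow> suminf (\<lambda>i. D i * 1)) (at_right 0)"
  proof (rule tannerys_theorem)
    show "((\<lambda>\<delta>. D i * w \<delta> i) \<longlongrightarrow> D i * 1) (at_right 0)" for i
      by (intro tendsto_intros w_lim)
    show "eventually (\<lambda>(i, \<delta>). norm (D i * w \<delta> i) \<le> norm (D i) * 2) (sequentially \<times>\<^sub>F at_right 0)"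
      unfolding eventually_prod_filter
    proof (intro exI conjI allI impI)
      show "eventually (\<lambda>_ :: nat. True) sequentially" by simp
      show "eventually (\<lambda>\<delta>. \<forall>i. norm (w \<delta> i) \<le> 2) (at_right 0)" by (rule w_ev)
    qed (auto simp: norm_mult intro!: mult_left_mono)
    show "summable (\<lambda>i. norm (D i) * 2)"
      using growth_summable(1)[OF D_growth] by (intro summable_mult2) simp
  qed simp
  then have lim1: "((\<lambda>\<delta>. suminf (\<lambda>i. D i * w \<delta> i)) \<longlongrightarrow> suminf D) (at_right 0)" by simp
  define \<phi> where "\<phi> z = Gamma a * Gamma b * rGamma (a + z) * rGamma (b + z) - Gamma x * rGamma (x + z) * rGamma (1 + z)" for z :: complex
  have sum_D: "suminf (\<lambda>i. D i * w \<delta> i) = Gamma (1 + of_real \<delta>) * (\<phi> (of_real \<delta>) / of_real \<delta>) - (\<Sum>l<M. hyp a b (- of_real \<delta>) l)"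
    if \<delta>: "\<delta> > 0" for \<delta>
  proof -
    have Gd: "Gamma (of_real \<delta> :: complex) = Gamma (1 + of_real \<delta>) / of_real \<delta>"
      using Gamma_plus1[of "of_real \<delta> :: complex"] nonpole[of "of_real \<delta>"] \<delta> by (simp add: add_ac)
    have "gauss_term a b (a + b + of_real \<delta>) sums
      (Gamma (a + b + of_real \<delta> - a - b) * rGamma (a + b + of_real \<delta> - a) * rGamma (a + b + of_real \<delta> - b))"
      by (rule gauss_summation) (use \<delta> in simp)
    from sums_mult[OF this, of "Gamma a * Gamma b"]
    have "(\<lambda>l. hyp a b (- of_real \<delta>) l) sums (Gamma a * Gamma b * (Gamma (of_real \<delta>) * rGamma (b + of_real \<delta>) * rGamma (a + of_real \<delta>)))"
      using a b by (simp add: hyp_eq_gauss_term algebra_simps)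
    from sums_split_initial_segment[OF this, of M]
    have 1: "H \<delta> sums (Gamma a * Gamma b * (Gamma (of_real \<delta>) * rGamma (b + of_real \<delta>) * rGamma (a + of_real \<delta>)) - (\<Sum>l<M. hyp a b (- of_real \<delta>) l))"
      by (simp add: H_def[abs_def])
    have "gauss_term x 1 (x + 1 + of_real \<delta>) sums
      (Gamma (x + 1 + of_real \<delta> - x - 1) * rGamma (x + 1 + of_real \<delta> - x) * rGamma (x + 1 + of_real \<delta> - 1))"
      by (rule gauss_summation) (use \<delta> in simp)
    from sums_mult[OF this, of "Gamma x"]
    have 2: "g \<delta> sums (Gamma x * (Gamma (of_real \<delta>) * rGamma (1 + of_real \<delta>) * rGamma (x + of_real \<delta>)))"
      using xn by (simp add: g_def[abs_def] gauss_term_def pochhammer_Gamma Gamma_eq_zero_iff pochhammer_fact[symmetric] algebra_simps)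
    from sums_diff[OF 1 2] have "(\<lambda>i. D i * w \<delta> i) sums (Gamma a * Gamma b * (Gamma (of_real \<delta>) * rGamma (b + of_real \<delta>) * rGamma (a + of_real \<delta>))
       - (\<Sum>l<M. hyp a b (- of_real \<delta>) l) - Gamma x * (Gamma (of_real \<delta>) * rGamma (1 + of_real \<delta>) * rGamma (x + of_real \<delta>)))"
      by (simp add: diff)
    also have "Gamma a * Gamma b * (Gamma (of_real \<delta>) * rGamma (b + of_real \<delta>) * rGamma (a + of_real \<delta>))
       - (\<Sum>l<M. hyp a b (- of_real \<delta>) l) - Gamma x * (Gamma (of_real \<delta>) * rGamma (1 + of_real \<delta>) * rGamma (x + of_real \<delta>))
       = Gamma (of_real \<delta>) * \<phi> (of_real \<delta>) - (\<Sum>l<M. hyp a b (- of_real \<delta>) l)"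
      by (simp add: \<phi>_def algebra_simps)
    finally show ?thesis unfolding Gd by (simp add: sums_iff)
  qed
  have lim2: "((\<lambda>\<delta>. Gamma (1 + of_real \<delta>) * (\<phi> (of_real \<delta>) / of_real \<delta>) - (\<Sum>l<M. hyp a b (- of_real \<delta>) l))
     \<longlongrightarrow> Gamma (1 + of_real 0) * (Digamma x + Digamma 1 - Digamma a - Digamma b) - (\<Sum>l<M. hyp a b (- of_real 0) l)) (at_right 0)"
  proof (intro tendsto_diff tendsto_mult tendsto_sum)
    show "((\<lambda>\<delta>. Gamma (1 + complex_of_real \<delta>)) \<longlongrightarrow> Gamma (1 + of_real 0)) (at_right 0)"
      by (intro tendsto_intros) auto
    have "(\<phi> has_field_derivative (Digamma x + Digamma 1 - Digamma a - Digamma b)) (at 0)"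
    proof -
      have rG: "((\<lambda>z. rGamma (c + z)) has_field_derivative (- rGamma c * Digamma c)) (at 0)" if "c \<notin> \<int>\<^sub>\<le>\<^sub>0" for c :: complex
        using has_field_derivative_rGamma_no_nonpos_int[OF that] DERIV_shift[of rGamma "- rGamma c * Digamma c" 0 c]
        by (simp add: add.commute)
      have one: "(1 :: complex) \<notin> \<int>\<^sub>\<le>\<^sub>0" by (rule nonpole) simp
      have "((\<lambda>z. Gamma a * Gamma b * (rGamma (a + z) * rGamma (b + z)) - Gamma x * (rGamma (x + z) * rGamma (1 + z))) has_field_derivative
          (Gamma a * Gamma b * (- rGamma a * Digamma a * rGamma (b + 0) + - rGamma b * Digamma b * rGamma (a + 0))
           - Gamma x * (- rGamma x * Digamma x * rGamma (1 + 0) + - rGamma 1 * Digamma 1 * rGamma (x + 0)))) (at 0)"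
        by (intro DERIV_diff DERIV_cmult DERIV_mult rG a b xn one)
      also have "(\<lambda>z. Gamma a * Gamma b * (rGamma (a + z) * rGamma (b + z)) - Gamma x * (rGamma (x + z) * rGamma (1 + z))) = \<phi>"
        by (simp add: \<phi>_def fun_eq_iff mult.assoc)
      also have "Gamma a * Gamma b * (- rGamma a * Digamma a * rGamma (b + 0) + - rGamma b * Digamma b * rGamma (a + 0))
           - Gamma x * (- rGamma x * Digamma x * rGamma (1 + 0) + - rGamma 1 * Digamma 1 * rGamma (x + 0))
         = (Gamma x * rGamma x) * (Digamma x + Digamma 1) - (Gamma a * rGamma a) * (Gamma b * rGamma b) * (Digamma a + Digamma b)"
        by (simp add: algebra_simps)
      also have "\<dots> = Digamma x + Digamma 1 - Digamma a - Digamma b"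
        using a b xn by (simp add: Gamma_mult_rGamma)
      finally show ?thesis .
    qed
    moreover have \<phi>0: "\<phi> 0 = 0"
    proof -
      have "\<phi> 0 = (Gamma a * rGamma a) * (Gamma b * rGamma b) - Gamma x * rGamma x"
        by (simp add: \<phi>_def)
      then show ?thesis using a b xn by (simp add: Gamma_mult_rGamma)
    qed
    ultimately have "((\<lambda>z. \<phi> z / z) \<longlongrightarrow> Digamma x + Digamma 1 - Digamma a - Digamma b) (at 0)"
      unfolding has_field_derivative_iff by (simp add: \<phi>0)
    moreover have "filterlim complex_of_real (at 0) (at_right 0)"
      unfolding filterlim_at by (auto intro!: tendsto_eq_intros simp: eventually_at_filter)
    ultimately show "((\<lambda>\<delta>. \<phi> (of_real \<delta>) / of_real \<delta>) \<longlongrightarrow> Digamma x + Digamma 1 - Digamma a - Digamma b) (at_right 0)"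
      by (rule filterlim_compose)
    show "((\<lambda>\<delta>. hyp a b (- complex_of_real \<delta>) l) \<longlongrightarrow> hyp a b (- of_real 0) l) (at_right 0)" for l
      unfolding hyp_def by (intro tendsto_intros isCont_tendsto_compose[OF isCont_rGamma[OF continuous_ident]]) auto
  qed
  have "suminf D = Digamma x + Digamma 1 - Digamma a - Digamma b - hyp_sum a b 0 M"
  proof (rule tendsto_unique[OF _ lim1])
    show "((\<lambda>\<delta>. suminf (\<lambda>i. D i * w \<delta> i)) \<longlongrightarrow> Digamma x + Digamma 1 - Digamma a - Digamma b - hyp_sum a b 0 M) (at_right 0)"
    proof (rule Lim_transform_eventually)
      show "((\<lambda>\<delta>. Gamma (1 + of_real \<delta>) * (\<phi> (of_real \<delta>) / of_real \<delta>) - (\<Sum>l<M. hyp a b (- of_real \<delta>) l))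
        \<longlongrightarrow> Digamma x + Digamma 1 - Digamma a - Digamma b - hyp_sum a b 0 M) (at_right 0)"
        using lim2 by (simp add: hyp_sum_def)
      show "eventually (\<lambda>\<delta>. Gamma (1 + of_real \<delta>) * (\<phi> (of_real \<delta>) / of_real \<delta>) - (\<Sum>l<M. hyp a b (- of_real \<delta>) l)
        = suminf (\<lambda>i. D i * w \<delta> i)) (at_right 0)"
        using eventually_at_right_less[of "0::real"] by eventually_elim (simp add: sum_D)
    qed
  qed simp
  moreover have "(\<lambda>n. \<Sum>i<n. D i) \<longlonglongrightarrow> suminf D"
    by (rule summable_LIMSEQ) (rule growth_summable(2)[OF D_growth], simp)
  moreover have "(\<Sum>i<n. D i) = hyp_sum a b 0 (n + M) - hyp_sum a b 0 M - (Digamma (x + of_nat n) - Digamma x)" for n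
  proof -
    have "hyp_sum a b 0 (n + M) = hyp_sum a b 0 M + (\<Sum>i<n. hyp a b 0 (i + M))"
      unfolding hyp_sum_def by (induction n) (simp_all add: algebra_simps)
    moreover have "\<forall>k<n. x \<noteq> - of_nat k" using xn by (metis minus_of_nat_in_nonpos_Ints)
    from Polygamma_plus_of_nat[OF this, of 0]
    have "Digamma (x + of_nat n) = Digamma x + (\<Sum>i<n. 1 / (x + of_nat i))" by simp
    ultimately show ?thesis by (simp add: D_def H_def g0 sum_subtractf)
  qed
  ultimately have "(\<lambda>n. hyp_sum a b 0 (n + M) - hyp_sum a b 0 M - (Digamma (x + of_nat n) - Digamma x)) \<longlonglongrightarrow>
     Digamma x + Digamma 1 - Digamma a - Digamma b - hyp_sum a b 0 M" by simp
  from tendsto_add[OF this tendsto_const[of "hyp_sum a b 0 M - Digamma x"]]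
  have lim3: "(\<lambda>n. hyp_sum a b 0 (n + M) - Digamma (x + of_nat n)) \<longlonglongrightarrow> Digamma 1 - Digamma a - Digamma b"
    by (simp add: algebra_simps)
  have "of_nat M \<notin> (\<int>\<^sub>\<le>\<^sub>0 :: complex set)" by (rule nonpole) (use M0 in simp)
  from tendsto_add[OF lim3 tendsto_diff[OF Digamma_shift_diff_tendsto_0[OF xn] Digamma_shift_diff_tendsto_0[OF this]]]
  have "(\<lambda>n. hyp_sum a b 0 (n + M) - Digamma (of_nat (n + M))) \<longlonglongrightarrow> Digamma 1 - Digamma a - Digamma b"
    by (simp add: algebra_simps)
  then show ?thesis by (rule LIMSEQ_offset)
qed

text \<open>Gauss's contiguous relation, summed over \<open>l < m\<close>.\<close>

lemma hyp_sum_contiguous: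
  assumes "a \<notin> \<int>\<^sub>\<le>\<^sub>0" "b \<notin> \<int>\<^sub>\<le>\<^sub>0"
  shows "\<tau> * hyp_sum a b \<tau> m + (a - \<tau>) * (b - \<tau>) * hyp_sum a b (\<tau> - 1) m = of_nat m * hyp a b \<tau> m"
proof (induction m)
  case (Suc m)
  define G where "G = Gamma a * Gamma b"
  have "\<tau> * hyp a b \<tau> m + (a - \<tau>) * (b - \<tau>) * hyp a b (\<tau> - 1) m
     = of_nat (Suc m) * hyp a b \<tau> (Suc m) - of_nat m * hyp a b \<tau> m"
  proof -
    have "a + b - (\<tau> - 1) = a + b - \<tau> + 1" by simp
    then have "\<tau> * hyp a b \<tau> m + (a - \<tau>) * (b - \<tau>) * hyp a b (\<tau> - 1) m
       = - G * ((a + b - \<tau> - a - b) * gauss_term a b (a + b - \<tau>) m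
           - (a + b - \<tau> - a) * (a + b - \<tau> - b) * gauss_term a b (a + b - \<tau> + 1) m)"
      unfolding hyp_eq_gauss_term[OF assms] by (simp add: G_def algebra_simps)
    also have "\<dots> = of_nat (Suc m) * hyp a b \<tau> (Suc m) - of_nat m * hyp a b \<tau> m"
      unfolding gauss_term_contiguous hyp_eq_gauss_term[OF assms] G_def[symmetric]
      by (simp add: algebra_simps del: of_nat_Suc)
    finally show ?thesis .
  qed
  with Suc show ?case by (simp add: hyp_sum_def algebra_simps)
qed (simp add: hyp_sum_def)

text \<open>
  The contiguous relation raises \<open>\<tau>\<close> from \<open>T\<close> to \<open>T + 1\<close>. All growing terms cancel, and what is left for the
  constants is the recurrence \<open>\<psi>(z + 1) = \<psi>(z) + 1 / z\<close>.
\<close>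

lemma hyp_sum_constant:
  assumes ab: "a \<notin> \<int>\<^sub>\<le>\<^sub>0" "b \<notin> \<int>\<^sub>\<le>\<^sub>0"
  shows "(\<lambda>m. hyp_sum a b (of_nat T) m - hyp_approx a b (of_nat T) (Suc T) m) \<longlonglongrightarrow>
     ecf a b (of_nat T) T * (Digamma (1 + of_nat T) - Digamma a - Digamma b)"
proof (induction T)
  case 0
  show ?case using hyp_sum_log_constant[OF ab] by (simp add: hyp_approx_def antidiff_def)
next
  case (Suc T)
  define \<tau> :: complex where "\<tau> = of_nat (Suc T)"
  define e where "e = ecf a b \<tau>"
  define \<kappa> where "\<kappa> = Digamma (1 + of_nat T) - Digamma a - Digamma b"
  define L where "L m = hyp_sum a b \<tau> m - hyp_approx a b \<tau> (Suc (Suc T)) m" for m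
  define L' where "L' m = hyp_sum a b (\<tau> - 1) m - hyp_approx a b (\<tau> - 1) (Suc T) m" for m
  have \<tau>0: "\<tau> \<noteq> 0" unfolding \<tau>_def by (simp del: of_nat_Suc)
  have \<tau>1: "\<tau> - 1 = of_nat T" by (simp add: \<tau>_def)
  have lower: "(a - \<tau>) * (b - \<tau>) * ecf a b (\<tau> - 1) n = - (of_nat (Suc n) * e (Suc n))" for n
    unfolding e_def ecf_Suc_lower by (simp only: mult_minus_left minus_minus)
  have L': "L' \<longlonglongrightarrow> ecf a b (\<tau> - 1) T * \<kappa>"
    using Suc unfolding L'_def[abs_def] \<kappa>_def \<tau>1 .
  have comb: "\<tau> * L m + (a - \<tau>) * (b - \<tau>) * L' m
      = of_nat m * hyp a b \<tau> m - (\<Sum>n<Suc T. e n * ((\<tau> - of_nat n) * antidiff (\<tau> - of_nat n) m))" for m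
  proof -
    have "(a - \<tau>) * (b - \<tau>) * hyp_approx a b (\<tau> - 1) (Suc T) m
        = (\<Sum>n<Suc T. - (of_nat (Suc n) * e (Suc n)) * antidiff (\<tau> - of_nat (Suc n)) m)"
      unfolding hyp_approx_def sum_distrib_left lower[symmetric] by (simp add: mult.assoc diff_diff_add)
    also have "\<dots> = (\<Sum>n<Suc (Suc T). - (of_nat n * e n) * antidiff (\<tau> - of_nat n) m)"
      by (subst sum.lessThan_Suc_shift[of _ "Suc T"]) simp
    finally have "\<tau> * hyp_approx a b \<tau> (Suc (Suc T)) m + (a - \<tau>) * (b - \<tau>) * hyp_approx a b (\<tau> - 1) (Suc T) m
        = (\<Sum>n<Suc (Suc T). e n * ((\<tau> - of_nat n) * antidiff (\<tau> - of_nat n) m))"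
      by (simp only: hyp_approx_def sum_distrib_left e_def[symmetric] sum.distrib[symmetric])
         (intro sum.cong refl, simp add: algebra_simps)
    also have "\<dots> = (\<Sum>n<Suc T. e n * ((\<tau> - of_nat n) * antidiff (\<tau> - of_nat n) m))"
      unfolding sum.lessThan_Suc[of _ "Suc T"] by (simp add: \<tau>_def)
    finally have approx: "\<tau> * hyp_approx a b \<tau> (Suc (Suc T)) m + (a - \<tau>) * (b - \<tau>) * hyp_approx a b (\<tau> - 1) (Suc T) m
        = (\<Sum>n<Suc T. e n * ((\<tau> - of_nat n) * antidiff (\<tau> - of_nat n) m))" .
    have split: "\<tau> * (x - y) + q * (x' - y') = (\<tau> * x + q * x') - (\<tau> * y + q * y')" for x y x' y' q
      by (simp add: algebra_simps)
    show ?thesis unfolding L_def L'_def split hyp_sum_contiguous[OF ab] approx ..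
  qed
  have "(\<lambda>m. of_nat m * hyp a b \<tau> m - (\<Sum>n<Suc T. e n * ((\<tau> - of_nat n) * antidiff (\<tau> - of_nat n) m))) \<longlonglongrightarrow> e (Suc T)"
  proof -
    have "growth (Re \<tau> - real (Suc (Suc T)) - 1) (\<lambda>m. hyp a b \<tau> m - (\<Sum>n<Suc (Suc T). e n * (Gamma (\<tau> - of_nat n + of_nat m) / fact m)))"
      unfolding e_def by (rule hyp_expansion)
    moreover have "growth 1 (\<lambda>m. of_nat m)" by (rule growthI[where C = 1]) simp
    ultimately have "growth (1 + (Re \<tau> - real (Suc (Suc T)) - 1))
        (\<lambda>m. of_nat m * (hyp a b \<tau> m - (\<Sum>n<Suc (Suc T). e n * (Gamma (\<tau> - of_nat n + of_nat m) / fact m))))"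
      using growth_mult by blast
    then have "(\<lambda>m. of_nat m * (hyp a b \<tau> m - (\<Sum>n<Suc (Suc T). e n * (Gamma (\<tau> - of_nat n + of_nat m) / fact m)))) \<longlonglongrightarrow> 0"
      by (rule growth_tendsto_0) (simp add: \<tau>_def)
    from tendsto_add[OF this tendsto_const[of "e (Suc T)"]]
    have "(\<lambda>m. of_nat m * (hyp a b \<tau> m - (\<Sum>n<Suc (Suc T). e n * (Gamma (\<tau> - of_nat n + of_nat m) / fact m))) + e (Suc T)) \<longlonglongrightarrow> e (Suc T)"
      by simp
    then show ?thesis
    proof (rule Lim_transform_eventually)
      show "eventually (\<lambda>m. of_nat m * (hyp a b \<tau> m - (\<Sum>n<Suc (Suc T). e n * (Gamma (\<tau> - of_nat n + of_nat m) / fact m))) + e (Suc T)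
         = of_nat m * hyp a b \<tau> m - (\<Sum>n<Suc T. e n * ((\<tau> - of_nat n) * antidiff (\<tau> - of_nat n) m))) sequentially"
        using eventually_gt_at_top[of 0]
      proof eventually_elim
        case (elim m)
        obtain k where k: "m = Suc k" using elim by (cases m) auto
        have 1: "of_nat m * (Gamma (\<tau> - of_nat n + of_nat m) / fact m) = (\<tau> - of_nat n) * antidiff (\<tau> - of_nat n) m" if "n < Suc T" for n
        proof -
          have "\<tau> - of_nat n \<noteq> 0" using that unfolding \<tau>_def by (simp del: of_nat_Suc)
          then show ?thesis by (simp add: antidiff_def k Gamma_of_nat_Suc del: of_nat_Suc)
        qed
        have 2: "of_nat m * (Gamma (\<tau> - of_nat (Suc T) + of_nat m) / fact m) = 1"
          by (simp add: \<tau>_def k Gamma_of_nat_Suc del: of_nat_Suc)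
        have "of_nat m * (\<Sum>n<Suc (Suc T). e n * (Gamma (\<tau> - of_nat n + of_nat m) / fact m))
          = (\<Sum>n<Suc (Suc T). e n * (of_nat m * (Gamma (\<tau> - of_nat n + of_nat m) / fact m)))"
          unfolding sum_distrib_left by (intro sum.cong refl) (simp only: mult.left_commute)
        also have "\<dots> = (\<Sum>n<Suc T. e n * (of_nat m * (Gamma (\<tau> - of_nat n + of_nat m) / fact m))) + e (Suc T)"
          unfolding sum.lessThan_Suc[of _ "Suc T"] 2 by simp
        also have "(\<Sum>n<Suc T. e n * (of_nat m * (Gamma (\<tau> - of_nat n + of_nat m) / fact m)))
            = (\<Sum>n<Suc T. e n * ((\<tau> - of_nat n) * antidiff (\<tau> - of_nat n) m))"
          by (intro sum.cong refl arg_cong2[of _ _ _ _ "(*)"] 1) auto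
        finally show ?case by (simp add: right_diff_distrib del: sum.lessThan_Suc)
      qed
    qed
  qed
  then have "(\<lambda>m. \<tau> * L m + (a - \<tau>) * (b - \<tau>) * L' m) \<longlonglongrightarrow> e (Suc T)"
    unfolding comb .
  from tendsto_diff[OF this tendsto_mult_left[OF L', of "(a - \<tau>) * (b - \<tau>)"]]
  have "(\<lambda>m. \<tau> * L m) \<longlonglongrightarrow> e (Suc T) - (a - \<tau>) * (b - \<tau>) * (ecf a b (\<tau> - 1) T * \<kappa>)"
    by simp
  from tendsto_mult_left[OF this, of "1 / \<tau>"]
  have "L \<longlonglongrightarrow> (e (Suc T) - (a - \<tau>) * (b - \<tau>) * ecf a b (\<tau> - 1) T * \<kappa>) / \<tau>"
    using \<tau>0 by (simp add: mult.assoc)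
  also have "(e (Suc T) - (a - \<tau>) * (b - \<tau>) * ecf a b (\<tau> - 1) T * \<kappa>) / \<tau> = e (Suc T) * (1 / \<tau> + \<kappa>)"
    unfolding lower \<tau>_def[symmetric] using \<tau>0 by (simp add: field_simps)
  also have "1 / \<tau> + \<kappa> = Digamma (1 + \<tau>) - Digamma a - Digamma b"
  proof -
    have "Digamma (\<tau> + 1) = Digamma \<tau> + 1 / \<tau>" using \<tau>0 by (rule Digamma_plus1)
    moreover have "1 + of_nat T = \<tau>" by (simp add: \<tau>_def)
    ultimately show ?thesis by (simp add: \<kappa>_def add.commute)
  qed
  finally show ?case by (simp add: L_def[abs_def] e_def \<tau>_def del: of_nat_Suc)
qed

lemma hyp_sums_convergent:
  assumes ab: "a \<notin> \<int>\<^sub>\<le>\<^sub>0" "b \<notin> \<int>\<^sub>\<le>\<^sub>0" and n: "n > 0"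
  shows "hyp a b (- of_nat n) sums (Gamma (of_nat n) / (pochhammer a n * pochhammer b n))"
proof -
  have "gauss_term a b (a + b + of_nat n) sums (Gamma (a + b + of_nat n - a - b) * rGamma (a + b + of_nat n - a) * rGamma (a + b + of_nat n - b))"
    by (rule gauss_summation) (use n in simp)
  from sums_mult[OF this, of "Gamma a * Gamma b"]
  have "hyp a b (- of_nat n) sums (Gamma a * Gamma b * (Gamma (of_nat n) * rGamma (b + of_nat n) * rGamma (a + of_nat n)))"
    using hyp_eq_gauss_term[OF ab, of "- of_nat n", abs_def] by (simp add: algebra_simps)
  also have "Gamma a * Gamma b * (Gamma (of_nat n) * rGamma (b + of_nat n) * rGamma (a + of_nat n))
     = Gamma (of_nat n) / (pochhammer a n * pochhammer b n)"
    using ab by (simp add: pochhammer_Gamma rGamma_inverse_Gamma field_simps)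
  finally show ?thesis .
qed

text \<open>
  The constant in the partial sum of the series with \<open>\<tau> = t - k\<close>, in the divergent case \<open>k \<le> t\<close> and in
  the convergent case.
\<close>

definition hyp_const :: "complex \<Rightarrow> complex \<Rightarrow> nat \<Rightarrow> nat \<Rightarrow> complex" where
  "hyp_const a b t k =
     (if k \<le> t then ecf a b (of_nat t - of_nat k) (t - k) * (Digamma (1 + of_nat t - of_nat k) - Digamma a - Digamma b)
      else Gamma (of_nat (k - t)) / (pochhammer a (k - t) * pochhammer b (k - t)))"

lemma hyp_sum_convergent_limit:
  assumes ab: "a \<notin> \<int>\<^sub>\<le>\<^sub>0" "b \<notin> \<int>\<^sub>\<le>\<^sub>0" and "t < k"
  shows "hyp_sum a b (of_nat t - of_nat k) \<longlonglongrightarrow> hyp_const a b t k"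
proof -
  have eq: "(of_nat t - of_nat k :: complex) = - of_nat (k - t)" using assms by (simp add: of_nat_diff)
  show ?thesis using hyp_sums_convergent[OF ab, of "k - t"] assms(3)
    unfolding eq hyp_const_def hyp_sum_def[abs_def] sums_def by simp
qed

text \<open>
  With \<open>t + 3 - k\<close> terms the expansion reaches the order \<open>m\<^sup>-\<^sup>3\<close> for every \<open>k\<close>. For \<open>k \<ge> t + 3\<close> the truncated
  subtraction leaves no term at all, and the tail of the convergent series is itself of that order.
\<close>

lemma hyp_sum_asymp:
  assumes ab: "a \<notin> \<int>\<^sub>\<le>\<^sub>0" "b \<notin> \<int>\<^sub>\<le>\<^sub>0"
  shows "growth (- 3) (\<lambda>m. hyp_sum a b (of_nat t - of_nat k) m
           - hyp_approx a b (of_nat t - of_nat k) (t + 3 - k) m - hyp_const a b t k)"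
proof -
  let ?\<tau> = "of_nat t - of_nat k :: complex"
  have "(\<lambda>m. hyp_sum a b ?\<tau> m - hyp_approx a b ?\<tau> (t + 3 - k) m) \<longlonglongrightarrow> hyp_const a b t k"
  proof (cases "k \<le> t")
    case True
    have \<tau>: "?\<tau> = of_nat (t - k)" using True by (simp add: of_nat_diff)
    have "(\<lambda>m. hyp_sum a b ?\<tau> m - hyp_approx a b ?\<tau> (Suc (t - k)) m) \<longlonglongrightarrow> hyp_const a b t k"
    proof -
      have "1 + of_nat t - of_nat k = (1 + of_nat (t - k) :: complex)" using True by (simp add: of_nat_diff)
      then have "hyp_const a b t k = ecf a b (of_nat (t - k)) (t - k) * (Digamma (1 + of_nat (t - k)) - Digamma a - Digamma b)"
        using True by (simp only: hyp_const_def \<tau> if_True)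
      then show ?thesis using hyp_sum_constant[OF ab, of "t - k"] by (simp only: \<tau>)
    qed
    then have "(\<lambda>m. hyp_sum a b ?\<tau> m - hyp_approx a b ?\<tau> (Suc (t - k) + 2) m) \<longlonglongrightarrow> hyp_const a b t k"
      by (rule hyp_approx_more) (simp add: \<tau>)
    moreover have "Suc (t - k) + 2 = t + 3 - k" using True by simp
    ultimately show ?thesis by (simp only:)
  next
    case False
    have "(\<lambda>m. hyp_sum a b ?\<tau> m - hyp_approx a b ?\<tau> 0 m) \<longlonglongrightarrow> hyp_const a b t k"
      using hyp_sum_convergent_limit[OF ab, of t k] False by (simp add: hyp_approx_def)
    then have "(\<lambda>m. hyp_sum a b ?\<tau> m - hyp_approx a b ?\<tau> (0 + (t + 3 - k)) m) \<longlonglongrightarrow> hyp_const a b t k"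
      by (rule hyp_approx_more) (use False in simp)
    then show ?thesis by simp
  qed
  then have "growth (Re ?\<tau> - real (t + 3 - k)) (\<lambda>m. hyp_sum a b ?\<tau> m - hyp_approx a b ?\<tau> (t + 3 - k) m - hyp_const a b t k)"
    by (rule hyp_sum_rate) (cases "k \<le> t + 3", auto simp: of_nat_diff)
  then show ?thesis by (rule growth_mono) (cases "k \<le> t + 3", auto simp: of_nat_diff)
qed

section \<open>Summation over the inverse factorial series\<close>

text \<open>
  The dependence on \<open>k\<close> and \<open>l\<close> together is \<open>1 / (\<sigma> + k)\<^sub>l\<close>, and \<open>\<bar>(\<sigma> + k)\<^sub>l\<bar>\<close> increases with \<open>k\<close> once \<open>Re (\<sigma> + k) > 0\<close>.
\<close>

lemma coeffA_hyp_bound: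
  fixes a b :: "nat \<Rightarrow> complex"
  assumes p: "p \<ge> 1" and Re_a: "\<And>j. j \<in> {3..p + 1} \<Longrightarrow> Re (a j) > \<epsilon>"
    and sig: "sig p a b = a 1 + a 2 - of_nat t" and K: "Re (sig p a b + of_nat K) > 0"
  obtains C where "C \<ge> 0" "\<And>k l. k \<ge> K \<Longrightarrow> norm (coeffA p a b k * hyp (a 1) (a 2) (of_nat t - of_nat k) l)
    \<le> C * real (Suc k) powr (- 1 - \<epsilon>) * norm (hyp (a 1) (a 2) (of_nat t - of_nat K) l)"
proof -
  define s where "s = sig p a b"
  have "growth (- 1 - \<epsilon>) (\<lambda>k. coeffA p a b k * rGamma (s + of_nat k))"
    unfolding s_def by (intro regular_growth coeffA_regular p Re_a)
  then obtain C where C: "C \<ge> 0" "\<And>k. norm (coeffA p a b k * rGamma (s + of_nat k)) \<le> C * real (Suc k) powr (- 1 - \<epsilon>)"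
    using growthE by blast
  have nonpole: "s + of_nat k \<notin> \<int>\<^sub>\<le>\<^sub>0" if "k \<ge> K" for k
  proof -
    have "Re (s + of_nat k) > 0" using K that by (simp add: s_def)
    then show ?thesis by (rule Re_pos_not_nonpos_Int)
  qed
  have pz: "pochhammer (s + of_nat k) l \<noteq> 0" if "k \<ge> K" for k l
    using nonpole[OF that] by (auto dest!: pochhammer_eq_0_imp_nonpos_Int)
  have hyp_eq: "hyp (a 1) (a 2) (of_nat t - of_nat k) l = Gamma (a 1 + of_nat l) * Gamma (a 2 + of_nat l) / fact l
      * (rGamma (s + of_nat k) / pochhammer (s + of_nat k) l)" if "k \<ge> K" for k l
  proof -
    have "a 1 + a 2 - (of_nat t - of_nat k) + of_nat l = s + of_nat k + of_nat l"
      by (simp add: s_def sig)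
    moreover have "rGamma (s + of_nat k + of_nat l) = rGamma (s + of_nat k) / pochhammer (s + of_nat k) l"
      using pochhammer_rGamma[of "s + of_nat k" l] pz[OF that, of l] by (simp add: field_simps)
    ultimately show ?thesis by (simp only: hyp_def) simp
  qed
  show ?thesis
  proof (rule that[of "C * norm (Gamma (s + of_nat K))"])
    show "0 \<le> C * norm (Gamma (s + of_nat K))" using C(1) by simp
    fix k l assume k: "k \<ge> K"
    define G where "G = Gamma (a 1 + of_nat l) * Gamma (a 2 + of_nat l) / fact l"
    have mono: "norm (pochhammer (s + of_nat K) l) \<le> norm (pochhammer (s + of_nat k) l)"
      using norm_pochhammer_mono[of "s + of_nat K" "real (k - K)" l] K k
      by (simp add: s_def of_nat_diff)
    have "norm (coeffA p a b k * hyp (a 1) (a 2) (of_nat t - of_nat k) l)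
       = norm (coeffA p a b k * rGamma (s + of_nat k)) * (norm G / norm (pochhammer (s + of_nat k) l))"
      unfolding hyp_eq[OF k] G_def[symmetric] by (simp add: norm_mult norm_divide)
    also have "\<dots> \<le> (C * real (Suc k) powr (- 1 - \<epsilon>)) * (norm G / norm (pochhammer (s + of_nat K) l))"
      using C(2)[of k] C(1) mono pz[of K l] pz[OF k, of l]
      by (intro mult_mono divide_left_mono mult_pos_pos) auto
    also have "norm G / norm (pochhammer (s + of_nat K) l)
       = norm (Gamma (s + of_nat K)) * norm (hyp (a 1) (a 2) (of_nat t - of_nat K) l)"
    proof -
      have "Gamma (s + of_nat K) * hyp (a 1) (a 2) (of_nat t - of_nat K) l
          = (Gamma (s + of_nat K) * rGamma (s + of_nat K)) * (G / pochhammer (s + of_nat K) l)"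
        unfolding hyp_eq[OF order_refl] G_def[symmetric] by simp
      also have "\<dots> = G / pochhammer (s + of_nat K) l" by (simp add: Gamma_mult_rGamma nonpole)
      finally show ?thesis by (metis norm_mult norm_divide)
    qed
    finally show "norm (coeffA p a b k * hyp (a 1) (a 2) (of_nat t - of_nat k) l)
      \<le> C * norm (Gamma (s + of_nat K)) * real (Suc k) powr (- 1 - \<epsilon>) * norm (hyp (a 1) (a 2) (of_nat t - of_nat K) l)"
      by (simp only: mult_ac)
  qed
qed

text \<open>
  Finitely many indices \<open>k < K\<close> are treated one by one. For \<open>k \<ge> K\<close> the remainders are tails of convergent
  series in \<open>l\<close>, and the uniform bound allows summation over \<open>k\<close>; at \<open>m = 0\<close>, where the partial sums are
  empty, it also gives the summability of the constants.
\<close>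

theorem partial_sums_asymp:
  fixes a b :: "nat \<Rightarrow> complex"
  assumes p: "p \<ge> 1"
    and a1: "a 1 \<notin> \<int>\<^sub>\<le>\<^sub>0" and a2: "a 2 \<notin> \<int>\<^sub>\<le>\<^sub>0"
    and Re_a: "\<And>j. j \<in> {3..p + 1} \<Longrightarrow> Re (a j) > 0"
    and sig: "sig p a b = a 1 + a 2 - of_nat t"
  defines "A \<equiv> coeffA p a b"
  shows "summable (\<lambda>k. A k * hyp_const (a 1) (a 2) t k)"
    and "growth (- 3) (\<lambda>m.
        (\<Sum>l<m. Gamma (a 1 + of_nat l) * Gamma (a 2 + of_nat l) / fact l *
           ((\<Prod>j=3..p + 1. Gamma (a j + of_nat l)) * (\<Prod>i=1..p. rGamma (b i + of_nat l))))
        - (\<Sum>k<t + 3. A k * hyp_approx (a 1) (a 2) (of_nat t - of_nat k) (t + 3 - k) m)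
        - (\<Sum>k. A k * hyp_const (a 1) (a 2) t k))"
proof -
  define h where "h k = hyp (a 1) (a 2) (of_nat t - of_nat k)" for k
  define S where "S k = hyp_sum (a 1) (a 2) (of_nat t - of_nat k)" for k
  define c where "c = hyp_const (a 1) (a 2) t"
  define R where "R k = hyp_approx (a 1) (a 2) (of_nat t - of_nat k) (t + 3 - k)" for k
  define f where "f l = Gamma (a 1 + of_nat l) * Gamma (a 2 + of_nat l) / fact l *
           ((\<Prod>j=3..p + 1. Gamma (a j + of_nat l)) * (\<Prod>i=1..p. rGamma (b i + of_nat l)))" for l
  obtain \<epsilon> where eps: "\<epsilon> > 0" "\<And>j. j \<in> {3..p + 1} \<Longrightarrow> Re (a j) > \<epsilon>"
    by (rule ex_positive_lower_bound[of "{3..p + 1}" a]) (use Re_a in auto)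
  obtain K0 where K0: "- Re (sig p a b) < real K0" using reals_Archimedean2 by blast
  define K where "K = K0 + t + 3"
  have K: "Re (sig p a b + of_nat K) > 0" "K \<ge> t + 3" using K0 by (auto simp: K_def)
  obtain C where C: "C \<ge> 0" "\<And>k l. k \<ge> K \<Longrightarrow> norm (A k * h k l) \<le> C * real (Suc k) powr (- 1 - \<epsilon>) * norm (h K l)"
    using coeffA_hyp_bound[OF p eps(2) sig K(1)] unfolding A_def h_def by blast
  (* f is the sum over k of A k * h k, so its partial sums are the sum of A k * S k *)
  have "(\<lambda>k. A k * h k l) sums f l" for l
  proof -
    have "rGamma (a 1 + a 2 - (of_nat t - of_nat k) + of_nat l) = rGamma (sig p a b + of_nat l + of_nat k)" for k
      by (simp add: sig algebra_simps)
    then have eq: "A k * h k l = Gamma (a 1 + of_nat l) * Gamma (a 2 + of_nat l) / fact l *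
       (coeffA p a b k * rGamma (sig p a b + of_nat l + of_nat k))" for k
      by (simp add: A_def h_def hyp_def)
    show ?thesis unfolding eq f_def
      by (intro sums_mult Gamma_quotient_expansion p Re_a)
  qed
  then have "(\<lambda>k. \<Sum>l<m. A k * h k l) sums (\<Sum>l<m. f l)" for m by (intro sums_sum)
  then have sum_f: "(\<lambda>k. A k * S k m) sums (\<Sum>l<m. f l)" for m
    by (simp add: S_def hyp_sum_def h_def sum_distrib_left)
  (* F m differs from its limit by a tail of the dominating series in l *)
  define F where "F m = complex_of_real (\<Sum>l<m. norm (h K l))" for m
  have hK: "growth (- 4) (h K)"
    unfolding h_def by (rule growth_mono[OF hyp_growth]) (use K(2) in simp)
  then have "summable (\<lambda>l. norm (h K l))" by (rule growth_summable) simp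
  then have F_lim: "F \<longlonglongrightarrow> of_real (\<Sum>l. norm (h K l))"
    unfolding F_def[abs_def] by (intro tendsto_of_real summable_LIMSEQ)
  define W where "W m = norm (F m - of_real (\<Sum>l. norm (h K l)))" for m
  have "growth (- 4) (\<lambda>m. F (Suc m) - F m)"
  proof -
    obtain D where "D \<ge> 0" "\<And>n. norm (h K n) \<le> D * real (Suc n) powr (- 4)" using growthE[OF hK] by blast
    then show ?thesis by (intro growthI[where C = D]) (simp add: F_def)
  qed
  from growth_from_increments[OF this _ F_lim]
  have W: "growth (- 3) (\<lambda>m. F m - of_real (\<Sum>l. norm (h K l)))" by simp
  have tail: "norm (A k * (S k m - c k)) \<le> C * real (Suc k) powr (- 1 - \<epsilon>) * W m" if k: "k \<ge> K" for k m
  proof -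
    define D where "D = C * real (Suc k) powr (- 1 - \<epsilon>)"
    have D: "D \<ge> 0" using C by (simp add: D_def)
    have "norm (A k * (S k m - S k (m + n))) \<le> D * norm (F m - F (m + n))" for n
    proof -
      have "S k (m + n) = S k m + (\<Sum>l=m..<m + n. h k l)" "F (m + n) = F m + of_real (\<Sum>l=m..<m + n. norm (h K l))"
        unfolding S_def hyp_sum_def F_def h_def
        by (simp_all add: sum.atLeastLessThan_concat[of 0 m "m + n", symmetric] lessThan_atLeast0 flip: of_real_add of_real_sum)
      then have "norm (A k * (S k m - S k (m + n))) = norm (\<Sum>l=m..<m + n. A k * h k l)"
        and eq: "norm (F m - F (m + n)) = (\<Sum>l=m..<m + n. norm (h K l))"
        by (simp_all add: sum_distrib_left[symmetric] sum_nonneg norm_mult del: of_real_sum)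
      then have "norm (A k * (S k m - S k (m + n))) \<le> (\<Sum>l=m..<m + n. norm (A k * h k l))" using norm_sum by metis
      also have "\<dots> \<le> (\<Sum>l=m..<m + n. D * norm (h K l))" unfolding D_def by (intro sum_mono C k)
      also have "\<dots> = D * norm (F m - F (m + n))" unfolding eq by (simp add: sum_distrib_left)
      finally show ?thesis .
    qed
    moreover have "(\<lambda>n. norm (A k * (S k m - S k (m + n)))) \<longlonglongrightarrow> norm (A k * (S k m - c k))"
    proof -
      have "t < k" using k K(2) by simp
      from LIMSEQ_ignore_initial_segment[OF hyp_sum_convergent_limit[OF a1 a2 this], of m]
      have "(\<lambda>n. S k (m + n)) \<longlonglongrightarrow> c k" by (simp add: S_def c_def add.commute)
      then show ?thesis by (intro tendsto_intros)
    qed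
    moreover have "(\<lambda>n. D * norm (F m - F (m + n))) \<longlonglongrightarrow> D * W m"
    proof -
      from LIMSEQ_ignore_initial_segment[OF F_lim, of m]
      have "(\<lambda>n. F (m + n)) \<longlonglongrightarrow> of_real (\<Sum>l. norm (h K l))" by (simp add: add.commute)
      then show ?thesis unfolding W_def by (intro tendsto_intros)
    qed
    ultimately show ?thesis unfolding D_def[symmetric] by (intro LIMSEQ_le) auto
  qed
  have powr_summable: "summable (\<lambda>k. real (Suc k) powr (- 1 - \<epsilon>))"
    by (rule summable_Suc_powr) (use eps in simp)
  have diff_summable: "summable (\<lambda>k. A k * (S k m - c k))" for m
    by (rule summable_comparison_test'[where N = K, OF summable_mult2[OF summable_mult[OF powr_summable, of C], of "W m"]])
       (rule tail)
  show c_summable: "summable (\<lambda>k. A k * hyp_const (a 1) (a 2) t k)"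
    using summable_minus[OF diff_summable[of 0]] by (simp add: S_def hyp_sum_def c_def)
  define Z where "Z = (\<Sum>k. real (Suc (k + K)) powr (- 1 - \<epsilon>))"
  have "growth (- 3) (\<lambda>m. \<Sum>k. A (k + K) * (S (k + K) m - c (k + K)))"
  proof -
    obtain D where D: "\<And>m. W m \<le> D * real (Suc m) powr (- 3)" using W unfolding W_def growth_def by blast
    have Z: "Z \<ge> 0" unfolding Z_def
      by (intro suminf_nonneg summable_ignore_initial_segment[OF powr_summable]) simp
    show ?thesis
    proof (rule growthI[where C = "C * Z * D"])
      fix m
      have "norm (\<Sum>k. A (k + K) * (S (k + K) m - c (k + K))) \<le> (\<Sum>k. C * real (Suc (k + K)) powr (- 1 - \<epsilon>) * W m)"
        by (intro norm_suminf_le tail summable_mult2 summable_mult summable_ignore_initial_segment[OF powr_summable]) simp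
      also have "\<dots> = C * Z * W m"
        using summable_ignore_initial_segment[OF powr_summable, of K] unfolding Z_def
        by (simp only: suminf_mult suminf_mult2[symmetric] summable_mult)
      also have "\<dots> \<le> C * Z * (D * real (Suc m) powr (- 3))"
        using C(1) Z D by (intro mult_left_mono) auto
      finally show "norm (\<Sum>k. A (k + K) * (S (k + K) m - c (k + K))) \<le> C * Z * D * real (Suc m) powr (- 3)"
        by (simp add: mult.assoc)
    qed
  qed
  moreover have "growth (- 3) (\<lambda>m. \<Sum>k<K. A k * (S k m - R k m - c k))"
    unfolding S_def R_def c_def by (intro growth_sum growth_cmult hyp_sum_asymp a1 a2)
  ultimately have "growth (- 3) (\<lambda>m. (\<Sum>k. A (k + K) * (S (k + K) m - c (k + K))) + (\<Sum>k<K. A k * (S k m - R k m - c k)))"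
    by (rule growth_add)
  moreover have "(\<Sum>k. A (k + K) * (S (k + K) m - c (k + K))) + (\<Sum>k<K. A k * (S k m - R k m - c k))
      = (\<Sum>l<m. f l) - (\<Sum>k<t + 3. A k * R k m) - (\<Sum>k. A k * c k)" for m
  proof -
    have "(\<Sum>l<m. f l) - (\<Sum>k. A k * c k) = (\<Sum>k. A k * S k m - A k * c k)"
      using suminf_diff[OF sums_summable[OF sum_f[of m]] c_summable[folded c_def]] sums_unique[OF sum_f[of m]] by simp
    also have "\<dots> = (\<Sum>k. A k * (S k m - c k))" by (simp add: right_diff_distrib)
    also have "\<dots> = (\<Sum>k. A (k + K) * (S (k + K) m - c (k + K))) + (\<Sum>k<K. A k * (S k m - c k))"
      by (rule suminf_split_initial_segment[OF diff_summable])
    finally have 1: "(\<Sum>l<m. f l) - (\<Sum>k. A k * c k) = \<dots>" .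
    have "(\<Sum>k<K. A k * R k m) = (\<Sum>k<t + 3. A k * R k m)"
      by (rule sum.mono_neutral_right) (use K(2) in \<open>auto simp: R_def hyp_approx_def\<close>)
    then have "(\<Sum>k<K. A k * (S k m - R k m - c k)) = (\<Sum>k<K. A k * (S k m - c k)) - (\<Sum>k<t + 3. A k * R k m)"
      by (simp add: right_diff_distrib sum_subtractf)
    with 1 show ?thesis by (simp add: algebra_simps)
  qed
  ultimately show "growth (- 3) (\<lambda>m.
        (\<Sum>l<m. Gamma (a 1 + of_nat l) * Gamma (a 2 + of_nat l) / fact l *
           ((\<Prod>j=3..p + 1. Gamma (a j + of_nat l)) * (\<Prod>i=1..p. rGamma (b i + of_nat l))))
        - (\<Sum>k<t + 3. A k * hyp_approx (a 1) (a 2) (of_nat t - of_nat k) (t + 3 - k) m)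
        - (\<Sum>k. A k * hyp_const (a 1) (a 2) t k))"
    unfolding f_def R_def c_def by simp
qed

section \<open>Collecting the terms of the expansion\<close>

lemma pochhammer_minus_of_nat:
  "k \<le> n \<Longrightarrow> pochhammer (- of_nat n :: complex) k * fact (n - k) = (- 1) ^ k * fact n"
proof (induction k)
  case (Suc k)
  have nk: "n - k = Suc (n - Suc k)" using Suc.prems by simp
  have "pochhammer (- of_nat n :: complex) (Suc k) * fact (n - Suc k)
      = - (pochhammer (- of_nat n) k * ((of_nat n - of_nat k) * fact (n - Suc k)))"
    by (simp add: pochhammer_rec' algebra_simps)
  also have "(of_nat n - of_nat k) * fact (n - Suc k) = (fact (n - k) :: complex)"
    using Suc.prems by (simp add: nk fact_Suc of_nat_diff)
  finally show ?case using Suc by simp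
qed simp

text \<open>With \<open>i = n - k\<close>, the coefficients depend on \<open>k\<close> through quotients \<open>(a - t)\<^sub>n / (a - t)\<^sub>k\<close>.\<close>

lemma ecf_eq_poch_quot:
  assumes "k \<le> n"
  shows "ecf a b (of_nat t - of_nat k) (n - k) = (- 1) ^ n * (1 / Gamma (1 + of_nat n)) *
     (pochhammer (- of_nat n) k * poch_quot (a - of_nat t) n k * poch_quot (b - of_nat t) n k)"
proof -
  have "(- 1) ^ (n - k) * (fact n :: complex) = (- 1) ^ n * ((- 1) ^ k * fact n)"
    using assms by (simp add: power_diff_conv_inverse)
  also have "\<dots> = (- 1) ^ n * pochhammer (- of_nat n) k * fact (n - k)"
    by (simp add: pochhammer_minus_of_nat[OF assms, symmetric])
  finally have "(- 1) ^ (n - k) / (fact (n - k) :: complex) = (- 1) ^ n * pochhammer (- of_nat n) k / fact n"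
    by (simp add: field_simps)
  moreover have "ecf a b (of_nat t - of_nat k) (n - k)
      = (- 1) ^ (n - k) / fact (n - k) * (poch_quot (a - of_nat t) n k * poch_quot (b - of_nat t) n k)"
    by (simp add: ecf_def poch_quot_def algebra_simps)
  ultimately show ?thesis by (simp add: Gamma_fact)
qed

text \<open>Terms with the same \<open>n = k + i\<close> contribute the same power of \<open>m\<close>.\<close>

lemma sum_hyp_approx:
  "(\<Sum>k<N. A k * hyp_approx a b (of_nat t - of_nat k) (N - k) m)
    = (\<Sum>n<N. (\<Sum>k\<le>n. A k * ecf a b (of_nat t - of_nat k) (n - k)) * antidiff (of_nat t - of_nat n) m)"
proof -
  define g where "g k i = A k * (ecf a b (of_nat t - of_nat k) i * antidiff (of_nat t - of_nat k - of_nat i) m)" for k i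
  have "(\<Sum>k<N. A k * hyp_approx a b (of_nat t - of_nat k) (N - k) m) = (\<Sum>k<N. \<Sum>i<N - k. g k i)"
    by (simp add: hyp_approx_def g_def sum_distrib_left)
  also have "\<dots> = (\<Sum>(k, i)\<in>(SIGMA k:{..<N}. {..<N - k}). g k i)"
    by (simp add: sum.Sigma)
  also have "(SIGMA k:{..<N}. {..<N - k}) = {(k, i). k + i < N}" by auto
  also have "(\<Sum>(k, i)\<in>{(k, i). k + i < N}. g k i) = (\<Sum>n<N. \<Sum>k\<le>n. g k (n - k))"
    by (rule sum.triangle_reindex)
  also have "\<dots> = (\<Sum>n<N. (\<Sum>k\<le>n. A k * ecf a b (of_nat t - of_nat k) (n - k)) * antidiff (of_nat t - of_nat n) m)"
    unfolding sum_distrib_right g_def by (intro sum.cong refl) (simp add: of_nat_diff)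
  finally show ?thesis .
qed

lemma Gamma_minus_of_nat_quot:
  assumes "m > n"
  shows "Gamma (of_nat m - of_nat n) * pochhammer (of_nat m - of_nat n :: complex) n = Gamma (of_nat m)"
proof -
  have "(of_nat m - of_nat n :: complex) \<notin> \<int>\<^sub>\<le>\<^sub>0"
    by (rule Re_pos_not_nonpos_Int) (use assms in simp)
  then show ?thesis using pochhammer_Gamma[of "of_nat m - of_nat n :: complex" n]
    by (simp add: Gamma_eq_zero_iff)
qed

lemma antidiff_minus_1:
  assumes "m > 1"
  shows "antidiff (- 1) m = - inverse (of_nat m - 1)"
proof -
  have "(of_nat m :: complex) - 1 \<noteq> 0" using assms of_nat_eq_iff[of m 1, where ?'a = complex] by auto
  moreover have "Gamma (of_nat m - 1) * (of_nat m - 1) = Gamma (of_nat m :: complex)"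
    using Gamma_minus_of_nat_quot[of 1 m] assms by simp
  moreover have "Gamma (of_nat m :: complex) \<noteq> 0"
    using Re_pos_not_nonpos_Int[of "of_nat m"] assms by (simp add: Gamma_eq_zero_iff)
  ultimately show ?thesis by (simp add: antidiff_def field_simps)
qed

lemma antidiff_minus_2:
  assumes "m > 2"
  shows "antidiff (- 2) m = - inverse (2 * ((of_nat m - 1) * (of_nat m - 2)))"
proof -
  have "(of_nat m :: complex) - 1 \<noteq> 0" "(of_nat m :: complex) - 2 \<noteq> 0"
    using assms of_nat_eq_iff[of m 1, where ?'a = complex] of_nat_eq_iff[of m 2, where ?'a = complex] by auto
  moreover have "Gamma (of_nat m - 2) * ((of_nat m - 1) * (of_nat m - 2)) = Gamma (of_nat m :: complex)"
    using Gamma_minus_of_nat_quot[of 2 m] assms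
    by (simp add: pochhammer_rec numeral_2_eq_2 algebra_simps)
  moreover have "Gamma (of_nat m :: complex) \<noteq> 0"
    using Re_pos_not_nonpos_Int[of "of_nat m"] assms by (simp add: Gamma_eq_zero_iff)
  ultimately show ?thesis by (simp add: antidiff_def divide_simps mult_ac)
qed

lemma growth_imp_bigo:
  assumes "growth (- 3) f"
  shows "f \<in> O(\<lambda>m::nat. inverse (of_nat m ^ 3))"
proof -
  obtain C where C: "C \<ge> 0" "\<And>n. norm (f n) \<le> C * real (Suc n) powr (- 3)"
    using assms growthE by blast
  show ?thesis
  proof (rule bigoI[where c = C])
    show "eventually (\<lambda>m. norm (f m) \<le> C * norm (inverse (of_nat m ^ 3 :: complex))) sequentially"
      using eventually_gt_at_top[of 0]
    proof eventually_elim
      case (elim m)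
      have "real (Suc m) powr (- 3) = inverse (real (Suc m) ^ 3)"
        by (simp add: powr_minus powr_realpow[of "real (Suc m)" 3, simplified] del: of_nat_Suc)
      also have "\<dots> \<le> inverse (real m ^ 3)" using elim by (intro le_imp_inverse_le power_mono) auto
      finally have "C * real (Suc m) powr (- 3) \<le> C * inverse (real m ^ 3)" using C(1) by (rule mult_left_mono)
      with C(2)[of m] show ?case by (simp add: norm_inverse norm_power)
    qed
  qed
qed

theorem theorem7:
  fixes p t :: nat and a b :: "nat \<Rightarrow> complex"
  assumes p: "p \<ge> 1"
    and a_nonpole: "\<And>j. j \<in> {1..p + 1} \<Longrightarrow> a j \<notin> \<int>\<^sub>\<le>\<^sub>0"
    and Re_a: "\<And>j. j \<in> {3..p + 1} \<Longrightarrow> Re (a j) > 0"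
    and t: "t \<ge> 1"
    and s_p: "(\<Sum>i=1..p. b i) - (\<Sum>j=1..p + 1. a j) = - of_nat t"
  shows
    "summable (\<lambda>k. Gamma (of_nat (Suc k))
        / (pochhammer (a 1) (Suc k) * pochhammer (a 2) (Suc k)) * coeffA p a b (t + Suc k))
     \<and>
     (\<lambda>m.
        (\<Sum>l<m. (\<Prod>j=1..p + 1. Gamma (a j + of_nat l)) * (\<Prod>i=1..p. rGamma (b i + of_nat l))
                / Gamma (1 + of_nat l))
      - ( (\<Sum>n<t. (-1) ^ n * (1 / (of_nat t - of_nat n)) * (1 / Gamma (1 + of_nat n))
                * (Gamma (of_nat t - of_nat n + of_nat m) / Gamma (of_nat m))
                * (\<Sum>k\<le>n. pochhammer (- of_nat n) k
                      * poch_quot (a 1 - of_nat t) n k * poch_quot (a 2 - of_nat t) n k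
                      * coeffA p a b k))
        + (\<Sum>k. Gamma (of_nat (Suc k))
                / (pochhammer (a 1) (Suc k) * pochhammer (a 2) (Suc k)) * coeffA p a b (t + Suc k))
        + (-1) ^ t * (1 / Gamma (1 + of_nat t))
                * (\<Sum>k\<le>t. pochhammer (- of_nat t) k
                      * poch_quot (a 1 - of_nat t) t k * poch_quot (a 2 - of_nat t) t k
                      * coeffA p a b k
                      * (Digamma (1 + of_nat t - of_nat k) - Digamma (a 1) - Digamma (a 2)
                         + Digamma (of_nat m)))
        + (-1) ^ t * (1 / Gamma (2 + of_nat t))
                * (\<Sum>k\<le>t + 1. pochhammer (- of_nat t - 1) k
                      * poch_quot (a 1 - of_nat t) (t + 1) k * poch_quot (a 2 - of_nat t) (t + 1) k
                      * coeffA p a b k)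
                * inverse (of_nat m - 1)
        - (-1) ^ t * (1 / (2 * Gamma (3 + of_nat t)))
                * (\<Sum>k\<le>t + 2. pochhammer (- of_nat t - 2) k
                      * poch_quot (a 1 - of_nat t) (t + 2) k * poch_quot (a 2 - of_nat t) (t + 2) k
                      * coeffA p a b k)
                * inverse ((of_nat m - 1) * (of_nat m - 2))))
     \<in> O(\<lambda>m::nat. inverse (of_nat m ^ 3))"
proof -
  define A where "A = coeffA p a b"
  define c where "c n = (\<Sum>k\<le>n. A k * ecf (a 1) (a 2) (of_nat t - of_nat k) (n - k))" for n
  define const where "const = hyp_const (a 1) (a 2) t"
  define Q where "Q n = (\<Sum>k\<le>n. pochhammer (- of_nat n) k
                      * poch_quot (a 1 - of_nat t) n k * poch_quot (a 2 - of_nat t) n k * A k)" for n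
  define tail where "tail k = Gamma (of_nat (Suc k)) / (pochhammer (a 1) (Suc k) * pochhammer (a 2) (Suc k)) * A (t + Suc k)" for k
  define f where "f l = (\<Prod>j=1..p + 1. Gamma (a j + of_nat l)) * (\<Prod>i=1..p. rGamma (b i + of_nat l))
                / Gamma (1 + of_nat l)" for l
  have split_a: "{1..p + 1} = insert 1 (insert 2 {3..p + 1})" using p by auto
  have sig: "sig p a b = a 1 + a 2 - of_nat t"
  proof -
    have "(\<Sum>j=1..p + 1. a j) = a 1 + a 2 + (\<Sum>j=3..p + 1. a j)"
      unfolding split_a by (simp del: sum.cl_ivl_Suc)
    then show ?thesis using s_p unfolding sig_def by (simp add: algebra_simps del: sum.cl_ivl_Suc)
  qed
  have a12: "a 1 \<notin> \<int>\<^sub>\<le>\<^sub>0" "a 2 \<notin> \<int>\<^sub>\<le>\<^sub>0" using a_nonpole p by auto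
  have f_eq: "f l = Gamma (a 1 + of_nat l) * Gamma (a 2 + of_nat l) / fact l *
           ((\<Prod>j=3..p + 1. Gamma (a j + of_nat l)) * (\<Prod>i=1..p. rGamma (b i + of_nat l)))" for l
  proof -
    have "(\<Prod>j=1..p + 1. Gamma (a j + of_nat l))
        = Gamma (a 1 + of_nat l) * Gamma (a 2 + of_nat l) * (\<Prod>j=3..p + 1. Gamma (a j + of_nat l))"
      unfolding split_a by (simp del: prod.cl_ivl_Suc)
    then show ?thesis by (simp only: f_def Gamma_fact) simp
  qed
  note asymp = partial_sums_asymp[OF p a12 Re_a sig, folded A_def]
  have c_Q: "c n = (- 1) ^ n * (1 / Gamma (1 + of_nat n)) * Q n" for n
    unfolding c_def Q_def sum_distrib_left
    by (intro sum.cong refl) (simp add: ecf_eq_poch_quot mult_ac)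
  have const_tail: "A (k + (t + 1)) * const (k + (t + 1)) = tail k" for k
    by (simp add: const_def hyp_const_def tail_def add_ac del: of_nat_Suc pochhammer_Suc)
  have summable_const: "summable (\<lambda>k. A k * const k)" using asymp(1) by (simp add: const_def)
  have tail_summable: "summable tail"
    using summable_ignore_initial_segment[OF summable_const, of "t + 1"] unfolding const_tail .
  have sum_const: "(\<Sum>k. A k * const k) = (\<Sum>k. tail k) +
     (- 1) ^ t * (1 / Gamma (1 + of_nat t)) * (\<Sum>k\<le>t. pochhammer (- of_nat t) k
                      * poch_quot (a 1 - of_nat t) t k * poch_quot (a 2 - of_nat t) t k
                      * A k * (Digamma (1 + of_nat t - of_nat k) - Digamma (a 1) - Digamma (a 2)))"
  proof -
    have "(\<Sum>k<t + 1. A k * const k) = (\<Sum>k\<le>t. A k * const k)"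
      by (simp add: lessThan_Suc_atMost)
    also have "\<dots> = (- 1) ^ t * (1 / Gamma (1 + of_nat t)) * (\<Sum>k\<le>t. pochhammer (- of_nat t) k
                      * poch_quot (a 1 - of_nat t) t k * poch_quot (a 2 - of_nat t) t k
                      * A k * (Digamma (1 + of_nat t - of_nat k) - Digamma (a 1) - Digamma (a 2)))"
      unfolding sum_distrib_left
      by (intro sum.cong refl) (simp add: const_def hyp_const_def ecf_eq_poch_quot mult_ac)
    finally show ?thesis
      using suminf_split_initial_segment[OF summable_const, of "t + 1"] unfolding const_tail by simp
  qed
  (* E is the expansion in the statement; the identity with the collected terms holds for m > 2, where
     m - 1 and m - 2 are nonzero *)
  define E where "E m = (\<Sum>n<t. (-1) ^ n * (1 / (of_nat t - of_nat n)) * (1 / Gamma (1 + of_nat n))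
                * (Gamma (of_nat t - of_nat n + of_nat m) / Gamma (of_nat m)) * Q n)
        + (\<Sum>k. tail k)
        + (-1) ^ t * (1 / Gamma (1 + of_nat t))
                * (\<Sum>k\<le>t. pochhammer (- of_nat t) k
                      * poch_quot (a 1 - of_nat t) t k * poch_quot (a 2 - of_nat t) t k
                      * A k
                      * (Digamma (1 + of_nat t - of_nat k) - Digamma (a 1) - Digamma (a 2)
                         + Digamma (of_nat m)))
        + (-1) ^ t * (1 / Gamma (2 + of_nat t)) * Q (t + 1) * inverse (of_nat m - 1)
        - (-1) ^ t * (1 / (2 * Gamma (3 + of_nat t))) * Q (t + 2)
                * inverse ((of_nat m - 1) * (of_nat m - 2))" for m :: nat
  have E_eq: "(\<Sum>k<t + 3. A k * hyp_approx (a 1) (a 2) (of_nat t - of_nat k) (t + 3 - k) m) + (\<Sum>k. A k * const k) = E m"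
    if m: "m > 2" for m
  proof -
    have "(\<Sum>k<t + 3. A k * hyp_approx (a 1) (a 2) (of_nat t - of_nat k) (t + 3 - k) m)
        = (\<Sum>n<t + 3. c n * antidiff (of_nat t - of_nat n) m)"
      unfolding sum_hyp_approx c_def ..
    also have "\<dots> = (\<Sum>n<t. c n * antidiff (of_nat t - of_nat n) m) + c t * antidiff 0 m
        + c (t + 1) * antidiff (- 1) m + c (t + 2) * antidiff (- 2) m"
      by (simp add: numeral_3_eq_3)
    also have "(\<Sum>n<t. c n * antidiff (of_nat t - of_nat n) m) = (\<Sum>n<t. (-1) ^ n * (1 / (of_nat t - of_nat n)) * (1 / Gamma (1 + of_nat n))
                * (Gamma (of_nat t - of_nat n + of_nat m) / Gamma (of_nat m)) * Q n)"
      by (intro sum.cong refl) (auto simp: c_Q antidiff_def mult_ac)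
    also have "c (t + 1) * antidiff (- 1) m = (-1) ^ t * (1 / Gamma (2 + of_nat t)) * Q (t + 1) * inverse (of_nat m - 1)"
      using m by (simp add: c_Q antidiff_minus_1 add_ac)
    also have "c (t + 2) * antidiff (- 2) m = - ((-1) ^ t * (1 / (2 * Gamma (3 + of_nat t))) * Q (t + 2)
                * inverse ((of_nat m - 1) * (of_nat m - 2)))"
      using m by (simp add: c_Q antidiff_minus_2 add_ac)
    also have "c t * antidiff 0 m = (-1) ^ t * (1 / Gamma (1 + of_nat t))
                * (\<Sum>k\<le>t. pochhammer (- of_nat t) k
                      * poch_quot (a 1 - of_nat t) t k * poch_quot (a 2 - of_nat t) t k
                      * A k * Digamma (of_nat m))"
      by (simp add: c_Q Q_def antidiff_def sum_distrib_right)
    finally show ?thesis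
      unfolding sum_const E_def by (simp only: distrib_left sum.distrib) (simp only: add_ac diff_conv_add_uminus)
  qed
  have "growth (- 3) (\<lambda>m. (\<Sum>l<m. f l) - (\<Sum>k<t + 3. A k * hyp_approx (a 1) (a 2) (of_nat t - of_nat k) (t + 3 - k) m)
        - (\<Sum>k. A k * const k))"
    unfolding f_eq const_def by (rule asymp(2))
  then have "growth (- 3) (\<lambda>m. (\<Sum>l<m. f l) - E m)"
    by (rule growth_cong_eventually)
       (use eventually_gt_at_top[of 2] in eventually_elim, simp only: E_eq[symmetric] diff_diff_add)
  then have "(\<lambda>m. (\<Sum>l<m. f l) - E m) \<in> O(\<lambda>m::nat. inverse (of_nat m ^ 3))"
    by (rule growth_imp_bigo)
  moreover have "- of_nat t - 1 = (- of_nat (t + 1) :: complex)" "- of_nat t - 2 = (- of_nat (t + 2) :: complex)"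
    by simp_all
  ultimately show ?thesis
    using tail_summable unfolding f_def E_def Q_def tail_def A_def by (simp only: simp_thms)
qed

end
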